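(* Let $p$ be a prime number and let $K$ be a field containing a primitive $p$-th root of unity. Then $\mathcal{R}_p(K)/K^{\times p}\cong \mathcal{R}_p(G_K)$. In particular, for $p=2$ we have $\mathcal{R}_{\mathrm{K}}(K)/K^{\times 2}\cong \mathcal{R}_2(G_K)$, and $K$ satisfies the H-conjecture if and only if $G_K$ has the $2$-Kijima--Nishi property.
   Context: $G_K=\mathrm{Gal}(K^{\mathrm{sep}}/K)$ is the absolute Galois group of $K$. The $p$-radical of a field $K$ containing a primitive $p$-th root of unity is $\mathcal{R}_p(K)=\bigcap_{a\in K^\times}N_{K(\sqrt[p]{a})/K}\big(K(\sqrt[p]{a})^\times\big)\subseteq K^\times$. For $K$ of characteristic $\neq 2$, the Kaplansky radical is $\mathcal{R}_{\mathrm{K}}(K)=\{a\in K^\times : D_K\langle 1,-a\rangle=K^\times\}$, where $D_K\langle 1,-a\rangle$ is the set of non-zero elements of $K$ represented by the binary quadratic form $X^2-aY^2$; it coincides with $\mathcal{R}_2(K)$. $K$ satisfies the H-conjecture if for every quadratic extension $K(\sqrt a)/K$ (with $a\in K^\times$ a non-square) one has $N_{K(\sqrt a)/K}^{-1}(\mathcal{R}_{\mathrm{K}}(K))=\mathcal{R}_{\mathrm{K}}(K(\sqrt a))\cdot K^\times$. For a profinite group $G$, $\mathrm{H}^n(G,\mathbb{F}_p)$ is continuous cohomology with trivial coefficients and $\mathcal{R}_p(G)=\{\alpha\in \mathrm{H}^1(G,\mathbb{F}_p) : \alpha\smile\beta=0 \text{ for all }\beta\in \mathrm{H}^1(G,\mathbb{F}_p)\}$.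 For an open subgroup $U\le G$, corestriction maps $\mathcal{R}_p(U)$ into $\mathcal{R}_p(G)$, inducing $c_{U,G}:\mathcal{R}_p(U)\to\mathcal{R}_p(G)$. $G$ has the $p$-Kijima--Nishi property if $c_{U,G}$ is surjective for every open normal subgroup $U$ of index $p$. *)

theory Defs
  imports
    "HOL-Algebra.Algebra"
    "HOL-Algebra.Algebraic_Closure_Type"
    "HOL-Analysis.Function_Topology"
    "Jordan_Normal_Form.Determinant"
begin

section \<open>Fields inside an algebraically closed field\<close>

text \<open>
  Fields are subfields \<open>K\<close> of an algebraically closed field, given by a type
  \<open>'c :: alg_closed_field\<close>. This fixes the separable closure of \<open>K\<close> and makes every algebraic
  extension of \<open>K\<close> that is considered a subset of \<open>'c\<close>. A field given as a type \<open>'a :: field\<close> is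
  covered as \<open>range to_ac\<close> inside \<open>'a alg_closure\<close>. The structure \<open>ring_of_type_algebra\<close> is the
  whole type regarded as a ring in the sense of HOL-Algebra.
\<close>

abbreviation field_on :: "'c::field set \<Rightarrow> 'c ring" where
  "field_on K \<equiv> ring_of_type_algebra\<lparr>carrier := K\<rparr>"

abbreviation adjoin :: "'c::field set \<Rightarrow> 'c \<Rightarrow> 'c set" where
  "adjoin K \<alpha> \<equiv> generate_field ring_of_type_algebra (insert \<alpha> K)"

definition primitive_root_of_unity :: "nat \<Rightarrow> 'c::field \<Rightarrow> bool" where
  "primitive_root_of_unity p \<zeta> \<longleftrightarrow> \<zeta> ^ p = 1 \<and> (\<forall>k. 0 < k \<and> k < p \<longrightarrow> \<zeta> ^ k \<noteq> 1)"

definition is_basis :: "'c::field set \<Rightarrow> 'c set \<Rightarrow> 'c list \<Rightarrow> bool" where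
  "is_basis K L us \<longleftrightarrow> ring.independent ring_of_type_algebra K us \<and>
     ring.Span ring_of_type_algebra K us = L"

text \<open>
  \<open>field_norm K L x\<close> is the norm of \<open>x\<close> for a finite extension \<open>L/K\<close>: the determinant of
  multiplication by \<open>x\<close> on the \<open>K\<close>-vector space \<open>L\<close>, computed in any basis \<open>us\<close>.
\<close>

definition field_norm :: "'c::field set \<Rightarrow> 'c set \<Rightarrow> 'c \<Rightarrow> 'c" where
  "field_norm K L x = (THE d. \<exists>us A. is_basis K L us \<and>
     A \<in> carrier_mat (length us) (length us) \<and> elements_mat A \<subseteq> K \<and>
     (\<forall>j<length us. x * us ! j = (\<Sum>i<length us. A $$ (i, j) * us ! i)) \<and>
     d = Determinant.det A)"

text \<open>
  The field \<open>K(a\<^sup>1\<^sup>/\<^sup>p)\<close> is \<open>adjoin K \<alpha>\<close> for any \<open>\<alpha>\<close> with \<open>\<alpha> ^ p = a\<close>; if \<open>K\<close> contains a primitive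
  \<open>p\<close>-th root of unity, it does not depend on the choice of \<open>\<alpha>\<close>.
\<close>

definition p_radical :: "nat \<Rightarrow> 'c::alg_closed_field set \<Rightarrow> 'c set" where
  "p_radical p K = {x \<in> K - {0}. \<forall>a \<in> K - {0}. \<forall>\<alpha>. \<alpha> ^ p = a \<longrightarrow>
     x \<in> field_norm K (adjoin K \<alpha>) ` (adjoin K \<alpha> - {0})}"

text \<open>
  \<open>D\<^sub>K\<langle>1,-a\<rangle>\<close>.
\<close>

definition represented :: "'c::field set \<Rightarrow> 'c \<Rightarrow> 'c set" where
  "represented K a = {x ^ 2 - a * y ^ 2 | x y. x \<in> K \<and> y \<in> K} - {0}"

definition kaplansky_radical :: "'c::field set \<Rightarrow> 'c set" where
  "kaplansky_radical K = {a \<in> K - {0}. represented K a = K - {0}}"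

definition H_conjecture :: "'c::alg_closed_field set \<Rightarrow> bool" where
  "H_conjecture K \<longleftrightarrow>
     (\<forall>a \<in> K - {0}. (\<nexists>b. b \<in> K \<and> b ^ 2 = a) \<longrightarrow> (\<forall>\<alpha>. \<alpha> ^ 2 = a \<longrightarrow>
        {x \<in> adjoin K \<alpha> - {0}. field_norm K (adjoin K \<alpha>) x \<in> kaplansky_radical K} =
        {r * c | r c. r \<in> kaplansky_radical (adjoin K \<alpha>) \<and> c \<in> K - {0}}))"

text \<open>
  The quotient \<open>R/K\<^sup>\<times>\<^sup>p\<close> of a group \<open>R\<close> with \<open>K\<^sup>\<times>\<^sup>p \<subseteq> R \<subseteq> K\<^sup>\<times>\<close>.
\<close>

definition mod_powers :: "nat \<Rightarrow> 'c::field set \<Rightarrow> 'c set \<Rightarrow> 'c set monoid" where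
  "mod_powers p K R = (Multiplicative_Group.mult_of (field_on K))\<lparr>carrier := R\<rparr> Mod ((\<lambda>x. x ^ p) ` (K - {0}))"


section \<open>The absolute Galois group\<close>

text \<open>
  An element is separable over \<open>K\<close> if it is a root of a polynomial over \<open>K\<close> that has only simple
  roots in the ambient algebraically closed field.
\<close>

definition separable_closure :: "'c::alg_closed_field set \<Rightarrow> 'c set" where
  "separable_closure K =
     {x. \<exists>f. (\<forall>i. coeff f i \<in> K) \<and> rsquarefree f \<and> poly f x = 0}"

definition absolute_galois_group :: "'c::alg_closed_field set \<Rightarrow> ('c \<Rightarrow> 'c) monoid" where
  "absolute_galois_group K = (BijGroup (separable_closure K))
     \<lparr>carrier := {\<sigma> \<in> Bij (separable_closure K).
        \<sigma> \<in> Ring.ring_hom (field_on (separable_closure K)) (field_on (separable_closure K)) \<and>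
        (\<forall>x\<in>K. \<sigma> x = x)}\<rparr>"

text \<open>
  The Krull topology. The basic neighbourhoods of \<open>\<sigma>\<close> are the cosets \<open>\<sigma> Gal(K\<^sup>s\<^sup>e\<^sup>p/K(F))\<close> for finite
  \<open>F\<close>; the fields \<open>K(F)\<close> are exactly the finite subextensions of \<open>K\<^sup>s\<^sup>e\<^sup>p/K\<close>.
\<close>

definition krull_open :: "'c::alg_closed_field set \<Rightarrow> ('c \<Rightarrow> 'c) set \<Rightarrow> bool" where
  "krull_open K U \<longleftrightarrow> U \<subseteq> carrier (absolute_galois_group K) \<and>
     (\<forall>\<sigma>\<in>U. \<exists>F. finite F \<and> F \<subseteq> separable_closure K \<and>
        {\<tau> \<in> carrier (absolute_galois_group K). \<forall>x\<in>F. \<tau> x = \<sigma> x} \<subseteq> U)"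

definition krull_topology :: "'c::alg_closed_field set \<Rightarrow> ('c \<Rightarrow> 'c) topology" where
  "krull_topology K = topology (krull_open K)"

lemma istopology_krull_open: "istopology (krull_open K)"
  unfolding istopology_def
proof (intro conjI allI impI)
  fix S T assume S: "krull_open K S" and T: "krull_open K T"
  show "krull_open K (S \<inter> T)"
    unfolding krull_open_def
  proof (intro conjI ballI)
    show "S \<inter> T \<subseteq> carrier (absolute_galois_group K)"
      using S by (auto simp: krull_open_def)
  next
    fix \<sigma> assume \<sigma>: "\<sigma> \<in> S \<inter> T"
    obtain F where F: "finite F" "F \<subseteq> separable_closure K"
      "{\<tau> \<in> carrier (absolute_galois_group K). \<forall>x\<in>F. \<tau> x = \<sigma> x} \<subseteq> S"
      using S \<sigma> unfolding krull_open_def by blast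
    obtain F' where F': "finite F'" "F' \<subseteq> separable_closure K"
      "{\<tau> \<in> carrier (absolute_galois_group K). \<forall>x\<in>F'. \<tau> x = \<sigma> x} \<subseteq> T"
      using T \<sigma> unfolding krull_open_def by blast
    show "\<exists>F. finite F \<and> F \<subseteq> separable_closure K \<and>
        {\<tau> \<in> carrier (absolute_galois_group K). \<forall>x\<in>F. \<tau> x = \<sigma> x} \<subseteq> S \<inter> T"
      using F F' by (intro exI[of _ "F \<union> F'"]) auto
  qed
next
  fix \<K> assume \<K>: "\<forall>S\<in>\<K>. krull_open K S"
  show "krull_open K (\<Union>\<K>)"
    unfolding krull_open_def
  proof (intro conjI ballI)
    show "\<Union>\<K> \<subseteq> carrier (absolute_galois_group K)"
      using \<K> by (auto simp: krull_open_def)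
  next
    fix \<sigma> assume "\<sigma> \<in> \<Union>\<K>"
    then obtain S where S: "S \<in> \<K>" "\<sigma> \<in> S" by blast
    then show "\<exists>F. finite F \<and> F \<subseteq> separable_closure K \<and>
        {\<tau> \<in> carrier (absolute_galois_group K). \<forall>x\<in>F. \<tau> x = \<sigma> x} \<subseteq> \<Union>\<K>"
      using \<K> unfolding krull_open_def by (meson Union_upper order_trans)
  qed
qed

lemma openin_krull_topology: "openin (krull_topology K) U \<longleftrightarrow> krull_open K U"
  unfolding krull_topology_def using topology_inverse'[OF istopology_krull_open] by metis

lemma topspace_krull_topology: "topspace (krull_topology K) = carrier (absolute_galois_group K)"
proof -
  have "krull_open K (carrier (absolute_galois_group K))"
    by (auto simp: krull_open_def)
  then show ?thesis
    unfolding topspace_def openin_krull_topology by (auto simp: krull_open_def)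
qed


section \<open>Continuous cohomology with trivial coefficients\<close>

text \<open>
  A topological group is given by its group structure \<open>G\<close> and its topology \<open>T\<close>. The field
  \<open>F\<^sub>p\<close> is \<open>{0..<p}\<close> with arithmetic modulo \<open>p\<close>. Cochains of degree \<open>n\<close> are inhomogeneous:
  functions on \<open>G\<^sup>n\<close>, whose elements are the extensional functions on \<open>{..<n}\<close>.
\<close>

abbreviation powers :: "('g, 'm) monoid_scheme \<Rightarrow> nat \<Rightarrow> (nat \<Rightarrow> 'g) set" where
  "powers G n \<equiv> {..<n} \<rightarrow>\<^sub>E carrier G"

definition cochains ::
    "nat \<Rightarrow> ('g, 'm) monoid_scheme \<Rightarrow> 'g topology \<Rightarrow> nat \<Rightarrow> ((nat \<Rightarrow> 'g) \<Rightarrow> int) set" where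
  "cochains p G T n = {\<phi> \<in> extensional (powers G n).
     continuous_map (product_topology (\<lambda>_. T) {..<n}) (discrete_topology {0..<int p}) \<phi>}"

definition cochain_group ::
    "nat \<Rightarrow> ('g, 'm) monoid_scheme \<Rightarrow> 'g topology \<Rightarrow> nat \<Rightarrow> ((nat \<Rightarrow> 'g) \<Rightarrow> int) monoid" where
  "cochain_group p G T n =
     \<lparr>carrier = cochains p G T n,
      monoid.mult = \<lambda>\<phi> \<psi>. \<lambda>x\<in>powers G n. (\<phi> x + \<psi> x) mod int p,
      one = \<lambda>x\<in>powers G n. 0\<rparr>"

text \<open>
  For \<open>x = (x\<^sub>0,\<dots>,x\<^sub>n)\<close> the faces are \<open>(x\<^sub>1,\<dots>,x\<^sub>n)\<close> for \<open>i = 0\<close>, \<open>(\<dots>,x\<^sub>i\<^sub>-\<^sub>1 x\<^sub>i,\<dots>)\<close> for \<open>1 \<le> i \<le> n\<close>,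
  and \<open>(x\<^sub>0,\<dots>,x\<^sub>n\<^sub>-\<^sub>1)\<close> for \<open>i = n + 1\<close>.
\<close>

definition face ::
    "('g, 'm) monoid_scheme \<Rightarrow> nat \<Rightarrow> nat \<Rightarrow> (nat \<Rightarrow> 'g) \<Rightarrow> (nat \<Rightarrow> 'g)" where
  "face G n i x = (\<lambda>j\<in>{..<n}.
     if j + 1 < i then x j
     else if j + 1 = i then x j \<otimes>\<^bsub>G\<^esub> x (j + 1)
     else x (j + 1))"

definition coboundary ::
    "nat \<Rightarrow> ('g, 'm) monoid_scheme \<Rightarrow> nat \<Rightarrow> ((nat \<Rightarrow> 'g) \<Rightarrow> int) \<Rightarrow> ((nat \<Rightarrow> 'g) \<Rightarrow> int)" where
  "coboundary p G n \<phi> = (\<lambda>x\<in>powers G (n + 1).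
     (\<Sum>i\<le>n + 1. (- 1) ^ i * \<phi> (face G n i x)) mod int p)"

definition cocycles ::
    "nat \<Rightarrow> ('g, 'm) monoid_scheme \<Rightarrow> 'g topology \<Rightarrow> nat \<Rightarrow> ((nat \<Rightarrow> 'g) \<Rightarrow> int) set" where
  "cocycles p G T n =
     {\<phi> \<in> cochains p G T n. coboundary p G n \<phi> = \<one>\<^bsub>cochain_group p G T (n + 1)\<^esub>}"

definition coboundaries ::
    "nat \<Rightarrow> ('g, 'm) monoid_scheme \<Rightarrow> 'g topology \<Rightarrow> nat \<Rightarrow> ((nat \<Rightarrow> 'g) \<Rightarrow> int) set" where
  "coboundaries p G T n = (case n of
     0 \<Rightarrow> {\<one>\<^bsub>cochain_group p G T 0\<^esub>}
   | Suc m \<Rightarrow> coboundary p G m ` cochains p G T m)"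

definition cohomology ::
    "nat \<Rightarrow> ('g, 'm) monoid_scheme \<Rightarrow> 'g topology \<Rightarrow> nat \<Rightarrow> ((nat \<Rightarrow> 'g) \<Rightarrow> int) set monoid" where
  "cohomology p G T n =
     (cochain_group p G T n)\<lparr>carrier := cocycles p G T n\<rparr> Mod coboundaries p G T n"

abbreviation cochain_class ::
    "nat \<Rightarrow> ('g, 'm) monoid_scheme \<Rightarrow> 'g topology \<Rightarrow> nat \<Rightarrow> ((nat \<Rightarrow> 'g) \<Rightarrow> int) \<Rightarrow>
       ((nat \<Rightarrow> 'g) \<Rightarrow> int) set" where
  "cochain_class p G T n \<phi> \<equiv> coboundaries p G T n #>\<^bsub>cochain_group p G T n\<^esub> \<phi>"

definition cochain_cup ::
    "nat \<Rightarrow> ('g, 'm) monoid_scheme \<Rightarrow> nat \<Rightarrow> nat \<Rightarrow>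
       ((nat \<Rightarrow> 'g) \<Rightarrow> int) \<Rightarrow> ((nat \<Rightarrow> 'g) \<Rightarrow> int) \<Rightarrow> ((nat \<Rightarrow> 'g) \<Rightarrow> int)" where
  "cochain_cup p G m n \<phi> \<psi> = (\<lambda>x\<in>powers G (m + n).
     (\<phi> (restrict x {..<m}) * \<psi> (\<lambda>i\<in>{..<n}. x (m + i))) mod int p)"

text \<open>
  Operations on classes are unions over all representatives; every representative contributes
  the same coset.
\<close>

definition cup ::
    "nat \<Rightarrow> ('g, 'm) monoid_scheme \<Rightarrow> 'g topology \<Rightarrow> nat \<Rightarrow> nat \<Rightarrow>
       ((nat \<Rightarrow> 'g) \<Rightarrow> int) set \<Rightarrow> ((nat \<Rightarrow> 'g) \<Rightarrow> int) set \<Rightarrow> ((nat \<Rightarrow> 'g) \<Rightarrow> int) set" where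
  "cup p G T m n \<alpha> \<beta> =
     (\<Union>\<phi>\<in>\<alpha>. \<Union>\<psi>\<in>\<beta>. cochain_class p G T (m + n) (cochain_cup p G m n \<phi> \<psi>))"

definition group_radical ::
    "nat \<Rightarrow> ('g, 'm) monoid_scheme \<Rightarrow> 'g topology \<Rightarrow> ((nat \<Rightarrow> 'g) \<Rightarrow> int) set set" where
  "group_radical p G T = {\<alpha> \<in> carrier (cohomology p G T 1).
     \<forall>\<beta> \<in> carrier (cohomology p G T 1). cup p G T 1 1 \<alpha> \<beta> = \<one>\<^bsub>cohomology p G T 2\<^esub>}"


section \<open>Corestriction\<close>

primrec partial_product :: "('g, 'm) monoid_scheme \<Rightarrow> (nat \<Rightarrow> 'g) \<Rightarrow> nat \<Rightarrow> 'g" where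
  "partial_product G x 0 = \<one>\<^bsub>G\<^esub>"
| "partial_product G x (Suc i) = partial_product G x i \<otimes>\<^bsub>G\<^esub> x i"

definition coset_rep :: "'g set \<Rightarrow> 'g" where
  "coset_rep C = (SOME r. r \<in> C)"

text \<open>
  For an open subgroup \<open>U\<close> of finite index, write \<open>r(C)\<close> for the chosen representative of a coset
  \<open>C = Ug\<close>. On homogeneous cochains corestriction sends \<open>\<Phi>\<close> to
  \<open>(h\<^sub>0,\<dots>,h\<^sub>n) \<mapsto> \<Sum>\<^sub>C \<Phi>(r(C) h\<^sub>0 r(C h\<^sub>0)\<^sup>-\<^sup>1, \<dots>, r(C) h\<^sub>n r(C h\<^sub>n)\<^sup>-\<^sup>1)\<close> (trivial coefficients).
  Substituting \<open>h\<^sub>i = x\<^sub>0 \<cdots> x\<^sub>i\<^sub>-\<^sub>1\<close> gives the inhomogeneous formula below. For \<open>n = 1\<close> it is the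
  map \<open>Hom(U, F\<^sub>p) \<rightarrow> Hom(G, F\<^sub>p)\<close> dual to the transfer.
\<close>

definition cochain_cores ::
    "nat \<Rightarrow> ('g, 'm) monoid_scheme \<Rightarrow> 'g set \<Rightarrow> nat \<Rightarrow>
       ((nat \<Rightarrow> 'g) \<Rightarrow> int) \<Rightarrow> ((nat \<Rightarrow> 'g) \<Rightarrow> int)" where
  "cochain_cores p G U n \<phi> = (\<lambda>x\<in>powers G n.
     (\<Sum>C\<in>rcosets\<^bsub>G\<^esub> U. \<phi> (\<lambda>i\<in>{..<n}.
        coset_rep (C #>\<^bsub>G\<^esub> partial_product G x i) \<otimes>\<^bsub>G\<^esub> x i \<otimes>\<^bsub>G\<^esub>
        inv\<^bsub>G\<^esub> (coset_rep (C #>\<^bsub>G\<^esub> partial_product G x (Suc i))))) mod int p)"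

definition corestriction ::
    "nat \<Rightarrow> ('g, 'm) monoid_scheme \<Rightarrow> 'g topology \<Rightarrow> 'g set \<Rightarrow> nat \<Rightarrow>
       ((nat \<Rightarrow> 'g) \<Rightarrow> int) set \<Rightarrow> ((nat \<Rightarrow> 'g) \<Rightarrow> int) set" where
  "corestriction p G T U n \<alpha> = (\<Union>\<phi>\<in>\<alpha>. cochain_class p G T n (cochain_cores p G U n \<phi>))"

definition kijima_nishi :: "nat \<Rightarrow> ('g, 'm) monoid_scheme \<Rightarrow> 'g topology \<Rightarrow> bool" where
  "kijima_nishi p G T \<longleftrightarrow>
     (\<forall>U. openin T U \<and> U \<lhd> G \<and> card (rcosets\<^bsub>G\<^esub> U) = p \<longrightarrow>
        corestriction p G T U 1 ` group_radical p (G\<lparr>carrier := U\<rparr>) (subtopology T U) =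
        group_radical p G T)"

end

theory Submission
  imports Defs
begin

text \<open>
  By Kummer theory \<open>K\<^sup>\<times>/K\<^sup>\<times>\<^sup>p \<cong> H\<^sup>1(G\<^sub>K, F\<^sub>p)\<close>, \<open>b \<mapsto> \<chi>\<^sub>b\<close>, so the isomorphism of radicals amounts to the
  equivalence: \<open>\<chi>\<^sub>b \<smile> \<chi>\<^sub>a = 0\<close> if and only if \<open>b\<close> is a norm from \<open>K(a\<^sup>1\<^sup>/\<^sup>p)\<close>. Instead of passing through
  the Brauer group, this is shown with explicit cochains: a trivialization \<open>f\<close> of the cup product
  restricts to a character of the stabilizer of \<open>a\<^sup>1\<^sup>/\<^sup>p\<close>, whose Kummer generator yields an element of
  norm \<open>b\<close>, and conversely.

  Corestriction of \<open>\<chi>\<^sub>y\<close> is \<open>\<chi>\<close> of the norm of \<open>y\<close>. For \<open>p = 2\<close> and \<open>L = K(\<surd>a)\<close> both the Kijima--Nishi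
  condition at \<open>G\<^sub>L\<close> and the H-condition at \<open>L\<close> therefore say that the norm maps the radical of \<open>L\<close> onto
  the radical of \<open>K\<close> up to squares; for the H-condition one uses Hilbert 90 in the form
  \<open>z = s(t)/t = N(t)/t\<^sup>2\<close>.
\<close>

section \<open>Subfields and polynomials over them\<close>

text \<open>An obstacle precedes the cohomology: \<open>separable_closure K\<close> is given by
  squarefree annihilating polynomials, and that such elements form a field is itself a result of
  Galois theory. The proof therefore works in the field they generate, shows that its embeddings
  over K have finite orbits and together move everything outside K, and recovers a squarefree
  polynomial over K from each orbit. Two encodings carry the later computations. Values in F_p are
  compared through \<open>\<zeta> powi\<close>, which turns congruences mod p into equations in the
  field, so that cochain identities are read off from the action on p-th roots. In degree one the
  coboundaries with trivial coefficients vanish, so classes are singletons \<open>{kappa b}\<close>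
  and radicals are compared element by element. For p = 2 the two conditions can be matched
  extension by extension because every open subgroup of index two is the stabilizer of a square
  root.\<close>

abbreviation is_subfield :: "'c::field set \<Rightarrow> bool" where
  "is_subfield E \<equiv> subfield E ring_of_type_algebra"

lemma ring_of_type_algebra_simps [simp]:
  "carrier (ring_of_type_algebra :: 'c::field ring) = UNIV"
  "x \<otimes>\<^bsub>ring_of_type_algebra\<^esub> y = x * (y :: 'c::field)"
  "x \<oplus>\<^bsub>ring_of_type_algebra\<^esub> y = x + (y :: 'c::field)"
  "\<one>\<^bsub>ring_of_type_algebra\<^esub> = (1 :: 'c::field)"
  "\<zero>\<^bsub>ring_of_type_algebra\<^esub> = (0 :: 'c::field)"
  by (simp_all add: ring_of_type_algebra_def)

interpretation type_ring: ring "ring_of_type_algebra :: 'c::field ring"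
  by (rule ring_from_type_algebra)

lemma ring_of_type_algebra_minus [simp]: "\<ominus>\<^bsub>ring_of_type_algebra\<^esub> x = - (x :: 'c::field)"
  using type_ring.minus_equality[of "- x" x] by simp

lemma ring_of_type_algebra_inv [simp]:
  "x \<noteq> 0 \<Longrightarrow> inv\<^bsub>ring_of_type_algebra\<^esub> x = inverse (x :: 'c::field)"
  using comm_monoid.comm_inv_char[OF cring.axioms(2)[OF cring_from_type_algebra], of x "inverse x"] by simp

lemma is_subfieldI:
  fixes E :: "'c::field set"
  assumes "1 \<in> E" and add: "\<And>x y. x \<in> E \<Longrightarrow> y \<in> E \<Longrightarrow> x + y \<in> E"
    and mult: "\<And>x y. x \<in> E \<Longrightarrow> y \<in> E \<Longrightarrow> x * y \<in> E"
    and um: "\<And>x. x \<in> E \<Longrightarrow> - x \<in> E" and inv: "\<And>x. x \<in> E \<Longrightarrow> x \<noteq> 0 \<Longrightarrow> inverse x \<in> E"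
  shows "is_subfield E"
  by (rule field.subfieldI'[OF field_from_type_algebra], rule type_ring.subringI) (use assms in auto)

context
  fixes E :: "'c::field set" assumes E: "is_subfield E"
begin

lemma is_subfield_0 [simp]: "0 \<in> E"
  and is_subfield_1 [simp]: "1 \<in> E"
  and is_subfield_add: "x \<in> E \<Longrightarrow> y \<in> E \<Longrightarrow> x + y \<in> E"
  and is_subfield_mult: "x \<in> E \<Longrightarrow> y \<in> E \<Longrightarrow> x * y \<in> E"
  and is_subfield_uminus: "x \<in> E \<Longrightarrow> - x \<in> E"
  using subringE[OF subfieldE(1)[OF E]] by auto

lemma is_subfield_inverse: "x \<in> E \<Longrightarrow> inverse x \<in> E"
  using type_ring.subfield_m_inv(1)[OF E, of x] by (cases "x = 0") auto

lemma is_subfield_diff: "x \<in> E \<Longrightarrow> y \<in> E \<Longrightarrow> x - y \<in> E"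
  using is_subfield_add[of x "- y"] is_subfield_uminus by simp

lemma is_subfield_divide: "x \<in> E \<Longrightarrow> y \<in> E \<Longrightarrow> x / y \<in> E"
  using is_subfield_mult[of x "inverse y"] is_subfield_inverse by (simp add: divide_inverse)

lemma is_subfield_power: "x \<in> E \<Longrightarrow> x ^ n \<in> E"
  by (induction n) (auto intro: is_subfield_mult)

lemma is_subfield_sum: "(\<And>i. i \<in> I \<Longrightarrow> f i \<in> E) \<Longrightarrow> sum f I \<in> E"
  by (induction I rule: infinite_finite_induct) (auto intro: is_subfield_add)

lemma is_subfield_prod: "(\<And>i. i \<in> I \<Longrightarrow> f i \<in> E) \<Longrightarrow> prod f I \<in> E"
  by (induction I rule: infinite_finite_induct) (auto intro: is_subfield_mult)

lemma is_subfield_of_nat: "of_nat n \<in> E"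
  by (induction n) (auto intro: is_subfield_add)

lemma is_subfield_powi: "x \<in> E \<Longrightarrow> x powi k \<in> E"
  by (auto simp: power_int_def intro: is_subfield_power is_subfield_inverse)

end

lemmas is_subfield_closed = is_subfield_0 is_subfield_1 is_subfield_add is_subfield_mult
  is_subfield_uminus is_subfield_inverse is_subfield_diff is_subfield_divide is_subfield_power
  is_subfield_sum is_subfield_prod is_subfield_of_nat is_subfield_powi

lemma is_subfield_generate_field: "is_subfield (generate_field ring_of_type_algebra A)"
  by (rule field.generate_field_is_subfield[OF field_from_type_algebra]) auto

lemma generate_field_least:
  assumes "is_subfield E" "A \<subseteq> E" shows "generate_field ring_of_type_algebra A \<subseteq> E"
  by (rule field.generate_field_min_subfield1[OF field_from_type_algebra]) (use assms in auto)

definition polys_over :: "'c::field set \<Rightarrow> 'c poly set" where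
  "polys_over E = {f. \<forall>i. coeff f i \<in> E}"

lemma polys_over_mono: "E \<subseteq> F \<Longrightarrow> polys_over E \<subseteq> polys_over F"
  by (auto simp: polys_over_def)

context
  fixes E :: "'c::field set" assumes E: "is_subfield E"
begin

lemma polys_over_0: "0 \<in> polys_over E"
  and polys_over_1: "1 \<in> polys_over E"
  and polys_over_add: "f \<in> polys_over E \<Longrightarrow> g \<in> polys_over E \<Longrightarrow> f + g \<in> polys_over E"
  and polys_over_diff: "f \<in> polys_over E \<Longrightarrow> g \<in> polys_over E \<Longrightarrow> f - g \<in> polys_over E"
  and polys_over_uminus: "f \<in> polys_over E \<Longrightarrow> - f \<in> polys_over E"
  and polys_over_mult: "f \<in> polys_over E \<Longrightarrow> g \<in> polys_over E \<Longrightarrow> f * g \<in> polys_over E"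
  and polys_over_pCons: "c \<in> E \<Longrightarrow> f \<in> polys_over E \<Longrightarrow> pCons c f \<in> polys_over E"
  and polys_over_monom: "c \<in> E \<Longrightarrow> Polynomial.monom c n \<in> polys_over E"
  by (auto simp: polys_over_def coeff_mult coeff_pCons is_subfield_closed[OF E]
      intro!: is_subfield_sum[OF E] split: nat.splits)

lemma poly_in_subfield:
  assumes "f \<in> polys_over F" "F \<subseteq> E" "x \<in> E" shows "poly f x \<in> E"
  unfolding poly_altdef using assms
  by (auto simp: polys_over_def intro!: is_subfield_closed[OF E])

text \<open>Long division inside E: a quotient of leading coefficients lies in E, so each
  cancellation of a leading term keeps quotient and remainder over E. The zero remainder is listed
  separately because its degree is 0, like that of a nonzero constant.\<close>

lemma polys_over_divide:
  assumes "m \<in> polys_over E" "m \<noteq> 0" "f \<in> polys_over E"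
  shows "\<exists>q\<in>polys_over E. \<exists>r\<in>polys_over E. f = q * m + r \<and>
    (r = 0 \<or> Polynomial.degree r < Polynomial.degree m)"
  using assms(3)
proof (induction "Polynomial.degree f" arbitrary: f rule: less_induct)
  case less
  show ?case
  proof (cases "Polynomial.degree f < Polynomial.degree m \<or> f = 0")
    case True
    then show ?thesis using less.prems polys_over_0 by (intro bexI[of _ 0] bexI[of _ f]) auto
  next
    case False
    define c where "c = lead_coeff f / lead_coeff m"
    define t where "t = Polynomial.monom c (Polynomial.degree f - Polynomial.degree m)"
    have t: "t \<in> polys_over E" unfolding t_def c_def using assms less.prems
      by (intro polys_over_monom is_subfield_divide[OF E]) (auto simp: polys_over_def)
    define g where "g = f - t * m"
    have g: "g \<in> polys_over E" unfolding g_def by (intro polys_over_diff polys_over_mult t assms less)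
    have c0: "c \<noteq> 0" using False assms(2) by (simp add: c_def)
    have "coeff g (Polynomial.degree f) = 0"
      using False assms(2) unfolding g_def t_def by (simp add: coeff_monom_mult c_def)
    moreover have "Polynomial.degree (t * m) = Polynomial.degree f"
      using False assms(2) c0 by (subst degree_mult_eq) (auto simp: t_def degree_monom_eq monom_eq_0_iff)
    then have "Polynomial.degree g \<le> Polynomial.degree f"
      unfolding g_def by (metis degree_diff_le order_refl)
    ultimately have "g = 0 \<or> Polynomial.degree g < Polynomial.degree f"
      by (metis leading_coeff_0_iff nat_less_le)
    then have "\<exists>q\<in>polys_over E. \<exists>r\<in>polys_over E. g = q * m + r \<and>
      (r = 0 \<or> Polynomial.degree r < Polynomial.degree m)"
      using less.hyps g polys_over_0 by (metis add.right_neutral mult_zero_left)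
    then obtain q r where qr: "q \<in> polys_over E" "r \<in> polys_over E" "g = q * m + r"
      "r = 0 \<or> Polynomial.degree r < Polynomial.degree m" by blast
    have "f = (q + t) * m + r" using qr(3) by (simp add: g_def algebra_simps)
    then show ?thesis using qr t polys_over_add by blast
  qed
qed

text \<open>Minimal degree stands in for irreducibility: a nonzero remainder after division by m
  would be a smaller annihilator. Divisibility later makes extended embeddings well defined;
  minimality of the degree keeps values of low-degree polynomials nonzero.\<close>

lemma exists_minimal_poly:
  assumes "f \<in> polys_over E" "f \<noteq> 0" "poly f a = 0"
  obtains m where "m \<in> polys_over E" "m \<noteq> 0" "poly m a = 0"
    "\<And>g. g \<in> polys_over E \<Longrightarrow> poly g a = 0 \<Longrightarrow> \<exists>q\<in>polys_over E. g = q * m"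
    "\<And>g. g \<in> polys_over E \<Longrightarrow> poly g a = 0 \<Longrightarrow> g \<noteq> 0 \<Longrightarrow> Polynomial.degree m \<le> Polynomial.degree g"
proof -
  let ?S = "\<lambda>n. \<exists>g\<in>polys_over E. g \<noteq> 0 \<and> poly g a = 0 \<and> Polynomial.degree g = n"
  have ex: "?S (Polynomial.degree f)" using assms by blast
  obtain m where m: "m \<in> polys_over E" "m \<noteq> 0" "poly m a = 0" "Polynomial.degree m = (LEAST n. ?S n)"
    using LeastI[of ?S, OF ex] by blast
  have min: "Polynomial.degree m \<le> Polynomial.degree g"
    if "g \<in> polys_over E" "poly g a = 0" "g \<noteq> 0" for g
    unfolding m(4) by (rule Least_le) (use that in blast)
  have "\<exists>q\<in>polys_over E. g = q * m" if g: "g \<in> polys_over E" "poly g a = 0" for g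
  proof -
    obtain q r where qr: "q \<in> polys_over E" "r \<in> polys_over E" "g = q * m + r"
      "r = 0 \<or> Polynomial.degree r < Polynomial.degree m"
      using polys_over_divide[OF m(1,2) g(1)] by blast
    have "poly r a = 0" using g(2) m(3) qr(3) by simp
    then have "r = 0" using min[OF qr(2)] qr(4) by force
    then show ?thesis using qr by auto
  qed
  then show ?thesis using that m min by blast
qed

end

section \<open>Simple algebraic extensions E[a]\<close>

definition simple_ext :: "'c::field set \<Rightarrow> 'c \<Rightarrow> 'c set" where
  "simple_ext E a = (\<lambda>f. poly f a) ` polys_over E"

lemma simple_ext_incl:
  assumes E: "is_subfield E" shows "E \<subseteq> simple_ext E a" "a \<in> simple_ext E a"
proof -
  show "E \<subseteq> simple_ext E a"
  proof
    fix x assume "x \<in> E"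
    then have "[:x:] \<in> polys_over E" by (intro polys_over_pCons[OF E] polys_over_0[OF E])
    then show "x \<in> simple_ext E a" unfolding simple_ext_def by (intro image_eqI[of _ _ "[:x:]"]) auto
  qed
  have "[:0, 1:] \<in> polys_over E" by (intro polys_over_pCons[OF E] polys_over_0[OF E] is_subfield_closed[OF E])
  then show "a \<in> simple_ext E a" unfolding simple_ext_def by (intro image_eqI[of _ _ "[:0, 1:]"]) auto
qed

text \<open>Only inverses take work. To invert g(a), divide m by g: m = q g + r gives r(a) = - q(a)
  g(a), so an inverse of r(a), available by induction on the degree, yields one of g(a).\<close>

lemma is_subfield_simple_ext:
  assumes E: "is_subfield E" and f: "f \<in> polys_over E" "f \<noteq> 0" "poly f a = 0"
  shows "is_subfield (simple_ext E a)"
proof -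
  obtain m where m: "m \<in> polys_over E" "m \<noteq> 0" "poly m a = 0"
    "\<And>g. g \<in> polys_over E \<Longrightarrow> poly g a = 0 \<Longrightarrow> \<exists>q\<in>polys_over E. g = q * m"
    "\<And>g. g \<in> polys_over E \<Longrightarrow> poly g a = 0 \<Longrightarrow> g \<noteq> 0 \<Longrightarrow> Polynomial.degree m \<le> Polynomial.degree g"
    using exists_minimal_poly[OF E f] by metis
  have mult: "x * y \<in> simple_ext E a" if "x \<in> simple_ext E a" "y \<in> simple_ext E a" for x y
    using that polys_over_mult[OF E] unfolding simple_ext_def
    by (auto simp flip: poly_mult)
  have um: "- x \<in> simple_ext E a" if "x \<in> simple_ext E a" for x
    using that polys_over_uminus[OF E] unfolding simple_ext_def
    by (auto simp flip: poly_minus)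
  have inv: "inverse (poly g a) \<in> simple_ext E a"
    if "g \<in> polys_over E" "poly g a \<noteq> 0" "Polynomial.degree g < Polynomial.degree m" for g
    using that
  proof (induction "Polynomial.degree g" arbitrary: g rule: less_induct)
    case less
    show ?case
    proof (cases "Polynomial.degree g = 0")
      case True
      then obtain c where c: "g = [:c:]" by (auto elim: degree_eq_zeroE)
      then have "c \<in> E" using less.prems(1) by (auto simp: polys_over_def dest: spec[of _ 0])
      then show ?thesis using c is_subfield_inverse[OF E] simple_ext_incl(1)[OF E] by auto
    next
      case False
      have "g \<noteq> 0" using less.prems by auto
      obtain q r where qr: "q \<in> polys_over E" "r \<in> polys_over E" "m = q * g + r"
        "r = 0 \<or> Polynomial.degree r < Polynomial.degree g"
        using polys_over_divide[OF E less.prems(1) \<open>g \<noteq> 0\<close> m(1)] by blast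
      have "q \<noteq> 0" using qr less.prems(3) m(2) by auto
      have "Polynomial.degree q < Polynomial.degree m"
      proof -
        have "Polynomial.degree (q * g) = Polynomial.degree q + Polynomial.degree g"
          using \<open>q \<noteq> 0\<close> \<open>g \<noteq> 0\<close> by (rule degree_mult_eq)
        moreover have "Polynomial.degree m = Polynomial.degree (q * g)"
          using qr(3,4) calculation False by (metis add.right_neutral degree_add_eq_left trans_less_add2)
        ultimately show ?thesis using False by linarith
      qed
      \<comment> \<open>q has smaller degree than m because g is not constant, so minimality of m
        forbids q(a) = 0; this is what keeps r(a) nonzero.\<close>
      then have qa: "poly q a \<noteq> 0" using m(5)[OF qr(1)] \<open>q \<noteq> 0\<close> by force
      have e: "poly r a = - (poly q a * poly g a)" using m(3) qr(3) by (metis add_eq_0_iff poly_add poly_mult)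
      then have ra: "poly r a \<noteq> 0" using qa less.prems(2) by simp
      then have "Polynomial.degree r < Polynomial.degree g" using qr(4) by auto
      then have "inverse (poly r a) \<in> simple_ext E a"
        using less.hyps[OF _ qr(2) ra] less.prems by simp
      moreover have "inverse (poly g a) = - (poly q a * inverse (poly r a))"
        using qa less.prems(2) unfolding e by (simp add: field_simps)
      moreover have "poly q a \<in> simple_ext E a" using qr(1) by (simp add: simple_ext_def)
      ultimately show ?thesis using um mult by metis
    qed
  qed
  show ?thesis
  proof (rule is_subfieldI[OF _ _ mult um])
    show "1 \<in> simple_ext E a" using simple_ext_incl[OF E] is_subfield_1[OF E] by blast
  next
    fix x y assume "x \<in> simple_ext E a" "y \<in> simple_ext E a"
    then show "x + y \<in> simple_ext E a" using polys_over_add[OF E] unfolding simple_ext_def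
    by (auto simp flip: poly_add)
  next
    fix x assume x: "x \<in> simple_ext E a" "x \<noteq> 0"
    then obtain g where g: "g \<in> polys_over E" "x = poly g a" unfolding simple_ext_def by auto
    obtain q r where qr: "q \<in> polys_over E" "r \<in> polys_over E" "g = q * m + r"
        "r = 0 \<or> Polynomial.degree r < Polynomial.degree m"
      using polys_over_divide[OF E m(1,2) g(1)] by blast
    have "x = poly r a" using g qr m by simp
    then show "inverse x \<in> simple_ext E a" using inv[OF qr(2)] x qr(4) by auto
  qed auto
qed

section \<open>Square-free polynomials\<close>

lemma order_linear_poly: "Polynomial.order a [:- b, 1:] = (if a = b then 1 else (0::nat))" for a :: "'c::field"
  using order_power_n_n[of b 1] by (auto intro: order_0I)

lemma rsquarefree_linear_mult:
  fixes q :: "'c::field poly"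
  shows "rsquarefree ([:- b, 1:] * q) \<longleftrightarrow> rsquarefree q \<and> poly q b \<noteq> 0"
proof (cases "q = 0")
  case False
  have "[:- b, 1:] * q \<noteq> 0" using False by (metis mult_eq_0_iff one_neq_zero pCons_eq_0_iff)
  then have "Polynomial.order a ([:- b, 1:] * q) = (if a = b then 1 else 0) + Polynomial.order a q" for a
    using order_mult[of "[:- b, 1:]" q a] order_linear_poly[of a b] by metis
  moreover have "poly q b \<noteq> 0 \<longleftrightarrow> Polynomial.order b q = 0" using False by (simp add: order_root)
  ultimately show ?thesis using False \<open>[:- b, 1:] * q \<noteq> 0\<close> unfolding rsquarefree_def
    by (simp del: mult_pCons_left) (metis One_nat_def add_eq_if add_is_0 nat.distinct(1) plus_1_eq_Suc)
qed (auto simp: rsquarefree_def)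

lemma rsquarefree_prod_linear:
  fixes S :: "'c::field set"
  assumes "finite S" shows "rsquarefree (\<Prod>b\<in>S. [:- b, 1:])"
  using assms
proof (induction S)
  case (insert b S)
  then show ?case by (simp add: rsquarefree_linear_mult poly_prod del: mult_pCons_left)
qed (auto simp: rsquarefree_def)

lemma rsquarefree_dvd:
  fixes f :: "'c::field poly"
  assumes "rsquarefree f" "g dvd f" shows "rsquarefree g"
proof -
  obtain h where h: "f = g * h" using assms(2) by auto
  have "f \<noteq> 0" using assms(1) by (auto simp: rsquarefree_def)
  then have "Polynomial.order a g \<le> Polynomial.order a f" for a using h by (simp add: order_mult)
  then show ?thesis using assms(1) \<open>f \<noteq> 0\<close> h unfolding rsquarefree_def
    by (metis le_0_eq le_Suc_eq One_nat_def mult_zero_left)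
qed

lemma card_roots_rsquarefree:
  fixes f :: "'c::alg_closed_field poly"
  assumes "rsquarefree f" shows "card {x. poly f x = 0} = Polynomial.degree f"
  using assms
proof (induction "Polynomial.degree f" arbitrary: f rule: less_induct)
  case less
  have f0: "f \<noteq> 0" using less.prems by (auto simp: rsquarefree_def)
  show ?case
  proof (cases "Polynomial.degree f = 0")
    case True
    then show ?thesis using f0 by (metis card_poly_roots_bound le_0_eq)
  next
    case False
    then obtain b where "poly f b = 0" using alg_closed_imp_poly_has_root by blast
    then obtain q where q: "f = [:- b, 1:] * q" using poly_eq_0_iff_dvd by (metis dvdE)
    then have rq: "rsquarefree q" "poly q b \<noteq> 0" using less.prems rsquarefree_linear_mult unfolding q by blast+
    then have q0: "q \<noteq> 0" by auto
    have d: "Polynomial.degree f = Suc (Polynomial.degree q)" unfolding q using q0 by (subst degree_mult_eq) auto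
    have "{x. poly f x = 0} = insert b {x. poly q x = 0}" unfolding q by auto
    moreover have "finite {x. poly q x = 0}" using q0 by (rule poly_roots_finite)
    ultimately show ?thesis using less.hyps[of q] rq d by simp
  qed
qed

text \<open>At a root a, writing f = (X - a) q gives f'(a) = q(a), so the root is simple exactly if
  the derivative does not vanish. This form suits substitutions X -> X^n, where the chain rule
  applies.\<close>

lemma rsquarefree_iff_pderiv:
  fixes f :: "'c::field poly"
  shows "rsquarefree f \<longleftrightarrow> (\<forall>a. poly f a = 0 \<longrightarrow> poly (pderiv f) a \<noteq> 0)"
proof (cases "f = 0")
  case False
  have *: "Polynomial.order a f \<le> 1 \<longleftrightarrow> (poly f a = 0 \<longrightarrow> poly (pderiv f) a \<noteq> 0)" for a
  proof (cases "poly f a = 0")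
    case True
    then obtain q where q: "f = [:- a, 1:] * q" using poly_eq_0_iff_dvd by (metis dvdE)
    have q0: "q \<noteq> 0" using False q by auto
    have "poly (pderiv f) a = poly q a" unfolding q by (simp add: pderiv_mult pderiv_pCons del: mult_pCons_left)
    moreover have "Polynomial.order a f = 1 + Polynomial.order a q"
      using False unfolding q by (subst order_mult) (auto simp: order_linear_poly)
    ultimately show ?thesis using True q0 by (auto simp: order_root)
  qed (simp add: order_0I)
  have "rsquarefree f \<longleftrightarrow> (\<forall>a. Polynomial.order a f \<le> 1)"
    using False unfolding rsquarefree_def by (metis le_0_eq le_Suc_eq One_nat_def order_refl zero_le)
  then show ?thesis using * by blast
qed (auto simp: rsquarefree_def)

section \<open>Extension of embeddings\<close>

text \<open>The ring laws are imposed only on E and the target is the whole ambient field, so a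
  subfield inherits an embedding without a change of function. Injectivity on a subfield is a
  consequence.\<close>

definition field_embedding :: "'c::field set \<Rightarrow> ('c \<Rightarrow> 'c) \<Rightarrow> bool" where
  "field_embedding E \<phi> \<longleftrightarrow> \<phi> 1 = 1 \<and>
     (\<forall>x\<in>E. \<forall>y\<in>E. \<phi> (x + y) = \<phi> x + \<phi> y \<and> \<phi> (x * y) = \<phi> x * \<phi> y)"

lemma field_embedding_mono: "field_embedding F \<phi> \<Longrightarrow> E \<subseteq> F \<Longrightarrow> field_embedding E \<phi>"
  unfolding field_embedding_def by blast

lemma field_embedding_cong:
  assumes "field_embedding E \<phi>" "is_subfield E" "\<And>x. x \<in> E \<Longrightarrow> \<psi> x = \<phi> x"
  shows "field_embedding E \<psi>"
  using assms(1,3) is_subfield_closed[OF assms(2)] unfolding field_embedding_def by auto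

context
  fixes E :: "'c::field set" and \<phi>
  assumes E: "is_subfield E" and \<phi>: "field_embedding E \<phi>"
begin

lemma emb_1 [simp]: "\<phi> 1 = 1"
  and emb_add: "x \<in> E \<Longrightarrow> y \<in> E \<Longrightarrow> \<phi> (x + y) = \<phi> x + \<phi> y"
  and emb_mult: "x \<in> E \<Longrightarrow> y \<in> E \<Longrightarrow> \<phi> (x * y) = \<phi> x * \<phi> y"
  using \<phi> unfolding field_embedding_def by auto

lemma emb_0 [simp]: "\<phi> 0 = 0"
  using emb_add[of 0 0] is_subfield_0[OF E] by (metis add.right_neutral add_cancel_right_right)

lemma emb_uminus: "x \<in> E \<Longrightarrow> \<phi> (- x) = - \<phi> x"
  using emb_add[of x "- x"] is_subfield_uminus[OF E, of x] by (simp add: eq_neg_iff_add_eq_0 add.commute)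

lemma emb_diff: "x \<in> E \<Longrightarrow> y \<in> E \<Longrightarrow> \<phi> (x - y) = \<phi> x - \<phi> y"
  using emb_add[of x "- y"] emb_uminus is_subfield_uminus[OF E, of y] by simp

lemma emb_eq_0_iff: "x \<in> E \<Longrightarrow> \<phi> x = 0 \<longleftrightarrow> x = 0"
  using emb_mult[of x "inverse x"] is_subfield_inverse[OF E, of x] by (cases "x = 0") auto

lemma emb_eq_iff: "x \<in> E \<Longrightarrow> y \<in> E \<Longrightarrow> \<phi> x = \<phi> y \<longleftrightarrow> x = y"
  using emb_eq_0_iff[of "x - y"] emb_diff[of x y] is_subfield_diff[OF E, of x y] by simp

lemma emb_inverse: "x \<in> E \<Longrightarrow> \<phi> (inverse x) = inverse (\<phi> x)"
  using emb_mult[of x "inverse x"] is_subfield_inverse[OF E, of x]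
  by (cases "x = 0") (auto intro!: inverse_unique[symmetric])

lemma emb_divide: "x \<in> E \<Longrightarrow> y \<in> E \<Longrightarrow> \<phi> (x / y) = \<phi> x / \<phi> y"
  using emb_mult[of x "inverse y"] emb_inverse is_subfield_inverse[OF E, of y] by (simp add: divide_inverse)

lemma emb_power: "x \<in> E \<Longrightarrow> \<phi> (x ^ n) = \<phi> x ^ n"
  by (induction n) (auto simp: emb_mult is_subfield_power[OF E])

lemma emb_sum: "(\<And>i. i \<in> I \<Longrightarrow> f i \<in> E) \<Longrightarrow> \<phi> (sum f I) = (\<Sum>i\<in>I. \<phi> (f i))"
  by (induction I rule: infinite_finite_induct) (auto simp: emb_add is_subfield_sum[OF E])

lemma emb_prod: "(\<And>i. i \<in> I \<Longrightarrow> f i \<in> E) \<Longrightarrow> \<phi> (prod f I) = (\<Prod>i\<in>I. \<phi> (f i))"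
  by (induction I rule: infinite_finite_induct) (auto simp: emb_mult is_subfield_prod[OF E])

lemma emb_powi: "x \<in> E \<Longrightarrow> \<phi> (x powi k) = \<phi> x powi k"
  by (auto simp: power_int_def emb_power emb_inverse is_subfield_closed[OF E])

lemma emb_poly:
  assumes "f \<in> polys_over E" "x \<in> E" shows "\<phi> (poly f x) = poly (map_poly \<phi> f) (\<phi> x)"
  using assms(1)
proof (induction f)
  case (pCons c f)
  then have c: "c \<in> E" and f: "f \<in> polys_over E"
    unfolding polys_over_def by (auto simp: coeff_pCons split: nat.splits)
  have "map_poly \<phi> (pCons c f) = pCons (\<phi> c) (map_poly \<phi> f)"
    by (intro poly_eqI) (auto simp: coeff_map_poly coeff_pCons split: nat.splits)
  moreover have "poly f x \<in> E" using poly_in_subfield[OF E f] assms by auto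
  ultimately show ?case using pCons.IH[OF f] c assms(2)
    by (simp add: emb_add emb_mult is_subfield_closed[OF E])
qed auto

lemma map_poly_emb_add:
  "f \<in> polys_over E \<Longrightarrow> g \<in> polys_over E \<Longrightarrow> map_poly \<phi> (f + g) = map_poly \<phi> f + map_poly \<phi> g"
  by (intro poly_eqI) (auto simp: coeff_map_poly polys_over_def emb_add)

lemma map_poly_emb_diff:
  "f \<in> polys_over E \<Longrightarrow> g \<in> polys_over E \<Longrightarrow> map_poly \<phi> (f - g) = map_poly \<phi> f - map_poly \<phi> g"
  by (intro poly_eqI) (auto simp: coeff_map_poly polys_over_def emb_diff)

lemma map_poly_emb_mult:
  "f \<in> polys_over E \<Longrightarrow> g \<in> polys_over E \<Longrightarrow> map_poly \<phi> (f * g) = map_poly \<phi> f * map_poly \<phi> g"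
  by (intro poly_eqI)
    (auto simp: coeff_map_poly polys_over_def coeff_mult emb_sum emb_mult is_subfield_mult[OF E])

lemma map_poly_emb_prod:
  "(\<And>i. i \<in> I \<Longrightarrow> f i \<in> polys_over E) \<Longrightarrow> map_poly \<phi> (prod f I) = (\<Prod>i\<in>I. map_poly \<phi> (f i))"
proof (induction I rule: infinite_finite_induct)
  case (insert i I)
  moreover have "prod f I \<in> polys_over E" using insert.hyps(1) insert.prems
    by (induction I) (auto intro: polys_over_mult[OF E] polys_over_1[OF E])
  ultimately show ?case by (simp add: map_poly_emb_mult)
qed (auto simp: map_poly_1)

lemma emb_image_subfield: "is_subfield (\<phi> ` E)"
proof (rule is_subfieldI)
  show "1 \<in> \<phi> ` E" using is_subfield_1[OF E] by (intro image_eqI[of _ _ 1]) auto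
next
  fix x y assume "x \<in> \<phi> ` E" "y \<in> \<phi> ` E"
  then obtain u v where "u \<in> E" "v \<in> E" "x = \<phi> u" "y = \<phi> v" by auto
  then show "x + y \<in> \<phi> ` E" "x * y \<in> \<phi> ` E"
    by (auto simp flip: emb_add emb_mult intro: is_subfield_closed[OF E])
next
  fix x assume "x \<in> \<phi> ` E"
  then show "- x \<in> \<phi> ` E" "inverse x \<in> \<phi> ` E"
    by (auto simp flip: emb_uminus emb_inverse intro: is_subfield_closed[OF E])
qed

lemma emb_vimage_subfield: assumes "is_subfield F" shows "is_subfield {x \<in> E. \<phi> x \<in> F}"
  by (rule is_subfieldI)
    (auto simp: emb_add emb_mult emb_uminus emb_inverse is_subfield_closed[OF E] is_subfield_closed[OF assms])

text \<open>Two polynomials with the same value at a differ by a multiple of m, and the transported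
  m vanishes at b; hence evaluating the transported polynomial at b does not depend on the
  polynomial chosen.\<close>

lemma emb_extend_simple:
  assumes m: "m \<in> polys_over E" "m \<noteq> 0" "poly m a = 0"
    "\<And>g. g \<in> polys_over E \<Longrightarrow> poly g a = 0 \<Longrightarrow> \<exists>q\<in>polys_over E. g = q * m"
    and b: "poly (map_poly \<phi> m) b = 0"
  obtains \<psi> where "field_embedding (simple_ext E a) \<psi>"
    "\<And>f. f \<in> polys_over E \<Longrightarrow> \<psi> (poly f a) = poly (map_poly \<phi> f) b"
    "\<And>x. x \<in> E \<Longrightarrow> \<psi> x = \<phi> x" "\<psi> a = b"
proof -
  define \<psi> where "\<psi> x = poly (map_poly \<phi> (SOME f. f \<in> polys_over E \<and> poly f a = x)) b" for x
  have \<psi>: "\<psi> (poly f a) = poly (map_poly \<phi> f) b" if f: "f \<in> polys_over E" for f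
  proof -
    define g where "g = (SOME g. g \<in> polys_over E \<and> poly g a = poly f a)"
    have g: "g \<in> polys_over E" "poly g a = poly f a"
      using someI[of "\<lambda>g. g \<in> polys_over E \<and> poly g a = poly f a" f] f unfolding g_def by auto
    obtain q where q: "q \<in> polys_over E" "g - f = q * m"
      using m(4)[of "g - f"] polys_over_diff[OF E] f g by auto
    have "map_poly \<phi> g - map_poly \<phi> f = map_poly \<phi> q * map_poly \<phi> m"
      using q g f m(1) by (simp flip: map_poly_emb_diff map_poly_emb_mult)
    then have "poly (map_poly \<phi> g) b - poly (map_poly \<phi> f) b = 0"
      using b by (metis mult_zero_right poly_diff poly_mult)
    then show ?thesis unfolding \<psi>_def g_def by simp
  qed
  have \<psi>E: "\<psi> x = \<phi> x" if "x \<in> E" for x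
  proof -
    have "[:x:] \<in> polys_over E" using that by (intro polys_over_pCons[OF E] polys_over_0[OF E])
    moreover have "map_poly \<phi> [:x:] = [:\<phi> x:]"
      by (intro poly_eqI) (auto simp: coeff_map_poly coeff_pCons split: nat.splits)
    ultimately show ?thesis using \<psi>[of "[:x:]"] by simp
  qed
  moreover have "\<psi> a = b"
  proof -
    have "[:0, 1:] \<in> polys_over E" by (intro polys_over_pCons[OF E] polys_over_0[OF E] is_subfield_closed[OF E])
    moreover have "map_poly \<phi> [:0, 1:] = [:0, 1:]"
      by (intro poly_eqI) (auto simp: coeff_map_poly coeff_pCons split: nat.splits)
    ultimately show ?thesis using \<psi>[of "[:0, 1:]"] by simp
  qed
  moreover have "field_embedding (simple_ext E a) \<psi>"
    unfolding field_embedding_def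
  proof (intro conjI ballI)
    show "\<psi> 1 = 1" using \<psi>E is_subfield_1[OF E] by simp
  next
    fix x y assume "x \<in> simple_ext E a" "y \<in> simple_ext E a"
    then obtain f g where fg: "f \<in> polys_over E" "g \<in> polys_over E" "x = poly f a" "y = poly g a"
      unfolding simple_ext_def by auto
    show "\<psi> (x + y) = \<psi> x + \<psi> y"
      using \<psi>[of "f + g"] fg by (simp add: \<psi> map_poly_emb_add polys_over_add[OF E])
    show "\<psi> (x * y) = \<psi> x * \<psi> y"
      using \<psi>[of "f * g"] fg by (simp add: \<psi> map_poly_emb_mult polys_over_mult[OF E])
  qed
  ultimately show ?thesis using that \<psi> by blast
qed

end

lemma map_poly_emb_id:
  assumes "\<And>x. x \<in> E \<Longrightarrow> \<phi> x = x" "f \<in> polys_over E" "0 \<in> E" shows "map_poly \<phi> f = f"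
  using assms by (intro poly_eqI) (auto simp: coeff_map_poly polys_over_def)

text \<open>
  Zorn's lemma is applied to the graphs of embeddings of intermediate fields, so that the union
  of a chain needs no gluing of functions.
\<close>

lemma emb_extend_generate:
  fixes E0 :: "'c::alg_closed_field set"
  assumes E0: "is_subfield E0" and \<phi>0: "field_embedding E0 \<phi>0"
    and alg: "\<And>a. a \<in> A \<Longrightarrow> \<exists>f\<in>polys_over E0. f \<noteq> 0 \<and> poly f a = 0"
  obtains \<phi> where "field_embedding (generate_field ring_of_type_algebra (E0 \<union> A)) \<phi>"
    "\<And>x. x \<in> E0 \<Longrightarrow> \<phi> x = \<phi>0 x"
proof -
  \<comment> \<open>The graphs of embeddings of subfields extending \<open>\<phi>0\<close>. Every
    clause involves at most two pairs, which is why the clauses survive unions of chains.\<close>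
  define good where "good = (\<lambda>\<Gamma> :: ('c \<times> 'c) set.
    (\<forall>x\<in>E0. (x, \<phi>0 x) \<in> \<Gamma>) \<and> (\<forall>x y z. (x, y) \<in> \<Gamma> \<longrightarrow> (x, z) \<in> \<Gamma> \<longrightarrow> y = z) \<and>
    (\<forall>x y x' y'. (x, y) \<in> \<Gamma> \<longrightarrow> (x', y') \<in> \<Gamma> \<longrightarrow> (x + x', y + y') \<in> \<Gamma> \<and> (x * x', y * y') \<in> \<Gamma>) \<and>
    (\<forall>x y. (x, y) \<in> \<Gamma> \<longrightarrow> (- x, - y) \<in> \<Gamma> \<and> (inverse x, inverse y) \<in> \<Gamma>))"
  have good_graph: "good {(x, \<phi> x) | x. x \<in> E}"
    if "is_subfield E" "field_embedding E \<phi>" "E0 \<subseteq> E" "\<And>x. x \<in> E0 \<Longrightarrow> \<phi> x = \<phi>0 x" for E \<phi>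
    unfolding good_def
    using that(3,4) is_subfield_closed[OF that(1)] emb_add[OF that(1,2)] emb_mult[OF that(1,2)]
      emb_uminus[OF that(1,2)] emb_inverse[OF that(1,2)] by (auto simp: subset_iff)
  have "\<exists>M\<in>Collect good. \<forall>N\<in>Collect good. M \<subseteq> N \<longrightarrow> N = M"
  proof (rule subset_Zorn_nonempty)
    show "Collect good \<noteq> {}" using good_graph[OF E0 \<phi>0] by auto
  next
    fix C assume C: "C \<noteq> {}" "subset.chain (Collect good) C"
    have g: "good \<Gamma>" if "\<Gamma> \<in> C" for \<Gamma> using C(2) that unfolding subset.chain_def by auto
    have two: "\<exists>\<Gamma>\<in>C. u \<in> \<Gamma> \<and> v \<in> \<Gamma>" if "u \<in> \<Union>C" "v \<in> \<Union>C" for u v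
    proof -
      obtain \<Gamma>1 \<Gamma>2 where "\<Gamma>1 \<in> C" "u \<in> \<Gamma>1" "\<Gamma>2 \<in> C" "v \<in> \<Gamma>2" using \<open>u \<in> \<Union>C\<close> \<open>v \<in> \<Union>C\<close> by blast
      moreover have "\<Gamma>1 \<subseteq> \<Gamma>2 \<or> \<Gamma>2 \<subseteq> \<Gamma>1"
        using C(2) \<open>\<Gamma>1 \<in> C\<close> \<open>\<Gamma>2 \<in> C\<close> unfolding subset_chain_def by blast
      ultimately show ?thesis by blast
    qed
    have "good (\<Union>C)"
      unfolding good_def
    proof (intro conjI ballI allI impI)
      fix x assume "x \<in> E0"
      then show "(x, \<phi>0 x) \<in> \<Union>C" using C(1) g unfolding good_def by blast
    next
      fix x y z assume "(x, y) \<in> \<Union>C" "(x, z) \<in> \<Union>C"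
      then obtain \<Gamma> where "\<Gamma> \<in> C" "(x, y) \<in> \<Gamma>" "(x, z) \<in> \<Gamma>" using two by metis
      then show "y = z" using g[of \<Gamma>] unfolding good_def by blast
    next
      fix x y x' y' assume "(x, y) \<in> \<Union>C" "(x', y') \<in> \<Union>C"
      then obtain \<Gamma> where "\<Gamma> \<in> C" "(x, y) \<in> \<Gamma>" "(x', y') \<in> \<Gamma>" using two by metis
      then show "(x + x', y + y') \<in> \<Union>C" "(x * x', y * y') \<in> \<Union>C"
        using g[of \<Gamma>] unfolding good_def by blast+
    next
      fix x y assume "(x, y) \<in> \<Union>C"
      then obtain \<Gamma> where "\<Gamma> \<in> C" "(x, y) \<in> \<Gamma>" by auto
      then show "(- x, - y) \<in> \<Union>C" "(inverse x, inverse y) \<in> \<Union>C"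
        using g[of \<Gamma>] unfolding good_def by blast+
    qed
    then show "\<Union>C \<in> Collect good" by simp
  qed
  then obtain \<Gamma> where \<Gamma>: "good \<Gamma>" and max: "\<And>N. good N \<Longrightarrow> \<Gamma> \<subseteq> N \<Longrightarrow> N = \<Gamma>" by blast
  define E where "E = fst ` \<Gamma>"
  define \<phi> where "\<phi> x = (THE y. (x, y) \<in> \<Gamma>)" for x
  have fn: "y = z" if "(x, y) \<in> \<Gamma>" "(x, z) \<in> \<Gamma>" for x y z
    using \<Gamma> that unfolding good_def by blast
  have \<phi>: "\<phi> x = y" if "(x, y) \<in> \<Gamma>" for x y
    unfolding \<phi>_def using that fn by blast
  have \<Gamma>E: "(x, \<phi> x) \<in> \<Gamma>" if "x \<in> E" for x using that \<phi> unfolding E_def by auto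
  have E0E: "E0 \<subseteq> E" and \<phi>E0: "\<phi> x = \<phi>0 x" if "x \<in> E0" for x
    using that \<Gamma> \<phi> unfolding good_def E_def by (auto intro: rev_image_eqI)
  have cl: "(x + x', y + y') \<in> \<Gamma>" "(x * x', y * y') \<in> \<Gamma>" "(- x, - y) \<in> \<Gamma>" "(inverse x, inverse y) \<in> \<Gamma>"
    if "(x, y) \<in> \<Gamma>" "(x', y') \<in> \<Gamma>" for x y x' y'
    using \<Gamma> that unfolding good_def by blast+
  have "E0 \<subseteq> E" using \<Gamma> unfolding good_def E_def by (auto intro: rev_image_eqI)
  have E: "is_subfield E"
  proof (rule is_subfieldI)
    show "1 \<in> E" using \<open>E0 \<subseteq> E\<close> is_subfield_1[OF E0] by auto
  next
    fix x y assume "x \<in> E" "y \<in> E"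
    from cl(1)[OF \<Gamma>E[OF this(1)] \<Gamma>E[OF this(2)]] cl(2)[OF \<Gamma>E[OF this(1)] \<Gamma>E[OF this(2)]]
    show "x + y \<in> E" "x * y \<in> E" unfolding E_def by force+
  next
    fix x assume "x \<in> E"
    from cl(3)[OF \<Gamma>E[OF this] \<Gamma>E[OF this]] cl(4)[OF \<Gamma>E[OF this] \<Gamma>E[OF this]]
    show "- x \<in> E" "inverse x \<in> E" unfolding E_def by force+
  qed
  have emb: "field_embedding E \<phi>"
    unfolding field_embedding_def
    using \<phi>E0[OF is_subfield_1[OF E0]] \<phi>0 \<phi>[OF cl(1)[OF \<Gamma>E \<Gamma>E]] \<phi>[OF cl(2)[OF \<Gamma>E \<Gamma>E]]
    unfolding field_embedding_def by auto
  have "A \<subseteq> E"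
  proof
    fix a assume "a \<in> A"
    then obtain f where f: "f \<in> polys_over E" "f \<noteq> 0" "poly f a = 0"
      using alg polys_over_mono[OF \<open>E0 \<subseteq> E\<close>] by blast
    obtain m where m: "m \<in> polys_over E" "m \<noteq> 0" "poly m a = 0"
      "\<And>g. g \<in> polys_over E \<Longrightarrow> poly g a = 0 \<Longrightarrow> \<exists>q\<in>polys_over E. g = q * m"
      using exists_minimal_poly[OF E f] by metis
    \<comment> \<open>m has a root and is nonzero, so it is not constant; its image under \<phi> has
      the same degree by injectivity, hence a root b to which a can be sent.\<close>
    have "Polynomial.degree m > 0"
      using m(2,3) by (metis degree_eq_zeroE gr0I poly_const_conv pCons_0_0)
    moreover have "Polynomial.degree (map_poly \<phi> m) = Polynomial.degree m"
      using m(1,2) emb_eq_0_iff[OF E emb, of "lead_coeff m"]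
      by (intro map_poly_degree_eq) (auto simp: polys_over_def)
    ultimately obtain b where "poly (map_poly \<phi> m) b = 0" using alg_closed_imp_poly_has_root by metis
    then obtain \<psi> where \<psi>: "field_embedding (simple_ext E a) \<psi>" "\<And>x. x \<in> E \<Longrightarrow> \<psi> x = \<phi> x"
      using emb_extend_simple[OF E emb m] by metis
    let ?N = "{(x, \<psi> x) | x. x \<in> simple_ext E a}"
    have "good ?N" using \<open>E0 \<subseteq> E\<close> simple_ext_incl(1)[OF E] \<psi> \<phi>E0
      by (intro good_graph is_subfield_simple_ext[OF E f]) auto
    moreover have "\<Gamma> \<subseteq> ?N" 
    proof
      fix u assume u: "u \<in> \<Gamma>"
      then have "fst u \<in> E" "\<phi> (fst u) = snd u" using \<phi>[of "fst u" "snd u"] unfolding E_def by auto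
      then have "fst u \<in> simple_ext E a" "\<psi> (fst u) = snd u" using \<psi>(2) simple_ext_incl(1)[OF E] by auto
      then show "u \<in> ?N" by (metis (mono_tags, lifting) mem_Collect_eq prod.collapse)
    qed
    ultimately have "?N = \<Gamma>" by (rule max)
    then have "(a, \<psi> a) \<in> \<Gamma>" using simple_ext_incl(2)[OF E, of a] by blast
    then show "a \<in> E" unfolding E_def by force
  qed
  then have "generate_field ring_of_type_algebra (E0 \<union> A) \<subseteq> E"
    using \<open>E0 \<subseteq> E\<close> by (intro generate_field_least E) auto
  then show ?thesis using that[of \<phi>] emb \<phi>E0 field_embedding_mono by blast
qed

text \<open>Write x = g(a) with g over E of smaller degree than m. The squarefree m has as many
  roots b as its degree, and sending a to b sends x to g(b). If all these values were x, then g - x,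
  nonzero because x is outside E, would have more roots than its degree.\<close>

lemma separable_moved:
  fixes E :: "'c::alg_closed_field set"
  assumes E: "is_subfield E" and f: "f \<in> polys_over E" "rsquarefree f" "poly f a = 0"
    and x: "x \<in> simple_ext E a" "x \<notin> E"
  obtains \<psi> where "field_embedding (simple_ext E a) \<psi>" "\<And>y. y \<in> E \<Longrightarrow> \<psi> y = y" "\<psi> x \<noteq> x"
proof -
  have "f \<noteq> 0" using f(2) by (auto simp: rsquarefree_def)
  then obtain m where m: "m \<in> polys_over E" "m \<noteq> 0" "poly m a = 0"
      "\<And>g. g \<in> polys_over E \<Longrightarrow> poly g a = 0 \<Longrightarrow> \<exists>q\<in>polys_over E. g = q * m"
    using exists_minimal_poly[OF E f(1) _ f(3)] by metis
  have "m dvd f" using m(4)[OF f(1,3)] by auto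
  then have "rsquarefree m" using f(2) rsquarefree_dvd by blast
  then have card: "card {z. poly m z = 0} = Polynomial.degree m" by (rule card_roots_rsquarefree)
  obtain g0 where g0: "g0 \<in> polys_over E" "x = poly g0 a" using x(1) unfolding simple_ext_def by auto
  obtain q g where g: "g \<in> polys_over E" "g0 = q * m + g" "g = 0 \<or> Polynomial.degree g < Polynomial.degree m"
    using polys_over_divide[OF E m(1,2) g0(1)] by blast
  have xg: "x = poly g a" using g0 g m(3) by simp
  have id: "field_embedding E (\<lambda>y. y)" by (auto simp: field_embedding_def)
  have mp: "map_poly (\<lambda>y. y) h = h" for h :: "'c poly" by (intro poly_eqI) (simp add: coeff_map_poly)
  have "\<exists>b. poly m b = 0 \<and> poly g b \<noteq> x"
  proof (rule ccontr)
    assume "\<not> ?thesis"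
    then have sub: "{z. poly m z = 0} \<subseteq> {z. poly (g - [:x:]) z = 0}" by auto
    have ne: "g - [:x:] \<noteq> 0"
    proof
      assume "g - [:x:] = 0"
      then have "coeff g 0 = x" by simp
      then show False using g(1) x(2) by (auto simp: polys_over_def)
    qed
    have "Polynomial.degree m > 0"
      using m(2,3) by (metis degree_eq_zeroE gr0I poly_const_conv pCons_0_0)
    then have "Polynomial.degree (g - [:x:]) < Polynomial.degree m"
      using g(3) by (intro degree_diff_less) auto
    moreover have "card {z. poly m z = 0} \<le> card {z. poly (g - [:x:]) z = 0}"
      using sub ne by (intro card_mono poly_roots_finite)
    ultimately show False using card card_poly_roots_bound[OF ne] by linarith
  qed
  then obtain b where b: "poly m b = 0" "poly g b \<noteq> x" by blast
  obtain \<psi> where \<psi>: "field_embedding (simple_ext E a) \<psi>" "\<And>y. y \<in> E \<Longrightarrow> \<psi> y = y"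
     "\<psi> (poly g a) = poly g b"
    using emb_extend_simple[OF E id m, of b] b(1) g(1) unfolding mp by metis
  then show ?thesis using that b xg by metis
qed

section \<open>The separable closure is Galois\<close>

lemma separable_closure_iff:
  "x \<in> separable_closure K \<longleftrightarrow> (\<exists>f\<in>polys_over K. rsquarefree f \<and> poly f x = 0)"
  by (auto simp: separable_closure_def polys_over_def)

context
  fixes K :: "'c::alg_closed_field set" and \<Omega> :: "'c set"
  assumes K: "is_subfield K"
  defines "\<Omega> \<equiv> generate_field ring_of_type_algebra (K \<union> separable_closure K)"
begin

lemma subfield_sep_gen: "is_subfield \<Omega>"
  unfolding \<Omega>_def by (rule is_subfield_generate_field)

lemma sep_gen_incl: "K \<subseteq> \<Omega>" "separable_closure K \<subseteq> \<Omega>"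
  unfolding \<Omega>_def by (auto intro: generate_field.incl)

lemma sep_gen_least: "is_subfield E \<Longrightarrow> K \<subseteq> E \<Longrightarrow> separable_closure K \<subseteq> E \<Longrightarrow> \<Omega> \<subseteq> E"
  unfolding \<Omega>_def by (intro generate_field_least) auto

lemma emb_maps_roots:
  assumes \<phi>: "field_embedding \<Omega> \<phi>" "\<And>x. x \<in> K \<Longrightarrow> \<phi> x = x"
    and f: "f \<in> polys_over K" "rsquarefree f" "poly f x = 0"
  shows "poly f (\<phi> x) = 0"
proof -
  have "x \<in> \<Omega>" using f sep_gen_incl separable_closure_iff by blast
  moreover have "f \<in> polys_over \<Omega>" using f sep_gen_incl polys_over_mono by blast
  ultimately have "\<phi> (poly f x) = poly (map_poly \<phi> f) (\<phi> x)"
    by (intro emb_poly[OF subfield_sep_gen \<phi>(1)])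
  moreover have "map_poly \<phi> f = f" by (rule map_poly_emb_id[OF \<phi>(2) f(1) is_subfield_0[OF K]])
  ultimately show ?thesis using f(3) emb_0[OF subfield_sep_gen \<phi>(1)] by simp
qed

text \<open>Both inclusions need only be checked on K and on separable elements. There \<phi> maps
  the finite root set of a polynomial over K injectively into itself, hence onto itself.\<close>

lemma emb_sep_gen_onto:
  assumes \<phi>: "field_embedding \<Omega> \<phi>" "\<And>x. x \<in> K \<Longrightarrow> \<phi> x = x"
  shows "\<phi> ` \<Omega> = \<Omega>"
proof
  note S = subfield_sep_gen
  have "\<Omega> \<subseteq> {x \<in> \<Omega>. \<phi> x \<in> \<Omega>}"
  proof (intro sep_gen_least emb_vimage_subfield[OF S \<phi>(1) S])
    show "separable_closure K \<subseteq> {x \<in> \<Omega>. \<phi> x \<in> \<Omega>}"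
    proof
      fix x assume x: "x \<in> separable_closure K"
      then obtain f where "f \<in> polys_over K" "rsquarefree f" "poly f x = 0"
        using separable_closure_iff by auto
      then have "\<phi> x \<in> separable_closure K" using emb_maps_roots[OF \<phi>] separable_closure_iff by blast
      then show "x \<in> {x \<in> \<Omega>. \<phi> x \<in> \<Omega>}" using sep_gen_incl x by auto
    qed
  qed (use sep_gen_incl \<phi> in auto)
  then show "\<phi> ` \<Omega> \<subseteq> \<Omega>" by auto
  show "\<Omega> \<subseteq> \<phi> ` \<Omega>"
  proof (intro sep_gen_least emb_image_subfield[OF S \<phi>(1)])
    show "K \<subseteq> \<phi> ` \<Omega>" using \<phi>(2) sep_gen_incl(1) by (metis image_iff subsetD subsetI)
    show "separable_closure K \<subseteq> \<phi> ` \<Omega>"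
    proof
      fix x assume "x \<in> separable_closure K"
      then obtain f where f: "f \<in> polys_over K" "rsquarefree f" "poly f x = 0"
        using separable_closure_iff by auto
      have sub: "{z. poly f z = 0} \<subseteq> \<Omega>" using f sep_gen_incl separable_closure_iff by blast
      have "finite {z. poly f z = 0}" using f(2) by (intro poly_roots_finite) (auto simp: rsquarefree_def)
      moreover have "\<phi> ` {z. poly f z = 0} \<subseteq> {z. poly f z = 0}" using emb_maps_roots[OF \<phi> f(1,2)] by auto
      moreover have "inj_on \<phi> {z. poly f z = 0}"
        using emb_eq_iff[OF S \<phi>(1)] sub by (auto simp: inj_on_def subset_iff)
      ultimately have "\<phi> ` {z. poly f z = 0} = {z. poly f z = 0}" by (rule endo_inj_surj)
      then show "x \<in> \<phi> ` \<Omega>" using f(3) sub by blast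
    qed
  qed
qed

text \<open>
  Let \<open>E\<close> be maximal among the subfields of \<open>\<Omega>\<close> over \<open>K\<close> that avoid \<open>x\<close>. Any separable \<open>a\<close> outside
  \<open>E\<close> satisfies \<open>x \<in> E(a)\<close>, and \<open>x\<close> is moved by some \<open>E\<close>-embedding of \<open>E(a)\<close>.
\<close>

lemma exists_moving_embedding:
  assumes x: "x \<in> \<Omega>" "x \<notin> K"
  obtains \<phi> where "field_embedding \<Omega> \<phi>" "\<And>y. y \<in> K \<Longrightarrow> \<phi> y = y" "\<phi> x \<noteq> x"
proof -
  define P where "P E \<longleftrightarrow> is_subfield E \<and> K \<subseteq> E \<and> x \<notin> E" for E
  have "\<exists>M\<in>Collect P. \<forall>N\<in>Collect P. M \<subseteq> N \<longrightarrow> N = M"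
  proof (rule subset_Zorn_nonempty)
    show "Collect P \<noteq> {}" using K x unfolding P_def by auto
  next
    fix C assume C: "C \<noteq> {}" "subset.chain (Collect P) C"
    have g: "P E" if "E \<in> C" for E using C(2) that unfolding subset.chain_def by auto
    have "is_subfield (\<Union>C)"
    proof (rule is_subfieldI)
      obtain E where "E \<in> C" using C(1) by auto
      then show "1 \<in> \<Union>C" using g is_subfield_1 unfolding P_def by blast
    next
      fix u v assume "u \<in> \<Union>C" "v \<in> \<Union>C"
      then obtain E1 E2 where E12: "E1 \<in> C" "u \<in> E1" "E2 \<in> C" "v \<in> E2" by auto
      moreover have "E1 \<subseteq> E2 \<or> E2 \<subseteq> E1" using C(2) E12(1,3) unfolding subset_chain_def by blast
      ultimately obtain E where "E \<in> C" "u \<in> E" "v \<in> E" by blast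
      moreover from this have "is_subfield E" using g unfolding P_def by auto
      ultimately show "u + v \<in> \<Union>C" "u * v \<in> \<Union>C" using is_subfield_add is_subfield_mult by blast+
    next
      fix u assume "u \<in> \<Union>C"
      then obtain E where E: "E \<in> C" "u \<in> E" by auto
      then have "is_subfield E" using g unfolding P_def by auto
      then show "- u \<in> \<Union>C" "inverse u \<in> \<Union>C" using E is_subfield_uminus is_subfield_inverse by blast+
    qed
    then show "\<Union>C \<in> Collect P" using C(1) g unfolding P_def by auto
  qed
  then obtain E where "P E" and max: "\<And>N. P N \<Longrightarrow> E \<subseteq> N \<Longrightarrow> N = E" by blast
  then have E: "is_subfield E" "K \<subseteq> E" "x \<notin> E" unfolding P_def by auto
  have "\<not> separable_closure K \<subseteq> E" using sep_gen_least[OF E(1,2)] E(3) x(1) by auto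
  then obtain a f where f: "a \<notin> E" "f \<in> polys_over K" "rsquarefree f" "poly f a = 0"
    using separable_closure_iff by blast
  have fE: "f \<in> polys_over E" and "f \<noteq> 0" using f polys_over_mono[OF E(2)] by (auto simp: rsquarefree_def)
  have Ea: "is_subfield (simple_ext E a)" by (rule is_subfield_simple_ext[OF E(1) fE \<open>f \<noteq> 0\<close> f(4)])
  have "x \<in> simple_ext E a"
  proof (rule ccontr)
    assume "x \<notin> simple_ext E a"
    then have "P (simple_ext E a)" using Ea simple_ext_incl[OF E(1)] E unfolding P_def by blast
    then have "simple_ext E a = E" using max simple_ext_incl(1)[OF E(1)] by blast
    then show False using simple_ext_incl(2)[OF E(1)] f(1) by blast
  qed
  then obtain \<psi> where \<psi>: "field_embedding (simple_ext E a) \<psi>" "\<And>y. y \<in> E \<Longrightarrow> \<psi> y = y" "\<psi> x \<noteq> x"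
    using separable_moved[OF E(1) fE f(3,4) _ E(3)] by metis
  have K': "K \<subseteq> simple_ext E a" using E(2) simple_ext_incl(1)[OF E(1)] by blast
  have "\<exists>f\<in>polys_over (simple_ext E a). f \<noteq> 0 \<and> poly f b = 0" if "b \<in> separable_closure K" for b
    using that polys_over_mono[OF K'] unfolding separable_closure_iff rsquarefree_def by blast
  then obtain \<phi> where \<phi>: "field_embedding (generate_field ring_of_type_algebra (simple_ext E a \<union> separable_closure K)) \<phi>"
    "\<And>x. x \<in> simple_ext E a \<Longrightarrow> \<phi> x = \<psi> x"
    using emb_extend_generate[OF Ea \<psi>(1)] by metis
  \<comment> \<open>The extended map lives on a field containing \<Omega>, so it can be restricted
    to \<Omega>; it still moves x because it extends \<psi>.\<close>
  have "\<Omega> \<subseteq> generate_field ring_of_type_algebra (simple_ext E a \<union> separable_closure K)"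
    using K' by (intro sep_gen_least is_subfield_generate_field) (auto intro: generate_field.incl)
  then have "field_embedding \<Omega> \<phi>" using \<phi>(1) field_embedding_mono by blast
  moreover have "\<phi> y = y" if "y \<in> K" for y using that E(2) K' \<phi>(2) \<psi>(2) by force
  moreover have "\<phi> x \<noteq> x" using \<phi>(2) \<psi>(3) \<open>x \<in> simple_ext E a\<close> by simp
  ultimately show ?thesis using that by blast
qed

text \<open>The elements with finite orbit form a subfield, since the orbit of a sum or product lies
  among the sums or products of two orbits. A separable element has its orbit among the roots of one
  polynomial.\<close>

lemma finite_emb_orbit:
  assumes "x \<in> \<Omega>"
  shows "finite {\<phi> x | \<phi>. field_embedding \<Omega> \<phi> \<and> (\<forall>y\<in>K. \<phi> y = y)}" (is "finite (?O x)")
proof -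
  note S = subfield_sep_gen
  have "is_subfield {x \<in> \<Omega>. finite (?O x)}"
  proof (rule is_subfieldI)
    have "?O 1 \<subseteq> {1}" using emb_1[OF S] by auto
    then show "1 \<in> {x \<in> \<Omega>. finite (?O x)}" using is_subfield_1[OF S] by (auto intro: finite_subset)
  next
    fix u v assume uv: "u \<in> {x \<in> \<Omega>. finite (?O x)}" "v \<in> {x \<in> \<Omega>. finite (?O x)}"
    then have fin: "finite (?O u \<times> ?O v)" by auto
    have "?O (u + v) \<subseteq> (\<lambda>(a, b). a + b) ` (?O u \<times> ?O v)" "?O (u * v) \<subseteq> (\<lambda>(a, b). a * b) ` (?O u \<times> ?O v)"
      using uv emb_add[OF S] emb_mult[OF S] by (auto simp: image_iff; blast)+
    then show "u + v \<in> {x \<in> \<Omega>. finite (?O x)}" "u * v \<in> {x \<in> \<Omega>. finite (?O x)}"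
      using uv is_subfield_closed[OF S] finite_subset[OF _ finite_imageI[OF fin]] by auto
  next
    fix u assume u: "u \<in> {x \<in> \<Omega>. finite (?O x)}"
    then have fin: "finite (?O u)" by auto
    have "?O (- u) \<subseteq> uminus ` ?O u" "?O (inverse u) \<subseteq> inverse ` ?O u"
      using u emb_uminus[OF S] emb_inverse[OF S] by (auto simp: image_iff; blast)+
    then show "- u \<in> {x \<in> \<Omega>. finite (?O x)}" "inverse u \<in> {x \<in> \<Omega>. finite (?O x)}"
      using u is_subfield_closed[OF S] finite_subset[OF _ finite_imageI[OF fin]] by auto
  qed
  then have "\<Omega> \<subseteq> {x \<in> \<Omega>. finite (?O x)}"
  proof (rule sep_gen_least)
    show "K \<subseteq> {x \<in> \<Omega>. finite (?O x)}"
    proof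
      fix x assume "x \<in> K"
      moreover from this have "?O x \<subseteq> {x}" by auto
      ultimately show "x \<in> {x \<in> \<Omega>. finite (?O x)}" using sep_gen_incl(1) by (auto intro: finite_subset)
    qed
    show "separable_closure K \<subseteq> {x \<in> \<Omega>. finite (?O x)}"
    proof
      fix x assume x: "x \<in> separable_closure K"
      then obtain f where f: "f \<in> polys_over K" "rsquarefree f" "poly f x = 0"
        using separable_closure_iff by auto
      have "finite {z. poly f z = 0}" using f(2) by (intro poly_roots_finite) (auto simp: rsquarefree_def)
      moreover have "?O x \<subseteq> {z. poly f z = 0}" using emb_maps_roots f by auto
      ultimately show "x \<in> {x \<in> \<Omega>. finite (?O x)}" using x sep_gen_incl(2) finite_subset by blast
    qed
  qed
  then show ?thesis using assms by auto
qed

text \<open>Embeddings over K compose, so each one permutes the finite orbit and fixes the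
  coefficients of its polynomial. As every element of \<Omega> outside K is moved by some embedding,
  the coefficients lie in K.\<close>

lemma orbit_polynomial:
  assumes x: "x \<in> \<Omega>"
  defines "Orb \<equiv> {\<phi> x | \<phi>. field_embedding \<Omega> \<phi> \<and> (\<forall>y\<in>K. \<phi> y = y)}"
  shows "(\<Prod>b\<in>Orb. [:- b, 1:]) \<in> polys_over K" "x \<in> Orb" "Orb \<subseteq> \<Omega>" "finite Orb"
proof -
  note S = subfield_sep_gen
  have ident: "field_embedding \<Omega> (\<lambda>y. y)" by (auto simp: field_embedding_def)
  show xO: "x \<in> Orb" unfolding Orb_def using ident by (auto intro!: exI[of _ "\<lambda>y. y"])
  show OO: "Orb \<subseteq> \<Omega>" 
  proof
    fix z assume "z \<in> Orb"
    then obtain \<phi> where "field_embedding \<Omega> \<phi>" "\<forall>y\<in>K. \<phi> y = y" "z = \<phi> x" unfolding Orb_def by auto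
    then show "z \<in> \<Omega>" using emb_sep_gen_onto[of \<phi>] x by blast
  qed
  show finO: "finite Orb" unfolding Orb_def by (rule finite_emb_orbit[OF x])
  let ?f = "\<Prod>b\<in>Orb. [:- b, 1:]"
  have lin: "[:- b, 1:] \<in> polys_over \<Omega>" if "b \<in> Orb" for b
    using that OO by (intro polys_over_pCons[OF S] polys_over_0[OF S]) (auto intro: is_subfield_closed[OF S])
  have f\<Omega>: "?f \<in> polys_over \<Omega>" using finO lin
    by (induction Orb) (auto intro!: polys_over_mult[OF S] polys_over_1[OF S] simp del: mult_pCons_left)
  have fixed: "map_poly \<phi> ?f = ?f" if \<phi>: "field_embedding \<Omega> \<phi>" "\<forall>y\<in>K. \<phi> y = y" for \<phi>
  proof -
    have sub: "\<phi> ` Orb \<subseteq> Orb"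
    proof
      fix z assume "z \<in> \<phi> ` Orb"
      then obtain \<psi> where \<psi>: "field_embedding \<Omega> \<psi>" "\<forall>y\<in>K. \<psi> y = y" "z = \<phi> (\<psi> x)" unfolding Orb_def by auto
      have "\<psi> y \<in> \<Omega>" if "y \<in> \<Omega>" for y using emb_sep_gen_onto[of \<psi>] \<psi> that by blast
      then have "field_embedding \<Omega> (\<lambda>y. \<phi> (\<psi> y))" using \<phi>(1) \<psi>(1) unfolding field_embedding_def by simp
      then show "z \<in> Orb" unfolding Orb_def using \<phi>(2) \<psi> by (auto intro!: exI[of _ "\<lambda>y. \<phi> (\<psi> y)"])
    qed
    have inj: "inj_on \<phi> Orb" using emb_eq_iff[OF S \<phi>(1)] OO by (auto simp: inj_on_def subset_iff)
    have img: "\<phi> ` Orb = Orb" by (rule endo_inj_surj[OF finO sub inj])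
    have "map_poly \<phi> ?f = (\<Prod>b\<in>Orb. map_poly \<phi> [:- b, 1:])"
      by (rule map_poly_emb_prod[OF S \<phi>(1)]) (rule lin)
    also have "\<dots> = (\<Prod>b\<in>Orb. [:- \<phi> b, 1:])"
    proof (rule prod.cong[OF refl])
      fix b assume "b \<in> Orb"
      then show "map_poly \<phi> [:- b, 1:] = [:- \<phi> b, 1:]"
        using OO emb_uminus[OF S \<phi>(1)] emb_0[OF S \<phi>(1)] emb_1[OF S \<phi>(1)]
        by (intro poly_eqI) (auto simp: coeff_map_poly coeff_pCons split: nat.splits)
    qed
    also have "\<dots> = (\<Prod>b\<in>\<phi> ` Orb. [:- b, 1:])" by (simp add: prod.reindex[OF inj])
    finally show ?thesis using img by simp
  qed
  have "coeff ?f i \<in> K" for i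
  proof (rule ccontr)
    assume notK: "coeff ?f i \<notin> K"
    have in\<Omega>: "coeff ?f i \<in> \<Omega>" using f\<Omega> unfolding polys_over_def by blast
    obtain \<phi> where \<phi>: "field_embedding \<Omega> \<phi>" "\<And>y. y \<in> K \<Longrightarrow> \<phi> y = y" "\<phi> (coeff ?f i) \<noteq> coeff ?f i"
      by (rule exists_moving_embedding[OF in\<Omega> notK]) blast
    have "coeff (map_poly \<phi> ?f) i = \<phi> (coeff ?f i)" using emb_0[OF S \<phi>(1)] by (rule coeff_map_poly)
    then show False using fixed[OF \<phi>(1)] \<phi>(2,3) by auto
  qed
  then show "?f \<in> polys_over K" unfolding polys_over_def by auto
qed

text \<open>Orbit polynomials are products of distinct linear factors, so every generated element is
  separable. In particular the separable elements form a field.\<close>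

lemma sep_gen_eq: "\<Omega> = separable_closure K"
proof
  show "\<Omega> \<subseteq> separable_closure K"
  proof
    fix x assume x: "x \<in> \<Omega>"
    define Orb where "Orb = {\<phi> x | \<phi>. field_embedding \<Omega> \<phi> \<and> (\<forall>y\<in>K. \<phi> y = y)}"
    note o = orbit_polynomial[OF x, folded Orb_def]
    have "poly (\<Prod>b\<in>Orb. [:- b, 1:]) x = 0" using o(2,4) by (auto simp: poly_prod)
    then show "x \<in> separable_closure K" using o(1) rsquarefree_prod_linear[OF o(4)] separable_closure_iff by blast
  qed
qed (rule sep_gen_incl)

text \<open>With f the orbit polynomial of a nonzero x^n, the derivative of f(X^n) is n X^(n-1)
  f'(X^n). It is nonzero at each root z: n is nonzero in the field, f is squarefree, and z is
  nonzero because conjugates of x^n are nonzero.\<close>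

lemma sep_gen_root_closed:
  assumes n: "of_nat n \<noteq> (0 :: 'c)" and x: "x ^ n \<in> \<Omega>"
  shows "x \<in> \<Omega>"
proof (cases "x = 0")
  case False
  define b where "b = x ^ n"
  define Orb where "Orb = {\<phi> b | \<phi>. field_embedding \<Omega> \<phi> \<and> (\<forall>y\<in>K. \<phi> y = y)}"
  have n0: "n > 0" using n by (cases n) auto
  note o = orbit_polynomial[OF x, folded b_def, folded Orb_def]
  define f where "f = (\<Prod>b\<in>Orb. [:- b, 1:])"
  have f: "f \<in> polys_over K" "rsquarefree f" "poly f b = 0"
    using o rsquarefree_prod_linear[OF o(4)] by (auto simp: f_def poly_prod)
  have "0 \<notin> Orb"
  proof
    assume "0 \<in> Orb"
    then obtain \<phi> where "field_embedding \<Omega> \<phi>" "\<phi> b = 0" unfolding Orb_def by auto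
    then show False using emb_eq_0_iff[OF subfield_sep_gen, of \<phi> b] x False b_def by auto
  qed
  then have f0: "poly f 0 \<noteq> 0" using o(4) by (auto simp: f_def poly_prod)
  define g where "g = pcompose f (Polynomial.monom 1 n)"
  have "g \<in> polys_over K"
    unfolding g_def using f(1)
  proof (induction f)
    case (pCons c f)
    then have c: "c \<in> K" and f: "f \<in> polys_over K"
      unfolding polys_over_def by (auto simp: coeff_pCons split: nat.splits)
    then show ?case using pCons.IH[OF f]
      by (auto simp: pcompose_pCons intro!: polys_over_add[OF K] polys_over_mult[OF K] polys_over_pCons[OF K]
        polys_over_monom[OF K] polys_over_0[OF K] is_subfield_closed[OF K])
  qed (auto intro: polys_over_0[OF K])
  moreover have "rsquarefree g"
    unfolding rsquarefree_iff_pderiv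
  proof (intro allI impI)
    fix z assume "poly g z = 0"
    then have fz: "poly f (z ^ n) = 0" by (simp add: g_def poly_pcompose poly_monom)
    then have "z \<noteq> 0" using f0 n0 by (auto simp: power_0_left)
    moreover have "poly (pderiv f) (z ^ n) \<noteq> 0" using fz f(2) unfolding rsquarefree_iff_pderiv by blast
    ultimately show "poly (pderiv g) z \<noteq> 0"
      using n by (simp add: g_def pderiv_pcompose poly_pcompose poly_monom pderiv_monom)
  qed
  moreover have "poly g x = 0" using f(3) by (simp add: g_def poly_pcompose poly_monom b_def)
  ultimately show ?thesis using sep_gen_eq separable_closure_iff by blast
qed (simp add: is_subfield_0[OF subfield_sep_gen])

end

section \<open>Roots of unity and Dedekind independence\<close>

text \<open>In characteristic p one has (\<zeta> - 1)^p = \<zeta>^p - 1 = 0, which would force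
  \<zeta> = 1.\<close>

lemma of_nat_neq_0_of_primitive_root:
  assumes "Factorial_Ring.prime p" "primitive_root_of_unity p (\<zeta> :: 'c::field)"
  shows "of_nat p \<noteq> (0 :: 'c)"
proof
  assume "of_nat p = (0 :: 'c)"
  then have "CHAR('c) dvd p" by (simp add: of_nat_eq_0_iff_char_dvd)
  then have c: "CHAR('c) = p" using assms(1) CHAR_not_1' by (metis One_nat_def prime_nat_iff)
  have "(\<zeta> - 1 + 1) ^ CHAR('c) = (\<zeta> - 1) ^ CHAR('c) + 1 ^ CHAR('c)"
    by (rule freshmans_dream) (use c assms(1) in auto)
  then have "(\<zeta> - 1) ^ p = 0" using assms(2) unfolding c primitive_root_of_unity_def by simp
  then have "\<zeta> = 1" by simp
  moreover have "1 < p" using assms(1) by (rule prime_gt_1_nat)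
  ultimately show False using assms(2) unfolding primitive_root_of_unity_def by (metis less_numeral_extra(1) power_one_right)
qed

text \<open>M is only asked to be closed under multiplication: for the Lagrange resolvent it will be
  the set of elements whose images depend on a restriction to a finite set, for the norm it will be
  a field.\<close>

lemma dedekind_independence:
  fixes s :: "'i \<Rightarrow> 'a::times \<Rightarrow> 'c::field"
  assumes "finite I"
    and M: "\<And>x y. x \<in> M \<Longrightarrow> y \<in> M \<Longrightarrow> x * y \<in> M"
    and mult: "\<And>i x y. i \<in> I \<Longrightarrow> x \<in> M \<Longrightarrow> y \<in> M \<Longrightarrow> s i (x * y) = s i x * s i y"
    and nz: "\<And>i. i \<in> I \<Longrightarrow> \<exists>x\<in>M. s i x \<noteq> 0"
    and dist: "\<And>i j. i \<in> I \<Longrightarrow> j \<in> I \<Longrightarrow> i \<noteq> j \<Longrightarrow> \<exists>x\<in>M. s i x \<noteq> s j x"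
    and zero: "\<And>x. x \<in> M \<Longrightarrow> (\<Sum>i\<in>I. c i * s i x) = 0"
  shows "\<forall>i\<in>I. c i = 0"
  using assms(1) mult nz dist zero
proof (induction I arbitrary: c)
  case (insert j I)
  have c0: "c i = 0" if "i \<in> I" for i
  proof -
    obtain y where y: "y \<in> M" "s i y \<noteq> s j y" using insert.prems(3)[of i j] insert.hyps \<open>i \<in> I\<close> by auto
    \<comment> \<open>The relation at \<open>x * y\<close> minus \<open>s j y\<close> times the
      relation at x eliminates the term of j and leaves a shorter relation.\<close>
    have "\<forall>i\<in>I. c i * (s i y - s j y) = 0"
    proof (rule insert.IH)
      fix x assume x: "x \<in> M"
      have 1: "c j * s j x + (\<Sum>i\<in>I. c i * s i x) = 0" using insert.prems(4)[OF x] insert.hyps by simp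
      have "c j * s j (x * y) + (\<Sum>i\<in>I. c i * s i (x * y)) = 0"
        using insert.prems(4)[OF M[OF x y(1)]] insert.hyps by simp
      then have 2: "c j * s j x * s j y + (\<Sum>i\<in>I. c i * s i x * s i y) = 0"
        using insert.prems(1) x y(1) by (simp add: mult.assoc)
      have "(\<Sum>i\<in>I. c i * (s i y - s j y) * s i x) = (\<Sum>i\<in>I. c i * s i x * s i y) - s j y * (\<Sum>i\<in>I. c i * s i x)"
        by (simp add: algebra_simps sum_subtractf sum_distrib_left)
      also have "\<dots> = - (c j * s j x * s j y) - s j y * (- (c j * s j x))"
        unfolding minus_unique[OF 1] minus_unique[OF 2] ..
      finally show "(\<Sum>i\<in>I. c i * (s i y - s j y) * s i x) = 0" by (simp add: algebra_simps)
    qed (use insert.prems in auto)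
    then show ?thesis using y(2) \<open>i \<in> I\<close> by auto
  qed
  obtain x where x: "x \<in> M" "s j x \<noteq> 0" using insert.prems(2) by auto
  have "c j = 0" using insert.prems(4)[OF x(1)] insert.hyps c0 x(2) by simp
  then show ?case using c0 by auto
qed auto

locale root_of_unity =
  fixes p :: nat and \<zeta> :: "'c::field"
  assumes prime_p: "Factorial_Ring.prime p" and zeta: "primitive_root_of_unity p \<zeta>"
begin

lemma p_gt_0 [simp]: "p > 0" and p_gt_1: "p > 1"
  using prime_p prime_gt_1_nat[of p] by auto

lemma p_ne_0 [simp]: "p \<noteq> 0"
  using p_gt_0 by simp

lemma p_neq_0: "of_nat p \<noteq> (0 :: 'c)"
  by (rule of_nat_neq_0_of_primitive_root[OF prime_p zeta])

lemma zeta_pow [simp]: "\<zeta> ^ p = 1"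
  using zeta by (simp add: primitive_root_of_unity_def)

lemma zeta_neq_0 [simp]: "\<zeta> \<noteq> 0"
  using zeta_pow p_gt_0 by (metis power_0_left zero_neq_one not_gr0)

lemma zeta_powi_add: "\<zeta> powi (i + j) = \<zeta> powi i * \<zeta> powi j"
  by (simp add: power_int_add)

lemma zeta_powi_mod: "\<zeta> powi (k mod int p) = \<zeta> powi k"
proof -
  have "\<zeta> powi k = \<zeta> powi (int p * (k div int p) + k mod int p)" by simp
  also have "\<dots> = (\<zeta> powi int p) powi (k div int p) * \<zeta> powi (k mod int p)"
    by (simp only: zeta_powi_add power_int_mult)
  finally show ?thesis by (simp add: power_int_of_nat)
qed

lemma zeta_powi_eq_1_iff: "\<zeta> powi k = 1 \<longleftrightarrow> int p dvd k"
proof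
  assume "\<zeta> powi k = 1"
  then have "\<zeta> ^ nat (k mod int p) = 1" using zeta_powi_mod[of k] p_gt_0
    by (simp add: power_int_def)
  moreover have "nat (k mod int p) < p" using p_gt_0 by (simp add: nat_less_iff)
  ultimately have "nat (k mod int p) = 0" using zeta unfolding primitive_root_of_unity_def by (metis not_gr0)
  then have "k mod int p = 0" using p_gt_0 by (metis nat_eq_iff2 pos_mod_sign of_nat_0_less_iff int_nat_eq of_nat_0)
  then show "int p dvd k" by auto
next
  assume "int p dvd k"
  then show "\<zeta> powi k = 1" using zeta_powi_mod[of k] by simp
qed

text \<open>The dictionary between F_p and the field: identities of cochains modulo p become
  identities between powers of \<zeta>, and conversely.\<close>

lemma zeta_powi_eq_iff: "\<zeta> powi i = \<zeta> powi j \<longleftrightarrow> i mod int p = j mod int p"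
proof -
  have "\<zeta> powi i = \<zeta> powi (i - j) * \<zeta> powi j" by (simp flip: zeta_powi_add)
  then have "\<zeta> powi i = \<zeta> powi j \<longleftrightarrow> \<zeta> powi (i - j) = 1" by simp
  then show ?thesis by (simp add: zeta_powi_eq_1_iff mod_eq_dvd_iff)
qed

text \<open>The p distinct powers of \<zeta> exhaust the at most p roots of X^p - 1. The exponent is
  normalized to the range in which cochains take their values.\<close>

lemma exists_zeta_powi:
  assumes "x ^ p = y ^ p" "y \<noteq> 0"
  obtains k where "0 \<le> k" "k < int p" "x = \<zeta> powi k * y"
proof -
  let ?f = "Polynomial.monom 1 p - 1 :: 'c poly"
  have f: "poly ?f z = z ^ p - 1" for z by (simp add: poly_monom)
  have deg: "Polynomial.degree ?f \<le> p" by (intro degree_diff_le) (auto simp: degree_monom_le)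
  have ne: "?f \<noteq> 0" using f[of 0] p_gt_0 by (metis diff_0 poly_0 power_0_left not_gr0 neg_equal_0_iff_equal zero_neq_one)
  have fin: "finite {z :: 'c. z ^ p = 1}" "card {z :: 'c. z ^ p = 1} \<le> p"
    using poly_roots_finite[OF ne] card_poly_roots_bound[OF ne] deg unfolding f by auto
  have inj: "inj_on (\<lambda>k. \<zeta> powi k) {0..<int p}"
    by (auto simp: inj_on_def zeta_powi_eq_iff)
  have "(\<lambda>k. \<zeta> powi k) ` {0..<int p} \<subseteq> {z. z ^ p = 1}"
    by (auto simp flip: power_int_of_nat power_int_mult simp: zeta_powi_eq_1_iff)
  moreover have "card ((\<lambda>k. \<zeta> powi k) ` {0..<int p}) = p" using inj by (simp add: card_image)
  ultimately have "(\<lambda>k. \<zeta> powi k) ` {0..<int p} = {z. z ^ p = 1}"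
    using fin by (metis card_seteq)
  moreover have "x / y \<in> {z. z ^ p = 1}" using assms by (simp add: power_divide)
  ultimately obtain k where "k \<in> {0..<int p}" "x / y = \<zeta> powi k" by (metis imageE)
  then show ?thesis using that[of k] assms(2) by (auto simp: field_simps)
qed

text \<open>Orthogonality of the characters of Z/p, from a geometric sum. It will separate the
  eigencomponents under a generator of the cyclic extension.\<close>

lemma sum_zeta_powi: "(\<Sum>k<p. \<zeta> powi (int k * j)) = (if int p dvd j then of_nat p else 0)"
proof (cases "int p dvd j")
  case True
  then have "\<zeta> powi (int k * j) = 1" for k by (simp add: zeta_powi_eq_1_iff)
  then show ?thesis using True by simp
next
  case False
  define z where "z = \<zeta> powi j"
  have "z \<noteq> 1" using False by (simp add: z_def zeta_powi_eq_1_iff)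
  moreover have "z ^ p = 1" by (simp add: z_def zeta_powi_eq_1_iff flip: power_int_of_nat power_int_mult)
  ultimately have "(\<Sum>k<p. z ^ k) = 0" by (simp add: geometric_sum)
  moreover have "\<zeta> powi (int k * j) = z ^ k" for k
    by (simp add: z_def mult.commute flip: power_int_of_nat power_int_mult)
  ultimately show ?thesis using False by simp
qed

end

section \<open>Kummer theory for a group of automorphisms with finite orbits\<close>

text \<open>
  \<open>H\<close> is not required to be the full automorphism group of \<open>\<Omega>\<close> over its fixed field: finiteness
  of orbits is all that is used. The locale therefore applies to the stabilizer of \<open>a\<^sup>1\<^sup>/\<^sup>p\<close> without
  comparing the separable closures of \<open>K\<close> and \<open>K(a\<^sup>1\<^sup>/\<^sup>p)\<close>.
\<close>

locale automorphism_group = root_of_unity p \<zeta> for p and \<zeta> :: "'c::alg_closed_field" +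
  fixes \<Omega> :: "'c set" and H :: "('c \<Rightarrow> 'c) set"
  assumes subfield_Omega: "is_subfield \<Omega>"
    and Bij: "\<sigma> \<in> H \<Longrightarrow> \<sigma> \<in> Bij \<Omega>"
    and emb: "\<sigma> \<in> H \<Longrightarrow> field_embedding \<Omega> \<sigma>"
    and id_mem: "(\<lambda>x\<in>\<Omega>. x) \<in> H"
    and compose_mem: "\<sigma> \<in> H \<Longrightarrow> \<tau> \<in> H \<Longrightarrow> compose \<Omega> \<sigma> \<tau> \<in> H"
    and inv_mem: "\<sigma> \<in> H \<Longrightarrow> restrict (inv_into \<Omega> \<sigma>) \<Omega> \<in> H"
    and finite_orbit: "x \<in> \<Omega> \<Longrightarrow> finite {\<sigma> x | \<sigma>. \<sigma> \<in> H}"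
    and root_closed: "x ^ p \<in> \<Omega> \<Longrightarrow> x \<in> \<Omega>"
    and zeta_fixed: "\<sigma> \<in> H \<Longrightarrow> \<sigma> \<zeta> = \<zeta>"
begin

definition inverse_aut :: "('c \<Rightarrow> 'c) \<Rightarrow> ('c \<Rightarrow> 'c)" where
  "inverse_aut \<sigma> = restrict (inv_into \<Omega> \<sigma>) \<Omega>"

lemma inverse_aut_mem: "\<sigma> \<in> H \<Longrightarrow> inverse_aut \<sigma> \<in> H"
  unfolding inverse_aut_def by (rule inv_mem)

definition fixed_field :: "'c set" where
  "fixed_field = {x \<in> \<Omega>. \<forall>\<sigma>\<in>H. \<sigma> x = x}"

text \<open>Continuity of a map on \<open>H\<close> into a discrete space, for the topology of pointwise convergence.\<close>

definition locally_constant :: "(('c \<Rightarrow> 'c) \<Rightarrow> 'x) \<Rightarrow> bool" where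
  "locally_constant f \<longleftrightarrow> (\<forall>\<sigma>\<in>H. \<exists>F. finite F \<and> F \<subseteq> \<Omega> \<and> (\<forall>\<tau>\<in>H. (\<forall>x\<in>F. \<tau> x = \<sigma> x) \<longrightarrow> f \<tau> = f \<sigma>))"

lemmas aut_add = emb_add[OF subfield_Omega emb]
  and aut_mult = emb_mult[OF subfield_Omega emb]
  and aut_uminus = emb_uminus[OF subfield_Omega emb]
  and aut_inverse = emb_inverse[OF subfield_Omega emb]
  and aut_divide = emb_divide[OF subfield_Omega emb]
  and aut_power = emb_power[OF subfield_Omega emb]
  and aut_powi = emb_powi[OF subfield_Omega emb]
  and aut_sum = emb_sum[OF subfield_Omega emb]
  and aut_prod = emb_prod[OF subfield_Omega emb]
  and aut_eq_0_iff = emb_eq_0_iff[OF subfield_Omega emb]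
  and aut_eq_iff = emb_eq_iff[OF subfield_Omega emb]

lemma aut_1: "\<sigma> \<in> H \<Longrightarrow> \<sigma> 1 = 1"
  by (rule emb_1[OF subfield_Omega emb])

lemmas Omega_closed = is_subfield_closed[OF subfield_Omega]

lemma zeta_mem: "\<zeta> \<in> \<Omega>"
  by (rule root_closed) (simp add: Omega_closed)

lemma zeta_powi_mem: "\<zeta> powi k \<in> \<Omega>"
  by (intro Omega_closed zeta_mem)

lemma aut_zeta_powi: "\<sigma> \<in> H \<Longrightarrow> \<sigma> (\<zeta> powi k) = \<zeta> powi k"
  by (simp add: aut_powi zeta_mem zeta_fixed)

lemma aut_mem: "\<sigma> \<in> H \<Longrightarrow> x \<in> \<Omega> \<Longrightarrow> \<sigma> x \<in> \<Omega>"
  using Bij Bij_imp_funcset by blast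

lemma inverse_aut: "\<sigma> \<in> H \<Longrightarrow> x \<in> \<Omega> \<Longrightarrow> \<sigma> (inverse_aut \<sigma> x) = x"
  "\<sigma> \<in> H \<Longrightarrow> x \<in> \<Omega> \<Longrightarrow> inverse_aut \<sigma> (\<sigma> x) = x"
  using Bij[of \<sigma>] aut_mem[of \<sigma> x] by (auto simp: inverse_aut_def Bij_def bij_betw_def f_inv_into_f inv_into_f_f)

lemma aut_ext: "\<sigma> \<in> H \<Longrightarrow> \<tau> \<in> H \<Longrightarrow> (\<And>x. x \<in> \<Omega> \<Longrightarrow> \<sigma> x = \<tau> x) \<Longrightarrow> \<sigma> = \<tau>"
  using Bij by (metis Bij_imp_extensional extensionalityI)

lemma locally_constantD:
  assumes "locally_constant f" "\<sigma> \<in> H"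
  obtains F where "finite F" "F \<subseteq> \<Omega>" "\<And>\<tau>. \<tau> \<in> H \<Longrightarrow> (\<And>x. x \<in> F \<Longrightarrow> \<tau> x = \<sigma> x) \<Longrightarrow> f \<tau> = f \<sigma>"
  using assms unfolding locally_constant_def by metis

lemma locally_constantI:
  assumes "finite F" "F \<subseteq> \<Omega>"
    "\<And>\<sigma> \<tau>. \<sigma> \<in> H \<Longrightarrow> \<tau> \<in> H \<Longrightarrow> (\<And>x. x \<in> F \<Longrightarrow> \<tau> x = \<sigma> x) \<Longrightarrow> f \<tau> = f \<sigma>"
  shows "locally_constant f"
  using assms unfolding locally_constant_def by metis

lemma fixed_field_iff: "x \<in> fixed_field \<longleftrightarrow> x \<in> \<Omega> \<and> (\<forall>\<sigma>\<in>H. \<sigma> x = x)"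
  by (simp add: fixed_field_def)

lemma fixed_field_subset: "fixed_field \<subseteq> \<Omega>"
  by (auto simp: fixed_field_def)

lemma subfield_fixed: "is_subfield fixed_field"
  by (rule is_subfieldI)
    (auto simp: fixed_field_iff Omega_closed aut_add aut_mult aut_uminus aut_inverse
      emb_1[OF subfield_Omega emb])

lemma zeta_fixed_field: "\<zeta> powi k \<in> fixed_field"
  by (simp add: fixed_field_iff zeta_powi_mem aut_zeta_powi)

lemma subgroup_automorphism_group:
  assumes "U \<subseteq> H" "(\<lambda>x\<in>\<Omega>. x) \<in> U"
    "\<And>\<sigma> \<tau>. \<sigma> \<in> U \<Longrightarrow> \<tau> \<in> U \<Longrightarrow> compose \<Omega> \<sigma> \<tau> \<in> U"
    "\<And>\<sigma>. \<sigma> \<in> U \<Longrightarrow> inverse_aut \<sigma> \<in> U"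
  shows "automorphism_group p \<zeta> \<Omega> U"
proof (intro automorphism_group.intro automorphism_group_axioms.intro)
  fix x assume "x \<in> \<Omega>"
  then show "finite {\<sigma> x | \<sigma>. \<sigma> \<in> U}"
    by (rule finite_subset[OF _ finite_orbit, rotated]) (use assms(1) in auto)
qed (simp_all add: root_of_unity_axioms assms subfield_Omega Bij emb zeta_fixed root_closed
  inverse_aut_def[symmetric] subsetD[OF assms(1)])

text \<open>
  A Lagrange resolvent over the finitely many restrictions of \<open>H\<close> to a finite set on which
  \<open>f\<close> depends.
\<close>

theorem exists_kummer_generator:
  assumes hom: "\<And>\<sigma> \<tau>. \<sigma> \<in> H \<Longrightarrow> \<tau> \<in> H \<Longrightarrow> \<zeta> powi f (compose \<Omega> \<sigma> \<tau>) = \<zeta> powi f \<sigma> * \<zeta> powi f \<tau>"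
    and cont: "locally_constant f"
  obtains \<gamma> where "\<gamma> \<in> \<Omega>" "\<gamma> \<noteq> 0" "\<And>\<sigma>. \<sigma> \<in> H \<Longrightarrow> \<sigma> \<gamma> = \<zeta> powi f \<sigma> * \<gamma>"
proof -
  obtain F where F: "finite F" "F \<subseteq> \<Omega>"
    "\<And>\<tau>. \<tau> \<in> H \<Longrightarrow> (\<And>x. x \<in> F \<Longrightarrow> \<tau> x = (\<lambda>x\<in>\<Omega>. x) x) \<Longrightarrow> f \<tau> = f (\<lambda>x\<in>\<Omega>. x)"
    using locally_constantD[OF cont id_mem] by metis
  have "compose \<Omega> (\<lambda>x\<in>\<Omega>. x) (\<lambda>x\<in>\<Omega>. x) = (\<lambda>x\<in>\<Omega>. x)" by (auto simp: compose_def)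
  then have f1: "\<zeta> powi f (\<lambda>x\<in>\<Omega>. x) = 1" using hom[OF id_mem id_mem] by simp
  \<comment> \<open>Automorphisms that agree on F differ by one fixing F pointwise, where the
    character is trivial. So \<open>\<zeta> powi f\<close> factors through restriction to F,
    although f itself need do so only modulo p.\<close>
  have dep: "\<zeta> powi f \<sigma> = \<zeta> powi f \<tau>" if s: "\<sigma> \<in> H" "\<tau> \<in> H" "\<And>x. x \<in> F \<Longrightarrow> \<sigma> x = \<tau> x" for \<sigma> \<tau>
  proof -
    define \<rho> where "\<rho> = compose \<Omega> (inverse_aut \<tau>) \<sigma>"
    have "\<rho> \<in> H" unfolding \<rho>_def by (intro compose_mem inverse_aut_mem s)
    moreover have "\<rho> x = (\<lambda>x\<in>\<Omega>. x) x" if "x \<in> F" for x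
      using that F(2) s inverse_aut(2)[OF s(2), of x] by (auto simp: \<rho>_def compose_def)
    ultimately have "\<zeta> powi f \<rho> = 1" using F(3) f1 by metis
    moreover have "compose \<Omega> \<tau> \<rho> = \<sigma>"
      using s \<open>\<rho> \<in> H\<close> inverse_aut(1)[OF s(2)] aut_mem
      by (intro aut_ext compose_mem) (auto simp: \<rho>_def compose_def)
    ultimately show ?thesis using hom[OF s(2) \<open>\<rho> \<in> H\<close>] by simp
  qed
  define R where "R = (\<lambda>\<sigma>. restrict \<sigma> F) ` H"
  have "R \<subseteq> (\<Pi>\<^sub>E x\<in>F. {\<sigma> x | \<sigma>. \<sigma> \<in> H})" unfolding R_def by auto
  moreover have "finite (\<Pi>\<^sub>E x\<in>F. {\<sigma> x | \<sigma>. \<sigma> \<in> H})" using F(1,2) finite_orbit by (intro finite_PiE) auto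
  ultimately have finR: "finite R" by (rule finite_subset)
  define r where "r \<rho> = (SOME \<sigma>. \<sigma> \<in> H \<and> restrict \<sigma> F = \<rho>)" for \<rho>
  have r: "r \<rho> \<in> H \<and> restrict (r \<rho>) F = \<rho>" if "\<rho> \<in> R" for \<rho>
  proof -
    have "\<exists>\<sigma>. \<sigma> \<in> H \<and> restrict \<sigma> F = \<rho>" using that unfolding R_def by blast
    then show ?thesis unfolding r_def by (rule someI_ex)
  qed
  have rF: "r \<rho> x = \<rho> x" if "\<rho> \<in> R" "x \<in> F" for \<rho> x using r[OF that(1)] that(2) by (metis restrict_apply')
  \<comment> \<open>The elements whose image is determined by the restriction to F. M contains F,
    which separates the chosen representatives, and 1, at which none of them vanishes: exactly what
    Dedekind independence asks for.\<close>
  define M where "M = {x \<in> \<Omega>. \<forall>\<sigma>\<in>H. \<forall>\<tau>\<in>H. (\<forall>y\<in>F. \<sigma> y = \<tau> y) \<longrightarrow> \<sigma> x = \<tau> x}"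
  have "F \<subseteq> M" using F(2) by (auto simp: M_def)
  have "1 \<in> M" by (simp add: M_def Omega_closed) (metis aut_1)
  have Mmult: "x * y \<in> M" if "x \<in> M" "y \<in> M" for x y
    unfolding M_def
  proof (intro CollectI conjI ballI impI)
    show "x * y \<in> \<Omega>" using that by (auto simp: M_def Omega_closed)
    fix \<sigma> \<tau> assume "\<sigma> \<in> H" "\<tau> \<in> H" "\<forall>y\<in>F. \<sigma> y = \<tau> y"
    then have "\<sigma> (x * y) = \<sigma> x * \<sigma> y" "\<tau> (x * y) = \<tau> x * \<tau> y" "\<sigma> x = \<tau> x" "\<sigma> y = \<tau> y"
      using that aut_mult unfolding M_def by blast+
    then show "\<sigma> (x * y) = \<tau> (x * y)" by simp
  qed
  \<comment> \<open>The coefficients are powers of \<zeta>, hence nonzero, so the resolvent cannot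
    vanish on all of M.\<close>
  have "\<exists>x\<in>M. (\<Sum>\<rho>\<in>R. \<zeta> powi (- f (r \<rho>)) * r \<rho> x) \<noteq> 0"
  proof (rule ccontr)
    assume "\<not> ?thesis"
    then have "\<forall>\<rho>\<in>R. \<zeta> powi (- f (r \<rho>)) = 0"
    proof (intro dedekind_independence[where M = M and s = r] finR)
      fix \<rho> \<rho>' assume \<rho>: "\<rho> \<in> R" "\<rho>' \<in> R" "\<rho> \<noteq> \<rho>'"
      show "\<exists>x\<in>M. r \<rho> x \<noteq> r \<rho>' x"
      proof (rule ccontr)
        assume "\<not> ?thesis"
        then have "\<forall>x\<in>F. r \<rho> x = r \<rho>' x" using \<open>F \<subseteq> M\<close> by auto
        then have "restrict (r \<rho>) F = restrict (r \<rho>') F" by (auto simp: restrict_def)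
        then show False using r \<rho> by metis
      qed
    next
      fix \<rho> assume "\<rho> \<in> R"
      then show "\<exists>x\<in>M. r \<rho> x \<noteq> 0" using r aut_1[of "r \<rho>"] by (intro bexI[OF _ \<open>1 \<in> M\<close>]) auto
    next
      fix \<rho> x y assume "\<rho> \<in> R" "x \<in> M" "y \<in> M"
      then show "r \<rho> (x * y) = r \<rho> x * r \<rho> y" using r by (simp add: M_def aut_mult)
    qed (auto intro: Mmult)
    moreover have "restrict (\<lambda>x\<in>\<Omega>. x) F \<in> R" unfolding R_def using id_mem by blast
    ultimately show False by auto
  qed
  then obtain x where x: "x \<in> M" "(\<Sum>\<rho>\<in>R. \<zeta> powi (- f (r \<rho>)) * r \<rho> x) \<noteq> 0" by blast
  define \<gamma> where "\<gamma> = (\<Sum>\<rho>\<in>R. \<zeta> powi (- f (r \<rho>)) * r \<rho> x)"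
  have x\<Omega>: "x \<in> \<Omega>" using x(1) by (simp add: M_def)
  have term_mem: "\<zeta> powi (- f (r \<rho>)) * r \<rho> x \<in> \<Omega>" if "\<rho> \<in> R" for \<rho>
    using r[OF that] x\<Omega> by (intro Omega_closed(4) zeta_powi_mem) (rule aut_mem, auto)
  have "\<gamma> \<in> \<Omega>" unfolding \<gamma>_def by (intro is_subfield_sum[OF subfield_Omega] term_mem)
  moreover have "\<sigma> \<gamma> = \<zeta> powi f \<sigma> * \<gamma>" if s: "\<sigma> \<in> H" for \<sigma>
  proof -
    \<comment> \<open>Composition with \<sigma> permutes the restrictions; reindexing the resolvent
      along this permutation brings out the factor \<open>\<zeta> powi f \<sigma>\<close>.\<close>
    define t where "t \<rho> = restrict (compose \<Omega> \<sigma> (r \<rho>)) F" for \<rho>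
    have tR: "t \<rho> \<in> R" if "\<rho> \<in> R" for \<rho> unfolding t_def R_def using compose_mem[OF s] r[OF that] by auto
    have agree: "r (t \<rho>) y = compose \<Omega> \<sigma> (r \<rho>) y" if "\<rho> \<in> R" "y \<in> F" for \<rho> y
      using rF[OF tR[OF that(1)] that(2)] that(2) by (simp add: t_def)
    have inj: "inj_on t R"
    proof (rule inj_onI)
      fix \<rho> \<rho>' assume \<rho>: "\<rho> \<in> R" "\<rho>' \<in> R" "t \<rho> = t \<rho>'"
      have "r \<rho> y = r \<rho>' y" if "y \<in> F" for y
      proof -
        have "compose \<Omega> \<sigma> (r \<rho>) y = compose \<Omega> \<sigma> (r \<rho>') y" using \<rho>(3) that unfolding t_def by (metis restrict_apply')
        then show ?thesis using that F(2) aut_eq_iff[OF s] aut_mem r \<rho> by (auto simp: compose_def)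
      qed
      then have "restrict (r \<rho>) F = restrict (r \<rho>') F" by (auto simp: restrict_def)
      then show "\<rho> = \<rho>'" using r \<rho> by metis
    qed
    have tRR: "t ` R = R" using tR by (intro endo_inj_surj finR inj) auto
    have summand: "\<sigma> (\<zeta> powi (- f (r \<rho>)) * r \<rho> x) = \<zeta> powi f \<sigma> * (\<zeta> powi (- f (r (t \<rho>))) * r (t \<rho>) x)"
      if \<rho>: "\<rho> \<in> R" for \<rho>
    proof -
      note rr = r[OF \<rho>, THEN conjunct1] r[OF tR[OF \<rho>], THEN conjunct1]
      have e1: "r (t \<rho>) x = \<sigma> (r \<rho> x)"
      proof -
        have "r (t \<rho>) x = compose \<Omega> \<sigma> (r \<rho>) x"
          using x(1) rr compose_mem[OF s rr(1)] agree[OF \<rho>] unfolding M_def by blast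
        then show ?thesis using x\<Omega> by (simp add: compose_def)
      qed
      have "\<zeta> powi f (r (t \<rho>)) = \<zeta> powi f (compose \<Omega> \<sigma> (r \<rho>))"
        using agree[OF \<rho>] by (intro dep rr compose_mem s)
      also have "\<dots> = \<zeta> powi f \<sigma> * \<zeta> powi f (r \<rho>)" by (rule hom[OF s rr(1)])
      finally have e2: "\<zeta> powi (- f (r \<rho>)) = \<zeta> powi f \<sigma> * \<zeta> powi (- f (r (t \<rho>)))"
        by (simp add: power_int_minus field_simps)
      have "\<sigma> (\<zeta> powi (- f (r \<rho>)) * r \<rho> x) = \<zeta> powi (- f (r \<rho>)) * \<sigma> (r \<rho> x)"
        using aut_mult[OF s zeta_powi_mem aut_mem[OF rr(1) x\<Omega>]] aut_zeta_powi[OF s] by simp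
      then show ?thesis unfolding e1 e2 by simp
    qed
    have "\<sigma> \<gamma> = (\<Sum>\<rho>\<in>R. \<sigma> (\<zeta> powi (- f (r \<rho>)) * r \<rho> x))"
      unfolding \<gamma>_def by (rule aut_sum[OF s]) (rule term_mem)
    also have "\<dots> = (\<Sum>\<rho>\<in>R. \<zeta> powi f \<sigma> * (\<zeta> powi (- f (r (t \<rho>))) * r (t \<rho>) x))"
      by (rule sum.cong) (auto simp: summand)
    also have "\<dots> = \<zeta> powi f \<sigma> * (\<Sum>\<rho>\<in>R. \<zeta> powi (- f (r (t \<rho>))) * r (t \<rho>) x)"
      by (simp add: sum_distrib_left)
    also have "(\<Sum>\<rho>\<in>R. \<zeta> powi (- f (r (t \<rho>))) * r (t \<rho>) x) = (\<Sum>\<rho>\<in>t ` R. \<zeta> powi (- f (r \<rho>)) * r \<rho> x)"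
      by (simp add: sum.reindex[OF inj])
    finally show ?thesis unfolding tRR \<gamma>_def .
  qed
  ultimately show ?thesis using that x(2) unfolding \<gamma>_def by blast
qed

end

section \<open>Kummer characters of elements of the fixed field\<close>

context automorphism_group
begin

text \<open>The choice of the root is immaterial: two roots differ by a power of \<zeta>, which H
  fixes. The exponent is taken in \<open>{0..<int p}\<close> because that is where cochains take
  their values.\<close>

definition kummer_char :: "'c \<Rightarrow> ('c \<Rightarrow> 'c) \<Rightarrow> int" where
  "kummer_char b \<sigma> = (THE k. 0 \<le> k \<and> k < int p \<and>
     \<sigma> (SOME \<beta>. \<beta> ^ p = b) = \<zeta> powi k * (SOME \<beta>. \<beta> ^ p = b))"

lemma fixed_root_mem: "\<beta> ^ p \<in> fixed_field \<Longrightarrow> \<beta> \<in> \<Omega>"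
  using fixed_field_subset root_closed by blast

lemma kummer_char_aux:
  assumes "\<beta> ^ p \<in> fixed_field" "\<beta> \<noteq> 0" "\<sigma> \<in> H"
  obtains k where "0 \<le> k" "k < int p" "\<sigma> \<beta> = \<zeta> powi k * \<beta>"
proof -
  have "\<sigma> \<beta> ^ p = \<beta> ^ p"
    using assms aut_power[OF assms(3) fixed_root_mem[OF assms(1)], of p] by (metis fixed_field_iff)
  then show ?thesis using exists_zeta_powi assms(2) that by metis
qed

lemma kummer_char:
  assumes b: "\<beta> ^ p = b" "b \<in> fixed_field" "b \<noteq> 0" and s: "\<sigma> \<in> H"
  shows "\<sigma> \<beta> = \<zeta> powi kummer_char b \<sigma> * \<beta>" "0 \<le> kummer_char b \<sigma>" "kummer_char b \<sigma> < int p"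
proof -
  define \<beta>0 where "\<beta>0 = (SOME \<beta>. \<beta> ^ p = b)"
  have \<beta>0: "\<beta>0 ^ p = b" unfolding \<beta>0_def by (rule someI[of "\<lambda>\<beta>. \<beta> ^ p = b", OF b(1)])
  then have nz: "\<beta>0 \<noteq> 0" "\<beta> \<noteq> 0" using b by (auto simp: power_0_left)
  obtain k where k: "0 \<le> k" "k < int p" "\<sigma> \<beta>0 = \<zeta> powi k * \<beta>0"
    by (rule kummer_char_aux[of \<beta>0 \<sigma>]) (use \<beta>0 b nz s in auto)
  have "kummer_char b \<sigma> = k"
    unfolding kummer_char_def \<beta>0_def[symmetric]
  proof (rule the_equality)
    fix j assume j: "0 \<le> j \<and> j < int p \<and> \<sigma> \<beta>0 = \<zeta> powi j * \<beta>0"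
    then have "\<zeta> powi j = \<zeta> powi k" using k(3) nz by simp
    then show "j = k" using j k by (simp add: zeta_powi_eq_iff)
  qed (use k in auto)
  then show "0 \<le> kummer_char b \<sigma>" "kummer_char b \<sigma> < int p" using k by auto
  obtain j where "\<beta> = \<zeta> powi j * \<beta>0" using exists_zeta_powi[of \<beta> \<beta>0] b(1) \<beta>0 nz by metis
  moreover have "\<beta>0 \<in> \<Omega>" using \<beta>0 b(2) fixed_root_mem by simp
  ultimately show "\<sigma> \<beta> = \<zeta> powi kummer_char b \<sigma> * \<beta>"
    using k \<open>kummer_char b \<sigma> = k\<close> s by (simp add: aut_mult zeta_powi_mem aut_zeta_powi)
qed

lemma kummer_char_unique:
  assumes "\<beta> ^ p = b" "b \<in> fixed_field" "b \<noteq> 0" "\<sigma> \<in> H" "\<sigma> \<beta> = \<zeta> powi k * \<beta>"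
  shows "kummer_char b \<sigma> = k mod int p"
proof -
  have "\<beta> \<noteq> 0" using assms by (auto simp: power_0_left)
  then have "\<zeta> powi kummer_char b \<sigma> = \<zeta> powi k" using kummer_char(1)[OF assms(1-4)] assms(5) by simp
  then show ?thesis using kummer_char(2,3)[OF assms(1-4)] by (simp add: zeta_powi_eq_iff)
qed

lemma kummer_char_range:
  assumes "b \<in> fixed_field" "b \<noteq> 0" "\<sigma> \<in> H"
  shows "0 \<le> kummer_char b \<sigma>" "kummer_char b \<sigma> < int p"
  using kummer_char nth_root_exists[OF p_gt_0, of b] assms by metis+

lemma kummer_char_compose:
  assumes "b \<in> fixed_field" "b \<noteq> 0" "\<sigma> \<in> H" "\<tau> \<in> H"
  shows "kummer_char b (compose \<Omega> \<sigma> \<tau>) = (kummer_char b \<sigma> + kummer_char b \<tau>) mod int p"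
proof -
  obtain \<beta> where \<beta>: "\<beta> ^ p = b" using nth_root_exists[OF p_gt_0] by blast
  have m: "\<beta> \<in> \<Omega>" using \<beta> assms fixed_root_mem by simp
  show ?thesis
  proof (rule kummer_char_unique[OF \<beta> assms(1,2) compose_mem[OF assms(3,4)]])
    show "compose \<Omega> \<sigma> \<tau> \<beta> = \<zeta> powi (kummer_char b \<sigma> + kummer_char b \<tau>) * \<beta>"
      using m kummer_char(1)[OF \<beta> assms(1,2,3)] kummer_char(1)[OF \<beta> assms(1,2,4)] assms(3)
      by (simp add: compose_def aut_mult zeta_powi_mem aut_zeta_powi zeta_powi_add)
  qed
qed

lemma kummer_char_mult:
  assumes "b \<in> fixed_field" "b \<noteq> 0" "c \<in> fixed_field" "c \<noteq> 0" "\<sigma> \<in> H"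
  shows "kummer_char (b * c) \<sigma> = (kummer_char b \<sigma> + kummer_char c \<sigma>) mod int p"
proof -
  obtain \<beta> \<gamma> where \<beta>: "\<beta> ^ p = b" "\<gamma> ^ p = c" using nth_root_exists[OF p_gt_0] by metis
  have m: "\<beta> \<in> \<Omega>" "\<gamma> \<in> \<Omega>" using \<beta> assms fixed_root_mem by auto
  show ?thesis
  proof (rule kummer_char_unique[of "\<beta> * \<gamma>"])
    show "\<sigma> (\<beta> * \<gamma>) = \<zeta> powi (kummer_char b \<sigma> + kummer_char c \<sigma>) * (\<beta> * \<gamma>)"
      using m kummer_char(1)[OF \<beta>(1) assms(1,2,5)] kummer_char(1)[OF \<beta>(2) assms(3,4,5)] assms(5)
      by (simp add: aut_mult zeta_powi_add)
  qed (use assms \<beta> is_subfield_mult[OF subfield_fixed] in \<open>auto simp: power_mult_distrib\<close>)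
qed

lemma kummer_char_eq_0_iff:
  assumes "\<beta> ^ p = b" "b \<in> fixed_field" "b \<noteq> 0" "\<sigma> \<in> H"
  shows "kummer_char b \<sigma> = 0 \<longleftrightarrow> \<sigma> \<beta> = \<beta>"
  using kummer_char(1)[OF assms] kummer_char_unique[OF assms, of 0] by auto

text \<open>Injectivity of the Kummer map modulo p-th powers: the characters agree exactly when the
  quotient of the p-th roots is fixed by H.\<close>

lemma kummer_char_eq_iff:
  assumes "b \<in> fixed_field" "b \<noteq> 0" "c \<in> fixed_field" "c \<noteq> 0"
  shows "(\<forall>\<sigma>\<in>H. kummer_char b \<sigma> = kummer_char c \<sigma>) \<longleftrightarrow> (\<exists>d\<in>fixed_field - {0}. b = d ^ p * c)"
proof -
  obtain \<beta> \<gamma> where \<beta>: "\<beta> ^ p = b" "\<gamma> ^ p = c" using nth_root_exists[OF p_gt_0] by metis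
  have m: "\<beta> \<in> \<Omega>" "\<gamma> \<in> \<Omega>" using \<beta> assms fixed_root_mem by auto
  have nz: "\<beta> \<noteq> 0" "\<gamma> \<noteq> 0" using \<beta> assms by (auto simp: power_0_left)
  show ?thesis
  proof
    assume eq: "\<forall>\<sigma>\<in>H. kummer_char b \<sigma> = kummer_char c \<sigma>"
    have "\<sigma> (\<beta> / \<gamma>) = \<beta> / \<gamma>" if s: "\<sigma> \<in> H" for \<sigma>
      using kummer_char(1)[OF \<beta>(1) assms(1,2) s] kummer_char(1)[OF \<beta>(2) assms(3,4) s] eq s m
      by (simp add: aut_divide)
    then have "\<beta> / \<gamma> \<in> fixed_field" using m by (simp add: fixed_field_iff Omega_closed)
    moreover have "b = (\<beta> / \<gamma>) ^ p * c" using \<beta> nz by (simp add: power_divide flip: \<beta>)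
    ultimately show "\<exists>d\<in>fixed_field - {0}. b = d ^ p * c" using nz by (intro bexI[of _ "\<beta> / \<gamma>"]) auto
  next
    assume "\<exists>d\<in>fixed_field - {0}. b = d ^ p * c"
    then obtain d where d: "d \<in> fixed_field" "d \<noteq> 0" "b = d ^ p * c" by blast
    show "\<forall>\<sigma>\<in>H. kummer_char b \<sigma> = kummer_char c \<sigma>"
    proof
      fix \<sigma> assume s: "\<sigma> \<in> H"
      have "d \<in> \<Omega>" "\<sigma> d = d" using d(1) s by (auto simp: fixed_field_iff)
      then have "\<sigma> (d * \<gamma>) = \<zeta> powi kummer_char c \<sigma> * (d * \<gamma>)"
        using m kummer_char(1)[OF \<beta>(2) assms(3,4) s] s by (simp add: aut_mult)
      then have "kummer_char b \<sigma> = kummer_char c \<sigma> mod int p"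
        by (intro kummer_char_unique[of "d * \<gamma>"]) (use assms d \<beta> s in \<open>auto simp: power_mult_distrib\<close>)
      then show "kummer_char b \<sigma> = kummer_char c \<sigma>" using kummer_char_range[OF assms(3,4) s] by simp
    qed
  qed
qed

lemma locally_constant_kummer_char:
  assumes "b \<in> fixed_field" "b \<noteq> 0" shows "locally_constant (kummer_char b)"
proof -
  obtain \<beta> where \<beta>: "\<beta> ^ p = b" using nth_root_exists[OF p_gt_0] by blast
  show ?thesis
  proof (rule locally_constantI[of "{\<beta>}"])
    fix \<sigma> \<tau> assume st: "\<sigma> \<in> H" "\<tau> \<in> H" and "\<And>x. x \<in> {\<beta>} \<Longrightarrow> \<tau> x = \<sigma> x"
    then have "\<tau> \<beta> = \<zeta> powi kummer_char b \<sigma> * \<beta>" using kummer_char(1)[OF \<beta> assms st(1)] by simp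
    from kummer_char_unique[OF \<beta> assms st(2) this]
    show "kummer_char b \<tau> = kummer_char b \<sigma>"
      using kummer_char_range[OF assms st(1)] by simp
  qed (use \<beta> assms fixed_root_mem in auto)
qed

text \<open>Surjectivity of the Kummer map: the p-th power of a Kummer generator is fixed, because
  the factors \<open>\<zeta> powi f \<sigma>\<close> have p-th power 1.\<close>

theorem kummer_char_surj:
  assumes hom: "\<And>\<sigma> \<tau>. \<sigma> \<in> H \<Longrightarrow> \<tau> \<in> H \<Longrightarrow> \<zeta> powi f (compose \<Omega> \<sigma> \<tau>) = \<zeta> powi f \<sigma> * \<zeta> powi f \<tau>"
    and cont: "locally_constant f" and range: "\<And>\<sigma>. \<sigma> \<in> H \<Longrightarrow> 0 \<le> f \<sigma> \<and> f \<sigma> < int p"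
  obtains b where "b \<in> fixed_field" "b \<noteq> 0" "\<And>\<sigma>. \<sigma> \<in> H \<Longrightarrow> kummer_char b \<sigma> = f \<sigma>"
proof -
  obtain \<gamma> where \<gamma>: "\<gamma> \<in> \<Omega>" "\<gamma> \<noteq> 0" "\<And>\<sigma>. \<sigma> \<in> H \<Longrightarrow> \<sigma> \<gamma> = \<zeta> powi f \<sigma> * \<gamma>"
    using exists_kummer_generator[OF hom cont] by metis
  have "\<sigma> (\<gamma> ^ p) = \<gamma> ^ p" if "\<sigma> \<in> H" for \<sigma>
  proof -
    have "\<sigma> (\<gamma> ^ p) = (\<zeta> powi f \<sigma>) ^ p * \<gamma> ^ p"
      using aut_power[OF that \<gamma>(1)] \<gamma>(3)[OF that] by (simp add: power_mult_distrib)
    also have "(\<zeta> powi f \<sigma>) ^ p = 1"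
      by (simp add: zeta_powi_eq_1_iff flip: power_int_of_nat power_int_mult)
    finally show ?thesis by simp
  qed
  then have mem: "\<gamma> ^ p \<in> fixed_field" using \<gamma>(1) by (simp add: fixed_field_iff Omega_closed)
  have "kummer_char (\<gamma> ^ p) \<sigma> = f \<sigma>" if "\<sigma> \<in> H" for \<sigma>
    using kummer_char_unique[OF refl mem _ that \<gamma>(3)[OF that]] \<gamma>(2) range[OF that] by simp
  then show ?thesis using that[OF mem] \<gamma>(2) by simp
qed

fun aut_pow :: "('c \<Rightarrow> 'c) \<Rightarrow> nat \<Rightarrow> ('c \<Rightarrow> 'c)" where
  "aut_pow \<sigma> 0 = (\<lambda>x\<in>\<Omega>. x)"
| "aut_pow \<sigma> (Suc n) = compose \<Omega> \<sigma> (aut_pow \<sigma> n)"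

lemma aut_pow_mem: "\<sigma> \<in> H \<Longrightarrow> aut_pow \<sigma> n \<in> H"
  by (induction n) (auto intro: id_mem compose_mem)

lemma aut_pow_apply: "\<sigma> \<in> H \<Longrightarrow> x \<in> \<Omega> \<Longrightarrow> aut_pow \<sigma> n x = (\<sigma> ^^ n) x"
  by (induction n) (auto simp: compose_def)

lemma funpow_mem: "\<sigma> \<in> H \<Longrightarrow> x \<in> \<Omega> \<Longrightarrow> (\<sigma> ^^ n) x \<in> \<Omega>"
  by (induction n) (auto intro: aut_mem)

lemma kummer_char_aut_pow:
  assumes "b \<in> fixed_field" "b \<noteq> 0" "\<sigma> \<in> H"
  shows "kummer_char b (aut_pow \<sigma> n) = (int n * kummer_char b \<sigma>) mod int p"
proof (induction n)
  case 0
  obtain \<beta> where \<beta>: "\<beta> ^ p = b" using nth_root_exists[OF p_gt_0] by blast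
  then have "\<beta> \<in> \<Omega>" using assms fixed_root_mem by auto
  then have "kummer_char b (\<lambda>x\<in>\<Omega>. x) = 0" using kummer_char_eq_0_iff[OF \<beta> assms(1,2) id_mem] by simp
  then show ?case unfolding aut_pow.simps by (metis of_nat_0 mult_zero_left mod_0)
next
  case (Suc n)
  then show ?case using kummer_char_compose[OF assms aut_pow_mem[OF assms(3)]]
    by (simp add: algebra_simps mod_add_right_eq)
qed

definition root_stabilizer :: "'c \<Rightarrow> ('c \<Rightarrow> 'c) set" where
  "root_stabilizer \<alpha> = {\<sigma> \<in> H. \<sigma> \<alpha> = \<alpha>}"

end

section \<open>The cyclic extension generated by a p-th root\<close>

locale kummer_extension = automorphism_group p \<zeta> \<Omega> H
  for p and \<zeta> :: "'c::alg_closed_field" and \<Omega> H +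
  fixes \<alpha> :: 'c
  assumes alpha_pow: "\<alpha> ^ p \<in> fixed_field" and alpha_notin: "\<alpha> \<notin> fixed_field"
begin

lemma alpha_mem: "\<alpha> \<in> \<Omega>"
  by (rule fixed_root_mem[OF alpha_pow])

lemma alpha_neq_0: "\<alpha> \<noteq> 0"
  using alpha_notin is_subfield_0[OF subfield_fixed] by auto

sublocale U: automorphism_group p \<zeta> \<Omega> "root_stabilizer \<alpha>"
proof (rule subgroup_automorphism_group)
  show "(\<lambda>x\<in>\<Omega>. x) \<in> root_stabilizer \<alpha>" using alpha_mem id_mem by (auto simp: root_stabilizer_def)
next
  fix \<sigma> assume s: "\<sigma> \<in> root_stabilizer \<alpha>"
  then have "inverse_aut \<sigma> (\<sigma> \<alpha>) = \<alpha>" using inverse_aut(2)[of \<sigma> \<alpha>] alpha_mem by (auto simp: root_stabilizer_def)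
  then show "inverse_aut \<sigma> \<in> root_stabilizer \<alpha>" using s inverse_aut_mem by (auto simp: root_stabilizer_def)
qed (use alpha_mem compose_mem in \<open>auto simp: root_stabilizer_def compose_def\<close>)

lemma stabilizer_subset: "root_stabilizer \<alpha> \<subseteq> H"
  by (auto simp: root_stabilizer_def)

lemma stabilizer_iff_kummer_char: "\<sigma> \<in> H \<Longrightarrow> \<sigma> \<in> root_stabilizer \<alpha> \<longleftrightarrow> kummer_char (\<alpha> ^ p) \<sigma> = 0"
  using kummer_char_eq_0_iff[OF refl alpha_pow] alpha_neq_0 by (auto simp: root_stabilizer_def)

text \<open>A nonzero value of the character is invertible modulo the prime p, so a suitable iterate
  of an automorphism moving \<alpha> takes the value 1.\<close>

lemma exists_generator: "\<exists>\<sigma>\<in>H. kummer_char (\<alpha> ^ p) \<sigma> = 1"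
proof -
  have nz: "\<alpha> ^ p \<noteq> 0" using alpha_neq_0 by simp
  obtain \<sigma> where s: "\<sigma> \<in> H" "\<sigma> \<alpha> \<noteq> \<alpha>" using alpha_notin alpha_mem by (auto simp: fixed_field_iff)
  define k where "k = kummer_char (\<alpha> ^ p) \<sigma>"
  have k: "0 < k" "k < int p"
    using kummer_char_range[OF alpha_pow nz s(1)] kummer_char_eq_0_iff[OF refl alpha_pow nz s(1)] s(2)
    by (auto simp: k_def order_le_less)
  have "\<not> int p dvd k" using k zdvd_not_zless by blast
  then have "coprime k (int p)"
    using prime_p by (metis coprime_commute prime_imp_coprime prime_nat_int_transfer)
  then obtain m v where m: "m * k + v * int p = 1" using bezout_int[of k "int p"] by auto
  define n where "n = nat (m mod int p)"
  have "kummer_char (\<alpha> ^ p) (aut_pow \<sigma> n) = (m mod int p * k) mod int p"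
    using kummer_char_aut_pow[OF alpha_pow nz s(1), of n] by (simp add: k_def n_def)
  also have "\<dots> = (m * k + v * int p) mod int p" by (simp add: mod_mult_left_eq)
  also have "\<dots> = 1" unfolding m using p_gt_1 by simp
  finally show ?thesis using aut_pow_mem[OF s(1)] by blast
qed

definition gen :: "'c \<Rightarrow> 'c" where
  "gen = (SOME \<sigma>. \<sigma> \<in> H \<and> kummer_char (\<alpha> ^ p) \<sigma> = 1)"

lemma gen_mem: "gen \<in> H" and kummer_char_gen: "kummer_char (\<alpha> ^ p) gen = 1"
proof -
  have "\<exists>\<sigma>. \<sigma> \<in> H \<and> kummer_char (\<alpha> ^ p) \<sigma> = 1" using exists_generator by blast
  then have "gen \<in> H \<and> kummer_char (\<alpha> ^ p) gen = 1" unfolding gen_def by (rule someI_ex)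
  then show "gen \<in> H" "kummer_char (\<alpha> ^ p) gen = 1" by auto
qed

lemma alpha_pow_neq_0: "\<alpha> ^ p \<noteq> 0"
  using alpha_neq_0 by simp

lemma gen_alpha: "gen \<alpha> = \<zeta> * \<alpha>"
  using kummer_char(1)[OF refl alpha_pow alpha_pow_neq_0 gen_mem] kummer_char_gen by simp

abbreviation L :: "'c set" where
  "L \<equiv> U.fixed_field"

lemma fixed_subset_L: "fixed_field \<subseteq> L"
  using stabilizer_subset unfolding fixed_field_def U.fixed_field_def by blast

lemma alpha_mem_L: "\<alpha> \<in> L"
  unfolding U.fixed_field_iff using alpha_mem by (auto simp: root_stabilizer_def)

text \<open>The iterate of \<open>gen\<close> with the same character value differs from \<sigma> by
  an element of the stabilizer, which is trivial on L. On L every automorphism is thereby reduced to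
  a cyclic group.\<close>

lemma aut_eq_gen_pow:
  assumes "\<sigma> \<in> H" "x \<in> L"
  shows "\<sigma> x = (gen ^^ nat (kummer_char (\<alpha> ^ p) \<sigma>)) x"
proof -
  note c = alpha_pow alpha_pow_neq_0
  define n where "n = nat (kummer_char (\<alpha> ^ p) \<sigma>)"
  define g where "g = aut_pow gen n"
  define u where "u = compose \<Omega> (inverse_aut g) \<sigma>"
  have g: "g \<in> H" unfolding g_def by (rule aut_pow_mem[OF gen_mem])
  have x: "x \<in> \<Omega>" using assms(2) U.fixed_field_subset by blast
  have u: "u \<in> H" unfolding u_def by (intro compose_mem inverse_aut_mem g assms)
  have gu: "g (u y) = \<sigma> y" if "y \<in> \<Omega>" for y
    using that inverse_aut(1)[OF g] aut_mem[OF assms(1)] by (simp add: u_def compose_def)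
  have "compose \<Omega> g u = \<sigma>" using gu u g assms by (intro aut_ext compose_mem) (auto simp: compose_def)
  then have "kummer_char (\<alpha> ^ p) \<sigma> = (kummer_char (\<alpha> ^ p) g + kummer_char (\<alpha> ^ p) u) mod int p"
    using kummer_char_compose[OF c g u] by simp
  moreover have "kummer_char (\<alpha> ^ p) g = kummer_char (\<alpha> ^ p) \<sigma>"
    using kummer_char_aut_pow[OF c gen_mem, of n] kummer_char_gen kummer_char_range[OF c assms(1)]
    by (simp add: g_def n_def)
  ultimately have "kummer_char (\<alpha> ^ p) \<sigma> mod int p = (kummer_char (\<alpha> ^ p) \<sigma> + kummer_char (\<alpha> ^ p) u) mod int p"
    by (metis mod_mod_trivial)
  then have "int p dvd kummer_char (\<alpha> ^ p) u" by (metis add_diff_cancel_left' mod_eq_dvd_iff)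
  then have "kummer_char (\<alpha> ^ p) u = 0" 
    using kummer_char_range[OF c u] zdvd_imp_le[of "int p" "kummer_char (\<alpha> ^ p) u"] by linarith
  then have "u x = x" using u stabilizer_iff_kummer_char assms(2) by (auto simp: U.fixed_field_iff)
  then show ?thesis using gu[OF x] aut_pow_apply[OF gen_mem x] by (simp add: g_def n_def)
qed

text \<open>\<sigma> multiplies \<alpha> by a power of \<zeta>, so whatever fixes \<alpha> also
  fixes \<open>\<sigma> \<alpha>\<close>. This normality is what lets H act on L.\<close>

lemma conj_stabilizer:
  assumes "\<tau> \<in> root_stabilizer \<alpha>" "\<sigma> \<in> H"
  shows "compose \<Omega> (inverse_aut \<sigma>) (compose \<Omega> \<tau> \<sigma>) \<in> root_stabilizer \<alpha>"
proof -
  obtain k where k: "\<sigma> \<alpha> = \<zeta> powi k * \<alpha>" using kummer_char_aux[OF alpha_pow alpha_neq_0 assms(2)] by metis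
  have t: "\<tau> \<in> H" "\<tau> \<alpha> = \<alpha>" using assms by (auto simp: root_stabilizer_def)
  have "\<tau> (\<sigma> \<alpha>) = \<sigma> \<alpha>" using k t alpha_mem by (simp add: aut_mult zeta_powi_mem aut_zeta_powi)
  then have "compose \<Omega> (inverse_aut \<sigma>) (compose \<Omega> \<tau> \<sigma>) \<alpha> = \<alpha>"
    using alpha_mem inverse_aut(2)[OF assms(2)] by (simp add: compose_def)
  then show ?thesis using compose_mem inverse_aut_mem assms t by (simp add: root_stabilizer_def)
qed

lemma aut_mem_L:
  assumes "\<sigma> \<in> H" "x \<in> L" shows "\<sigma> x \<in> L"
  unfolding U.fixed_field_iff
proof (intro conjI ballI)
  have x: "x \<in> \<Omega>" using assms(2) U.fixed_field_subset by blast
  show m: "\<sigma> x \<in> \<Omega>" by (rule aut_mem[OF assms(1) x])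
  fix \<tau> assume t: "\<tau> \<in> root_stabilizer \<alpha>"
  then have "\<tau> \<in> H" using stabilizer_subset by auto
  have "compose \<Omega> (inverse_aut \<sigma>) (compose \<Omega> \<tau> \<sigma>) x = x"
    using conj_stabilizer[OF t assms(1)] assms(2) U.fixed_field_iff by blast
  then have "inverse_aut \<sigma> (\<tau> (\<sigma> x)) = x" using x by (simp add: compose_def)
  then show "\<tau> (\<sigma> x) = \<sigma> x" using inverse_aut(1)[OF assms(1) aut_mem[OF \<open>\<tau> \<in> H\<close> m]] by metis
qed

lemma gen_pow_mem_L: "x \<in> L \<Longrightarrow> (gen ^^ n) x \<in> L"
  by (induction n) (auto intro: aut_mem_L gen_mem)

lemma gen_pow_p: assumes "x \<in> L" shows "(gen ^^ p) x = x"
proof -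
  have "kummer_char (\<alpha> ^ p) (aut_pow gen p) = 0"
    using kummer_char_aut_pow[OF alpha_pow alpha_pow_neq_0 gen_mem, of p] kummer_char_gen by simp
  then have "aut_pow gen p \<in> root_stabilizer \<alpha>" using stabilizer_iff_kummer_char aut_pow_mem[OF gen_mem] by simp
  then show ?thesis using assms aut_pow_apply[OF gen_mem, of x p] by (auto simp: U.fixed_field_iff)
qed

lemma fixed_by_gen: assumes "x \<in> L" "gen x = x" shows "x \<in> fixed_field"
proof -
  have "(gen ^^ n) x = x" for n by (induction n) (auto simp: assms)
  then show ?thesis using aut_eq_gen_pow[OF _ assms(1)] assms(1) by (auto simp: fixed_field_iff U.fixed_field_iff)
qed

lemma gen_pow_emb: "field_embedding L (gen ^^ n)"
proof -
  have "field_embedding L (aut_pow gen n)"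
    using field_embedding_mono[OF emb[OF aut_pow_mem[OF gen_mem]] U.fixed_field_subset] .
  then show ?thesis
    by (rule field_embedding_cong[OF _ U.subfield_fixed])
      (use U.fixed_field_subset in \<open>auto simp: aut_pow_apply[OF gen_mem]\<close>)
qed

lemma gen_pow_fixed: "x \<in> fixed_field \<Longrightarrow> (gen ^^ n) x = x"
  using gen_mem by (induction n) (auto simp: fixed_field_iff)

lemma gen_pow_alpha: "(gen ^^ n) \<alpha> = \<zeta> ^ n * \<alpha>"
proof (induction n)
  case (Suc n)
  then show ?case using gen_mem gen_alpha alpha_mem zeta_powi_mem[of "int n"] aut_zeta_powi[OF gen_mem, of "int n"]
    by (simp add: aut_mult power_int_of_nat)
qed auto

lemma sum_shift_p: "(\<Sum>k<p. f (Suc k)) = (\<Sum>k<p. f k)" if "f p = f 0" for f :: "nat \<Rightarrow> 'c"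
  using sum.lessThan_Suc_shift[of f p] that by simp

text \<open>A discrete Fourier transform over the iterates of \<open>gen\<close> splits x into
  eigenvectors. The one with eigenvalue \<zeta>^i is divided by \<alpha>^i, which has the same
  eigenvalue, and leaves a coefficient fixed by \<open>gen\<close>.\<close>

lemma L_decomposition:
  assumes x: "x \<in> L"
  obtains c where "\<And>i. i < p \<Longrightarrow> c i \<in> fixed_field" "x = (\<Sum>i<p. c i * \<alpha> ^ i)"
proof -
  define t where "t i k = \<zeta> powi (- (int k * int i)) * (gen ^^ k) x" for i k
  define c where "c i = (\<Sum>k<p. t i k) / (of_nat p * \<alpha> ^ i)" for i
  note LS = U.subfield_fixed
  note clL = is_subfield_closed[OF LS]
  have tL: "t i k \<in> L" for i k unfolding t_def by (intro clL U.zeta_fixed_field gen_pow_mem_L x)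
  have cL: "c i \<in> L" for i unfolding c_def by (intro clL tL alpha_mem_L)
  note embg = field_embedding_mono[OF emb[OF gen_mem] U.fixed_field_subset]
  have "gen (c i) = c i" for i
  proof -
    have "gen (t i k) = \<zeta> powi (int i) * t i (Suc k)" for k
    proof -
      have "gen (t i k) = \<zeta> powi (- (int k * int i)) * (gen ^^ Suc k) x"
        unfolding t_def using aut_mult[OF gen_mem zeta_powi_mem funpow_mem[OF gen_mem]] x U.fixed_field_subset
          aut_zeta_powi[OF gen_mem] by auto
      also have "\<zeta> powi (- (int k * int i)) = \<zeta> powi (int i) * \<zeta> powi (- (int (Suc k) * int i))"
      proof -
        have "- (int k * int i) = int i + - (int (Suc k) * int i)" by (simp add: algebra_simps)
        then show ?thesis by (metis zeta_powi_add)
      qed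
      finally show ?thesis by (simp add: t_def)
    qed
    \<comment> \<open>The index wraps around because gen^p is the identity on L and \<zeta>^p = 1,
      so \<open>gen\<close> merely shifts the sum, up to the factor \<zeta>^i.\<close>
    moreover have "t i p = t i 0" unfolding t_def using gen_pow_p[OF x] by (simp add: zeta_powi_eq_1_iff)
    ultimately have s: "gen (\<Sum>k<p. t i k) = \<zeta> powi (int i) * (\<Sum>k<p. t i k)"
      using emb_sum[OF LS embg, of "{..<p}" "t i"] tL sum_shift_p[of "t i"] by (simp flip: sum_distrib_left)
    have "gen (of_nat p * \<alpha> ^ i) = of_nat p * (\<zeta> * \<alpha>) ^ i"
    proof -
      have "of_nat p \<in> fixed_field" by (rule is_subfield_of_nat[OF subfield_fixed])
      then have "gen (of_nat p) = of_nat p" using gen_mem by (simp add: fixed_field_iff)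
      then show ?thesis using gen_alpha by (simp add: aut_mult[OF gen_mem] aut_power[OF gen_mem] Omega_closed alpha_mem)
    qed
    then have "gen (c i) = \<zeta> powi (int i) * (\<Sum>k<p. t i k) / (of_nat p * (\<zeta> * \<alpha>) ^ i)"
      unfolding c_def using emb_divide[OF LS embg, of "\<Sum>k<p. t i k" "of_nat p * \<alpha> ^ i"] s
      by (simp add: clL alpha_mem_L tL)
    then show ?thesis by (simp add: c_def power_mult_distrib power_int_of_nat)
  qed
  then have "c i \<in> fixed_field" for i using cL fixed_by_gen by blast
  moreover have "x = (\<Sum>i<p. c i * \<alpha> ^ i)"
  proof -
    have "c i * \<alpha> ^ i = (\<Sum>k<p. t i k) / of_nat p" for i using alpha_neq_0 by (simp add: c_def)
    then have "(\<Sum>i<p. c i * \<alpha> ^ i) = (\<Sum>i<p. \<Sum>k<p. t i k) / of_nat p"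
      by (simp flip: sum_divide_distrib)
    also have "(\<Sum>i<p. \<Sum>k<p. t i k) = (\<Sum>k<p. \<Sum>i<p. t i k)" by (rule sum.swap)
    \<comment> \<open>With the sum over i taken first, orthogonality kills every iterate except k =
      0, which contributes p times x.\<close>
    also have "\<dots> = (\<Sum>k<p. (if k = 0 then of_nat p else 0) * (gen ^^ k) x)"
    proof (rule sum.cong[OF refl])
      fix k assume k: "k \<in> {..<p}"
      have "(\<Sum>i<p. t i k) = (\<Sum>i<p. \<zeta> powi (int i * - int k)) * (gen ^^ k) x"
        unfolding t_def sum_distrib_right by (simp add: mult.commute[of "int k"])
      also have "(\<Sum>i<p. \<zeta> powi (int i * - int k)) = (if k = 0 then of_nat p else 0)"
        unfolding sum_zeta_powi using k by (auto dest: dvd_imp_le)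
      finally show "(\<Sum>i<p. t i k) = (if k = 0 then of_nat p else 0) * (gen ^^ k) x" .
    qed
    also have "\<dots> = (\<Sum>k<p. if k = 0 then of_nat p * x else 0)" by (rule sum.cong) auto
    also have "\<dots> = of_nat p * x" by simp
    finally show ?thesis using p_neq_0 by simp
  qed
  ultimately show ?thesis by (intro that[of c])
qed

text \<open>The eigenvector decomposition expresses every element of L in powers of \<alpha>, so
  this instance of the Galois correspondence follows without counting degrees.\<close>

lemma L_eq_adjoin: "L = adjoin fixed_field \<alpha>"
proof
  show "adjoin fixed_field \<alpha> \<subseteq> L"
    using fixed_subset_L alpha_mem_L by (intro generate_field_least U.subfield_fixed) auto
  show "L \<subseteq> adjoin fixed_field \<alpha>"
  proof
    fix x assume "x \<in> L"
    then obtain c where "\<And>i. i < p \<Longrightarrow> c i \<in> fixed_field" "x = (\<Sum>i<p. c i * \<alpha> ^ i)"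
      using L_decomposition by metis
    moreover have "\<alpha> \<in> adjoin fixed_field \<alpha>" "fixed_field \<subseteq> adjoin fixed_field \<alpha>"
      by (auto intro: generate_field.incl)
    ultimately show "x \<in> adjoin fixed_field \<alpha>"
      by (auto intro!: is_subfield_sum[OF is_subfield_generate_field] is_subfield_mult[OF is_subfield_generate_field]
        is_subfield_power[OF is_subfield_generate_field])
  qed
qed

end

section \<open>Norms as products of conjugates\<close>

lemma combine_eq_sum:
  "length ks = length us \<Longrightarrow> ring.combine ring_of_type_algebra ks us = (\<Sum>i<length us. ks ! i * us ! i :: 'c::field)"
proof (induction ks us rule: list_induct2)
  case (Cons k ks u us)
  then show ?case by (simp add: type_ring.combine.simps sum.lessThan_Suc_shift del: sum.lessThan_Suc)
qed (simp add: type_ring.combine.simps)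

lemma Span_iff_sum:
  fixes K :: "'c::field set"
  assumes "is_subfield K"
  shows "x \<in> ring.Span ring_of_type_algebra K us \<longleftrightarrow>
    (\<exists>c. (\<forall>i<length us. c i \<in> K) \<and> x = (\<Sum>i<length us. c i * us ! i))"
proof -
  have "x \<in> ring.Span ring_of_type_algebra K us \<longleftrightarrow>
    (\<exists>ks. set ks \<subseteq> K \<and> length ks = length us \<and> x = (\<Sum>i<length us. ks ! i * us ! i))"
    using type_ring.Span_mem_iff_length_version[OF assms, of us x] by (auto simp: combine_eq_sum)
  also have "\<dots> \<longleftrightarrow> (\<exists>c. (\<forall>i<length us. c i \<in> K) \<and> x = (\<Sum>i<length us. c i * us ! i))"
  proof
    assume "\<exists>ks. set ks \<subseteq> K \<and> length ks = length us \<and> x = (\<Sum>i<length us. ks ! i * us ! i)"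
    then obtain ks where "set ks \<subseteq> K" "length ks = length us" "x = (\<Sum>i<length us. ks ! i * us ! i)" by blast
    then show "\<exists>c. (\<forall>i<length us. c i \<in> K) \<and> x = (\<Sum>i<length us. c i * us ! i)"
      by (intro exI[of _ "\<lambda>i. ks ! i"]) (auto dest: nth_mem)
  next
    assume "\<exists>c. (\<forall>i<length us. c i \<in> K) \<and> x = (\<Sum>i<length us. c i * us ! i)"
    then obtain c where "\<forall>i<length us. c i \<in> K" "x = (\<Sum>i<length us. c i * us ! i)" by blast
    then show "\<exists>ks. set ks \<subseteq> K \<and> length ks = length us \<and> x = (\<Sum>i<length us. ks ! i * us ! i)"
      by (intro exI[of _ "map c [0..<length us]"]) auto
  qed
  finally show ?thesis .
qed

lemma is_basis_length:
  assumes "is_subfield K" "is_basis K L us" "is_basis K L vs" shows "length us = length vs"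
  using type_ring.dimension_is_inj[OF assms(1)] type_ring.dimensionI[OF assms(1)] assms(2,3)
  unfolding is_basis_def by blast

text \<open>
  For a basis \<open>u\<^sub>j\<close> put \<open>M = (s\<^sub>k u\<^sub>j)\<close>. Applying \<open>s\<^sub>k\<close> to \<open>w u\<^sub>j = \<Sum>\<^sub>i A\<^sub>i\<^sub>j u\<^sub>i\<close> gives
  \<open>diag(s\<^sub>k w) M = M A\<close>, and \<open>M\<close> is invertible by Dedekind independence.
\<close>

theorem field_norm_eq_prod:
  fixes K L :: "'c::field set"
  assumes K: "is_subfield K" and L: "is_subfield L"
    and bas: "is_basis K L vs" "length vs = n"
    and emb: "\<And>k. k < n \<Longrightarrow> field_embedding L (s k)"
    and fix_K: "\<And>k x. k < n \<Longrightarrow> x \<in> K \<Longrightarrow> s k x = x" and KL: "K \<subseteq> L"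
    and dist: "\<And>k l. k < n \<Longrightarrow> l < n \<Longrightarrow> k \<noteq> l \<Longrightarrow> \<exists>x\<in>L. s k x \<noteq> s l x"
    and w: "w \<in> L"
  shows "field_norm K L w = (\<Prod>k<n. s k w)"
proof -
  \<comment> \<open>Proved for all bases and matrices at once, because the norm is defined by
    \<open>THE\<close> and every admissible determinant must have the same value.\<close>
  have det_eq: "Determinant.det A = (\<Prod>k<n. s k w)"
    if us: "is_basis K L us" and A: "A \<in> carrier_mat (length us) (length us)" "elements_mat A \<subseteq> K"
      "\<forall>j<length us. w * us ! j = (\<Sum>i<length us. A $$ (i, j) * us ! i)" for us A
  proof -
    have len: "length us = n" using is_basis_length[OF K us bas(1)] bas(2) by simp
    have Sp: "x \<in> L \<longleftrightarrow> (\<exists>c. (\<forall>i<n. c i \<in> K) \<and> x = (\<Sum>i<n. c i * us ! i))" for x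
      using Span_iff_sum[OF K, of x us] us len unfolding is_basis_def by simp
    have usL: "us ! j \<in> L" if "j < n" for j
      unfolding Sp using that is_subfield_0[OF K] is_subfield_1[OF K]
      by (intro exI[of _ "\<lambda>i. if i = j then 1 else 0"]) (auto simp: if_distrib[of "\<lambda>c. c * _"] cong: if_cong)
    have AK: "A $$ (i, j) \<in> K" if "i < n" "j < n" for i j
    proof -
      have "A $$ (i, j) \<in> elements_mat A" using that A(1) len by (intro elements_matI[of _ n n]) auto
      then show ?thesis using A(2) by blast
    qed
    define M where "M = Matrix.mat n n (\<lambda>(k, j). s k (us ! j))"
    define D where "D = Matrix.mat n n (\<lambda>(k, j). if k = j then s k w else 0)"
    have M: "M \<in> carrier_mat n n" and D: "D \<in> carrier_mat n n" and An: "A \<in> carrier_mat n n"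
      using A len by (auto simp: M_def D_def)
    have "D * M = M * A"
    proof (rule eq_matI)
      fix k j assume "k < dim_row (M * A)" "j < dim_col (M * A)"
      then have kj: "k < n" "j < n" using M An by auto
      have "(D * M) $$ (k, j) = (\<Sum>i<n. D $$ (k, i) * M $$ (i, j))"
        using kj M D by (simp add: scalar_prod_def atLeast0LessThan)
      also have "\<dots> = s k w * s k (us ! j)"
        using kj by (simp add: D_def M_def if_distrib[of "\<lambda>c. c * _"] cong: if_cong)
      also have "\<dots> = s k (w * us ! j)" using emb_mult[OF L emb[OF kj(1)] w usL[OF kj(2)]] by simp
      also have "\<dots> = s k (\<Sum>i<n. A $$ (i, j) * us ! i)" using A(3) kj len by simp
      also have "\<dots> = (\<Sum>i<n. s k (A $$ (i, j) * us ! i))"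
        by (rule emb_sum[OF L emb[OF kj(1)]]) (use AK kj usL KL in \<open>auto intro!: is_subfield_mult[OF L]\<close>)
      also have "\<dots> = (\<Sum>i<n. M $$ (k, i) * A $$ (i, j))"
      proof (rule sum.cong[OF refl])
        fix i assume "i \<in> {..<n}"
        then have i: "i < n" by simp
        have "A $$ (i, j) \<in> L" using AK[OF i kj(2)] KL by auto
        then show "s k (A $$ (i, j) * us ! i) = M $$ (k, i) * A $$ (i, j)"
          using emb_mult[OF L emb[OF kj(1)] _ usL[OF i]] fix_K[OF kj(1) AK[OF i kj(2)]] i kj
          by (simp add: M_def)
      qed
      also have "\<dots> = (M * A) $$ (k, j)" using kj M An by (simp add: scalar_prod_def atLeast0LessThan)
      finally show "(D * M) $$ (k, j) = (M * A) $$ (k, j)" .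
    qed (use M D An in auto)
    then have "Determinant.det D * Determinant.det M = Determinant.det M * Determinant.det A"
      using det_mult[OF D M] det_mult[OF M An] by metis
    moreover have "Determinant.det M \<noteq> 0"
    proof
      assume "Determinant.det M = 0"
      then have "Determinant.det (transpose_mat M) = 0" using det_transpose[OF M] by simp
      then obtain v where v: "v \<in> carrier_vec n" "v \<noteq> 0\<^sub>v n" "transpose_mat M *\<^sub>v v = 0\<^sub>v n"
        using det_0_iff_vec_prod_zero[of "transpose_mat M" n] M by auto
      have 0: "(\<Sum>k<n. v $ k * s k (us ! j)) = 0" if "j < n" for j
      proof -
        have "(transpose_mat M *\<^sub>v v) $ j = (\<Sum>k<n. v $ k * s k (us ! j))"
          using that M v(1) by (simp add: scalar_prod_def M_def atLeast0LessThan mult.commute)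
        then show ?thesis using v(3) that by simp
      qed
      \<comment> \<open>A vector killed by the transpose is a linear relation among the maps
        \<open>s k\<close> on a basis. As these maps are K-linear, the relation holds on all of L,
        and independence applies.\<close>
      have "\<forall>k\<in>{..<n}. v $ k = 0"
      proof (rule dedekind_independence[where M = L and s = s])
        fix x assume "x \<in> L"
        then obtain c where c: "\<forall>i<n. c i \<in> K" "x = (\<Sum>i<n. c i * us ! i)" using Sp by blast
        have "s k x = (\<Sum>i<n. c i * s k (us ! i))" if "k < n" for k
        proof -
          have "s k x = (\<Sum>i<n. s k (c i * us ! i))" unfolding c(2)
            by (rule emb_sum[OF L emb[OF that]]) (use c usL KL in \<open>auto intro!: is_subfield_mult[OF L]\<close>)
          also have "\<dots> = (\<Sum>i<n. c i * s k (us ! i))"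
          proof (rule sum.cong[OF refl])
            fix i assume "i \<in> {..<n}"
            then have "c i \<in> K" "c i \<in> L" "us ! i \<in> L" using c KL usL by auto
            then show "s k (c i * us ! i) = c i * s k (us ! i)"
              using emb_mult[OF L emb[OF that]] fix_K[OF that] by simp
          qed
          finally show ?thesis .
        qed
        then have "(\<Sum>k<n. v $ k * s k x) = (\<Sum>k<n. \<Sum>i<n. c i * (v $ k * s k (us ! i)))"
          by (simp add: sum_distrib_left algebra_simps)
        also have "\<dots> = (\<Sum>i<n. \<Sum>k<n. c i * (v $ k * s k (us ! i)))" by (rule sum.swap)
        also have "\<dots> = 0" using 0 by (simp flip: sum_distrib_left)
        finally show "(\<Sum>k<n. v $ k * s k x) = 0" .
      next
        fix k assume "k \<in> {..<n}"
        then show "\<exists>x\<in>L. s k x \<noteq> 0" using emb_1[OF L emb[of k]] is_subfield_1[OF L] by (intro bexI[of _ 1]) auto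
      qed (use is_subfield_mult[OF L] emb_mult[OF L emb] dist in auto)
      then have "v = 0\<^sub>v n" using v(1) by (intro eq_vecI) auto
      then show False using v(2) by simp
    qed
    moreover have "Determinant.det D = (\<Prod>k<n. s k w)"
    proof -
      have "upper_triangular D" by (auto simp: D_def)
      then have "Determinant.det D = prod_list (diag_mat D)" using D by (rule det_upper_triangular)
      also have "diag_mat D = map (\<lambda>k. s k w) [0..<n]" by (auto simp: diag_mat_def D_def)
      also have "prod_list \<dots> = (\<Prod>k<n. s k w)"
        by (simp add: atLeast0LessThan flip: prod.distinct_set_conv_list)
      finally show ?thesis .
    qed
    ultimately show ?thesis by simp
  qed
  have ex: "\<exists>A. A \<in> carrier_mat n n \<and> elements_mat A \<subseteq> K \<and>
     (\<forall>j<n. w * vs ! j = (\<Sum>i<n. A $$ (i, j) * vs ! i))"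
  proof -
    have Sp: "x \<in> L \<longleftrightarrow> (\<exists>c. (\<forall>i<n. c i \<in> K) \<and> x = (\<Sum>i<n. c i * vs ! i))" for x
      using Span_iff_sum[OF K, of x vs] bas unfolding is_basis_def by simp
    have vsL: "vs ! j \<in> L" if "j < n" for j
      unfolding Sp using that is_subfield_0[OF K] is_subfield_1[OF K]
      by (intro exI[of _ "\<lambda>i. if i = j then 1 else 0"]) (auto simp: if_distrib[of "\<lambda>c. c * _"] cong: if_cong)
    have "\<forall>j. \<exists>c. j < n \<longrightarrow> (\<forall>i<n. c i \<in> K) \<and> w * vs ! j = (\<Sum>i<n. c i * vs ! i)"
      using Sp is_subfield_mult[OF L w vsL] by blast
    then obtain c where c: "\<And>j. j < n \<Longrightarrow> (\<forall>i<n. c j i \<in> K) \<and> w * vs ! j = (\<Sum>i<n. c j i * vs ! i)" by metis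
    then show ?thesis
      by (intro exI[of _ "Matrix.mat n n (\<lambda>(i, j). c j i)"]) (auto simp: elements_mat_def)
  qed
  then obtain A where A: "A \<in> carrier_mat (length vs) (length vs)" "elements_mat A \<subseteq> K"
     "\<forall>j<length vs. w * vs ! j = (\<Sum>i<length vs. A $$ (i, j) * vs ! i)"
    using bas(2) by auto
  show ?thesis
    unfolding field_norm_def
  proof (rule the_equality)
    show "\<exists>us A. is_basis K L us \<and> A \<in> carrier_mat (length us) (length us) \<and> elements_mat A \<subseteq> K \<and>
     (\<forall>j<length us. w * us ! j = (\<Sum>i<length us. A $$ (i, j) * us ! i)) \<and> (\<Prod>k<n. s k w) = Determinant.det A"
      using A bas(1) det_eq[OF bas(1) A] by (intro exI[of _ vs] exI[of _ A]) auto
  next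
    fix d assume "\<exists>us A. is_basis K L us \<and> A \<in> carrier_mat (length us) (length us) \<and> elements_mat A \<subseteq> K \<and>
     (\<forall>j<length us. w * us ! j = (\<Sum>i<length us. A $$ (i, j) * us ! i)) \<and> d = Determinant.det A"
    then show "d = (\<Prod>k<n. s k w)" using det_eq by blast
  qed
qed

lemma is_basis_self: assumes "is_subfield K" shows "is_basis K K [1]"
proof -
  have "ring.Span ring_of_type_algebra K [1] = K"
    using Span_iff_sum[OF assms, of _ "[1]"] by (auto intro: exI[of _ "\<lambda>_. _"])
  moreover have "ring.independent ring_of_type_algebra K [1]"
    by (rule type_ring.li_Cons) (auto simp: type_ring.Span.simps)
  ultimately show ?thesis by (simp add: is_basis_def)
qed

lemma field_norm_self: assumes "is_subfield K" "w \<in> K" shows "field_norm K K w = w"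
  using field_norm_eq_prod[OF assms(1,1) is_basis_self[OF assms(1)], of 1 "\<lambda>_ x. x" w] assms(2)
  by (simp add: field_embedding_def)

lemma adjoin_self: assumes "is_subfield K" "\<alpha> \<in> K" shows "adjoin K \<alpha> = K"
  using generate_field_least[OF assms(1), of "insert \<alpha> K"] assms(2) by (auto intro: generate_field.incl)

section \<open>The norm of the cyclic extension\<close>

context kummer_extension
begin

text \<open>Applying the iterates of \<open>gen\<close> to a relation replaces \<alpha> by \<zeta>^n
  \<alpha>, and orthogonality then isolates each coefficient. Spanning is the eigenvector
  decomposition.\<close>

lemma is_basis_powers: "is_basis fixed_field L (map (\<lambda>i. \<alpha> ^ i) [0..<p])" (is "is_basis _ _ ?us")
proof -
  have "ring.independent ring_of_type_algebra fixed_field ?us"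
  proof (rule type_ring.trivial_combine_imp_independent[OF subfield_fixed])
    fix ks assume ks: "set ks \<subseteq> fixed_field" "ring.combine ring_of_type_algebra ks ?us = \<zero>\<^bsub>ring_of_type_algebra\<^esub>"
    \<comment> \<open>A coefficient list may have any length; it is first replaced by one of length
      p with the same combination.\<close>
    obtain ks' where ks': "set (take (length ?us) ks) \<subseteq> set ks'"
       "set ks' \<subseteq> set (take (length ?us) ks) \<union> {0}" "length ks' = length ?us"
       "ring.combine ring_of_type_algebra ks' ?us = 0"
      using type_ring.combine_normalize[of ks ?us 0] ks(2) by auto
    have c: "ks' ! i \<in> fixed_field" if "i < p" for i
    proof -
      have "ks' ! i \<in> set ks'" using that ks'(3) by simp
      then have "ks' ! i \<in> set ks \<or> ks' ! i = 0" using ks'(2) set_take_subset[of "length ?us" ks] by blast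
      then show ?thesis using ks(1) is_subfield_0[OF subfield_fixed] by auto
    qed
    have sum0: "(\<Sum>i<p. ks' ! i * \<alpha> ^ i) = 0" using ks'(3,4) combine_eq_sum[of ks' ?us] by simp
    have all: "(\<Sum>i<p. ks' ! i * (\<zeta> ^ n * \<alpha>) ^ i) = 0" for n
    proof -
      have "(gen ^^ n) (\<Sum>i<p. ks' ! i * \<alpha> ^ i) = (\<Sum>i<p. ks' ! i * (\<zeta> ^ n * \<alpha>) ^ i)"
      proof -
        note e = U.subfield_fixed gen_pow_emb[of n]
        have cL: "ks' ! i \<in> L" if "i < p" for i using c[OF that] fixed_subset_L by auto
        show ?thesis
          using emb_sum[OF e, of "{..<p}" "\<lambda>i. ks' ! i * \<alpha> ^ i"] cL
          by (simp add: emb_mult[OF e] emb_power[OF e] alpha_mem_L is_subfield_closed[OF e(1)]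
              gen_pow_alpha gen_pow_fixed[OF c])
      qed
      then show ?thesis unfolding sum0 using emb_0[OF U.subfield_fixed gen_pow_emb] by simp
    qed
    have zero: "ks' ! j = 0" if j: "j < p" for j
    proof -
      have "0 = (\<Sum>n<p. \<zeta> powi (int n * - int j) * (\<Sum>i<p. ks' ! i * (\<zeta> ^ n * \<alpha>) ^ i))"
        unfolding all by simp
      also have "\<dots> = (\<Sum>n<p. \<Sum>i<p. ks' ! i * \<alpha> ^ i * \<zeta> powi (int n * (int i - int j)))"
      proof -
        have "\<zeta> powi (int n * - int j) * (ks' ! i * (\<zeta> ^ n * \<alpha>) ^ i) =
          ks' ! i * \<alpha> ^ i * \<zeta> powi (int n * (int i - int j))" for n i
        proof -
          have "(\<zeta> ^ n) ^ i = \<zeta> powi (int n * int i)" by (simp flip: power_int_of_nat power_int_mult power_mult)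
          moreover have "\<zeta> powi (int n * (int i - int j)) = \<zeta> powi (int n * int i) * \<zeta> powi (int n * - int j)"
            by (simp add: algebra_simps flip: zeta_powi_add)
          ultimately show ?thesis by (simp only: power_mult_distrib mult_ac)
        qed
        then show ?thesis by (simp only: sum_distrib_left)
      qed
      also have "\<dots> = (\<Sum>i<p. \<Sum>n<p. ks' ! i * \<alpha> ^ i * \<zeta> powi (int n * (int i - int j)))" by (rule sum.swap)
      also have "\<dots> = (\<Sum>i<p. ks' ! i * \<alpha> ^ i * (if i = j then of_nat p else 0))"
      proof (rule sum.cong[OF refl])
        fix i assume "i \<in> {..<p}"
        then have "int p dvd int i - int j \<longleftrightarrow> i = j" using j
          by (auto simp flip: mod_eq_dvd_iff)
        then show "(\<Sum>n<p. ks' ! i * \<alpha> ^ i * \<zeta> powi (int n * (int i - int j))) =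
          ks' ! i * \<alpha> ^ i * (if i = j then of_nat p else 0)"
          by (simp only: sum_zeta_powi flip: sum_distrib_left)
      qed
      also have "\<dots> = ks' ! j * \<alpha> ^ j * of_nat p" using j by (simp add: if_distrib[of "\<lambda>c. _ * c"] cong: if_cong)
      finally show ?thesis using p_neq_0 alpha_neq_0 by simp
    qed
    have "set ks' \<subseteq> {0}" using zero ks'(3) by (auto simp: in_set_conv_nth)
    then show "set (take (length ?us) ks) \<subseteq> {\<zero>\<^bsub>ring_of_type_algebra\<^esub>}" using ks'(1) by auto
  qed auto
  moreover have "ring.Span ring_of_type_algebra fixed_field ?us = L"
  proof (rule Set.set_eqI)
    fix x
    have "x \<in> ring.Span ring_of_type_algebra fixed_field ?us \<longleftrightarrow>
       (\<exists>c. (\<forall>i<p. c i \<in> fixed_field) \<and> x = (\<Sum>i<p. c i * \<alpha> ^ i))"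
      unfolding Span_iff_sum[OF subfield_fixed] by simp
    also have "\<dots> \<longleftrightarrow> x \<in> L"
    proof
      assume "\<exists>c. (\<forall>i<p. c i \<in> fixed_field) \<and> x = (\<Sum>i<p. c i * \<alpha> ^ i)"
      then show "x \<in> L" using fixed_subset_L alpha_mem_L
        by (auto intro!: is_subfield_sum[OF U.subfield_fixed] is_subfield_mult[OF U.subfield_fixed]
            is_subfield_power[OF U.subfield_fixed])
    next
      assume "x \<in> L"
      then show "\<exists>c. (\<forall>i<p. c i \<in> fixed_field) \<and> x = (\<Sum>i<p. c i * \<alpha> ^ i)"
        by (rule L_decomposition) blast
    qed
    finally show "x \<in> ring.Span ring_of_type_algebra fixed_field ?us \<longleftrightarrow> x \<in> L" .
  qed
  ultimately show ?thesis by (simp add: is_basis_def)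
qed

theorem field_norm_L:
  assumes "w \<in> L" shows "field_norm fixed_field L w = (\<Prod>k<p. (gen ^^ k) w)"
proof (rule field_norm_eq_prod[OF subfield_fixed U.subfield_fixed is_basis_powers])
  fix k l assume kl: "k < p" "l < p" "k \<noteq> l"
  show "\<exists>x\<in>L. (gen ^^ k) x \<noteq> (gen ^^ l) x"
  proof (intro bexI[OF _ alpha_mem_L])
    have "\<zeta> powi int k \<noteq> \<zeta> powi int l" using kl by (simp only: zeta_powi_eq_iff) simp
    then show "(gen ^^ k) \<alpha> \<noteq> (gen ^^ l) \<alpha>" using alpha_neq_0 by (simp add: gen_pow_alpha power_int_of_nat)
  qed
qed (use gen_pow_emb gen_pow_fixed fixed_subset_L assms in auto)

end

section \<open>Vanishing of cup products\<close>

context automorphism_group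
begin

text \<open>f is a trivializing 1-cochain up to reduction mod p: its coboundary is the cup product
  of the two characters. Written in powers of \<zeta>, the identity allows f arbitrary integer
  values.\<close>

definition cup_trivial :: "'c \<Rightarrow> 'c \<Rightarrow> bool" where
  "cup_trivial b a \<longleftrightarrow> (\<exists>f. locally_constant f \<and> (\<forall>\<sigma>\<in>H. \<forall>\<tau>\<in>H.
     \<zeta> powi (kummer_char b \<sigma> * kummer_char a \<tau>) = \<zeta> powi (f \<sigma> + f \<tau> - f (compose \<Omega> \<sigma> \<tau>))))"

end

context kummer_extension
begin

abbreviation a_char :: "('c \<Rightarrow> 'c) \<Rightarrow> int" where
  "a_char \<equiv> kummer_char (\<alpha> ^ p)"

lemmas a_char_range = kummer_char_range[OF alpha_pow alpha_pow_neq_0]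
  and a_char_compose = kummer_char_compose[OF alpha_pow alpha_pow_neq_0]

lemma L_subset_Omega: "x \<in> L \<Longrightarrow> x \<in> \<Omega>"
  using U.fixed_field_subset by blast

lemma funpow_L_mult: "x \<in> L \<Longrightarrow> y \<in> L \<Longrightarrow> (gen ^^ n) (x * y) = (gen ^^ n) x * (gen ^^ n) y"
  by (rule emb_mult[OF U.subfield_fixed gen_pow_emb])

text \<open>At n = p this is the norm of w. The intermediate products obey the cocycle rule
  \<open>partial_norm_add\<close> for the iterates of \<open>gen\<close>, and it is they that enter
  the cochains.\<close>

definition partial_norm :: "'c \<Rightarrow> nat \<Rightarrow> 'c" where
  "partial_norm w n = (\<Prod>k<n. (gen ^^ k) w)"

lemma partial_norm_mem: "w \<in> L \<Longrightarrow> partial_norm w n \<in> L"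
  unfolding partial_norm_def by (intro is_subfield_prod[OF U.subfield_fixed] gen_pow_mem_L)

lemma partial_norm_add:
  assumes "w \<in> L" shows "partial_norm w (m + n) = partial_norm w m * (gen ^^ m) (partial_norm w n)"
proof (induction n)
  case 0
  then show ?case using emb_1[OF U.subfield_fixed gen_pow_emb] by (simp add: partial_norm_def)
next
  case (Suc n)
  have "partial_norm w (Suc k) = partial_norm w k * (gen ^^ k) w" for k by (simp add: partial_norm_def)
  then show ?case using Suc.IH assms by (simp add: funpow_L_mult partial_norm_mem gen_pow_mem_L funpow_add)
qed

lemma partial_norm_Suc: "w \<in> L \<Longrightarrow> partial_norm w (Suc n) = w * gen (partial_norm w n)"
  using partial_norm_add[of w 1 n] by (simp add: partial_norm_def)

lemma gen_pow_neq_0: "w \<in> L \<Longrightarrow> w \<noteq> 0 \<Longrightarrow> (gen ^^ n) w \<noteq> 0"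
  by (subst emb_eq_0_iff[OF U.subfield_fixed gen_pow_emb])

lemma partial_norm_neq_0: "w \<in> L \<Longrightarrow> w \<noteq> 0 \<Longrightarrow> partial_norm w n \<noteq> 0"
  by (simp add: partial_norm_def gen_pow_neq_0)

lemma partial_norm_p_mem:
  assumes "w \<in> L" shows "partial_norm w p \<in> fixed_field"
proof (rule fixed_by_gen[OF partial_norm_mem[OF assms]])
  have "partial_norm w (Suc p) = partial_norm w p * (gen ^^ p) w" by (simp add: partial_norm_def)
  then have "w * gen (partial_norm w p) = partial_norm w p * w"
    using partial_norm_Suc[OF assms, of p] gen_pow_p[OF assms] by metis
  \<comment> \<open>The product of p + 1 factors, written in two ways, gives invariance only after
    cancelling w; hence zero is treated apart.\<close>
  moreover have "partial_norm w p = 0" if "w = 0"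
    unfolding partial_norm_def that by (rule prod_zero) (auto intro!: bexI[of _ 0])
  ultimately show "gen (partial_norm w p) = partial_norm w p"
    using emb_0[OF subfield_Omega emb[OF gen_mem]] by (metis mult.commute mult_cancel_left)
qed

text \<open>
  With \<open>W = \<Prod>\<^sub>k (s\<^sup>k w)\<^sup>k\<close> one has \<open>s W = W w\<^sup>p / b\<close>, hence \<open>s\<^sup>n W = W g(n)\<^sup>p\<close> where \<open>g(n)\<close> is the partial
  norm divided by \<open>\<beta>\<^sup>n\<close>; \<open>g\<close> has period \<open>p\<close> in \<open>n\<close>. A \<open>p\<close>-th root \<open>\<gamma>\<close> of \<open>W\<close> then satisfies
  \<open>\<sigma> \<gamma> = \<zeta>\<^sup>f\<^sup>(\<^sup>\<sigma>\<^sup>) \<gamma> g(n(\<sigma>))\<close>, and \<open>f\<close> is a cochain whose coboundary is the cup product.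
\<close>

theorem cup_trivial_of_norm:
  assumes w: "w \<in> L" "w \<noteq> 0"
  shows "cup_trivial (partial_norm w p) (\<alpha> ^ p)"
proof -
  define b where "b = partial_norm w p"
  have b: "b \<in> fixed_field" "b \<noteq> 0" unfolding b_def using partial_norm_p_mem partial_norm_neq_0 w by auto
  obtain \<beta> where \<beta>: "\<beta> ^ p = b" using nth_root_exists[OF p_gt_0] by blast
  have \<beta>m: "\<beta> \<in> \<Omega>" and \<beta>0: "\<beta> \<noteq> 0" using fixed_root_mem \<beta> b by (auto simp: power_0_left)
  define W where "W = (\<Prod>k<p. ((gen ^^ k) w) ^ k)"
  have WL: "W \<in> L" unfolding W_def
    by (intro is_subfield_prod[OF U.subfield_fixed] is_subfield_power[OF U.subfield_fixed] gen_pow_mem_L w)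
  have W0: "W \<noteq> 0" using w by (simp add: W_def gen_pow_neq_0)
  \<comment> \<open>Applying \<open>gen\<close> shifts the factors of W against their exponents;
    multiplying by b raises every exponent by one and realigns them, and the top factor (s^p w)^p =
    w^p is left over.\<close>
  have genW: "gen W * b = W * w ^ p"
  proof -
    note e = subfield_Omega emb[OF gen_mem]
    have "gen W = (\<Prod>k<p. gen (((gen ^^ k) w) ^ k))"
      unfolding W_def by (rule emb_prod[OF e]) (intro Omega_closed funpow_mem gen_mem L_subset_Omega w)
    also have "\<dots> = (\<Prod>k<p. ((gen ^^ Suc k) w) ^ k)"
      by (simp add: emb_power[OF e funpow_mem[OF gen_mem L_subset_Omega[OF w(1)]]])
    finally have "gen W = (\<Prod>k<p. ((gen ^^ Suc k) w) ^ k)" .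
    moreover have "b = (\<Prod>k<p. (gen ^^ Suc k) w)"
    proof -
      have "(\<Prod>k<p. (gen ^^ Suc k) w) = gen b"
        unfolding b_def partial_norm_def
        using emb_prod[OF e, of "{..<p}" "\<lambda>k. (gen ^^ k) w"] funpow_mem[OF gen_mem L_subset_Omega[OF w(1)]] by simp
      also have "gen b = b" using b(1) gen_mem by (simp add: fixed_field_iff)
      finally show ?thesis by simp
    qed
    ultimately have "gen W * b = (\<Prod>k<p. ((gen ^^ Suc k) w) ^ k) * (\<Prod>k<p. (gen ^^ Suc k) w)" by simp
    also have "\<dots> = (\<Prod>k<p. ((gen ^^ Suc k) w) ^ Suc k)" by (simp add: mult.commute flip: prod.distrib)
    also have "\<dots> = (\<Prod>k<Suc p. ((gen ^^ k) w) ^ k)"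
      by (subst prod.lessThan_Suc_shift) simp
    also have "\<dots> = W * w ^ p" using gen_pow_p[OF w(1)] by (simp add: W_def)
    finally show ?thesis .
  qed
  obtain \<gamma> where \<gamma>: "\<gamma> ^ p = W" using nth_root_exists[OF p_gt_0] by blast
  have \<gamma>m: "\<gamma> \<in> \<Omega>" and \<gamma>0: "\<gamma> \<noteq> 0" using root_closed \<gamma> W0 L_subset_Omega[OF WL] by (auto simp: power_0_left)
  define g where "g n = partial_norm w n / \<beta> ^ n" for n
  have g0: "g n \<noteq> 0" and gm: "g n \<in> \<Omega>" for n
    using w \<beta>0 \<beta>m L_subset_Omega[OF partial_norm_mem[OF w(1)]] by (simp_all add: g_def partial_norm_neq_0 Omega_closed)
  have g_per: "g (n + p * m) = g n" for n m
  proof (induction m)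
    case (Suc m)
    have "partial_norm w (p + k) = b * partial_norm w k" for k
      using partial_norm_add[OF w(1), of p k] gen_pow_p[OF partial_norm_mem[OF w(1)]] by (simp add: b_def)
    then have "g (p + k) = g k" for k using \<beta> b(2) by (simp add: g_def power_add)
    then show ?case using Suc.IH by (metis add.left_commute mult_Suc_right)
  qed simp
  have g_mod: "g (n mod p) = g n" for n using g_per[of "n mod p" "n div p"] by simp
  have W_pow: "(gen ^^ n) W = W * g n ^ p" for n
  proof (induction n)
    case (Suc n)
    have gp: "g k ^ p = partial_norm w k ^ p / b ^ k" for k
      by (simp add: g_def power_divide \<beta>[symmetric] mult.commute flip: power_mult)
    have "gen (g n ^ p) = gen (partial_norm w n) ^ p / b ^ n"
    proof -
      have "gen b = b" "b \<in> \<Omega>" using b(1) gen_mem by (auto simp: fixed_field_iff)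
      then show ?thesis unfolding gp using partial_norm_mem[OF w(1), of n, THEN L_subset_Omega]
        by (simp add: aut_divide[OF gen_mem] aut_power[OF gen_mem] Omega_closed)
    qed
    moreover have "gen (W * g n ^ p) = gen W * gen (g n ^ p)"
      by (rule aut_mult[OF gen_mem L_subset_Omega[OF WL]]) (intro Omega_closed gm)
    ultimately have "(gen ^^ Suc n) W = gen W * gen (partial_norm w n) ^ p / b ^ n" using Suc.IH by simp
    also have "gen W = W * w ^ p / b" using genW b(2) by (simp add: field_simps)
    finally show ?case unfolding gp partial_norm_Suc[OF w(1)] by (simp add: power_mult_distrib)
  qed (simp add: g_def partial_norm_def)
  define n where "n \<sigma> = nat (a_char \<sigma>)" for \<sigma>
  have ex: "\<exists>k. \<sigma> \<gamma> = \<zeta> powi k * (\<gamma> * g (n \<sigma>))" if s: "\<sigma> \<in> H" for \<sigma>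
  proof -
    have "\<sigma> \<gamma> ^ p = (\<gamma> * g (n \<sigma>)) ^ p"
      using aut_power[OF s \<gamma>m, of p] aut_eq_gen_pow[OF s WL] W_pow[of "n \<sigma>"] \<gamma>
      by (simp add: n_def power_mult_distrib)
    then obtain k where "\<sigma> \<gamma> = \<zeta> powi k * (\<gamma> * g (n \<sigma>))" using exists_zeta_powi \<gamma>0 g0 by (metis mult_eq_0_iff)
    then show ?thesis by blast
  qed
  \<comment> \<open>The choice depends on \<sigma> only through \<open>\<sigma> \<gamma>\<close> and
    \<open>n \<sigma>\<close>, which makes f locally constant.\<close>
  define f where "f \<sigma> = (SOME k. \<sigma> \<gamma> = \<zeta> powi k * (\<gamma> * g (n \<sigma>)))" for \<sigma>
  have f: "\<sigma> \<gamma> = \<zeta> powi f \<sigma> * (\<gamma> * g (n \<sigma>))" if "\<sigma> \<in> H" for \<sigma>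
    unfolding f_def by (rule someI_ex[OF ex[OF that]])
  have "locally_constant f"
    unfolding locally_constant_def
  proof
    fix \<sigma> assume s: "\<sigma> \<in> H"
    obtain F where F: "finite F" "F \<subseteq> \<Omega>" "\<And>\<tau>. \<tau> \<in> H \<Longrightarrow> (\<And>x. x \<in> F \<Longrightarrow> \<tau> x = \<sigma> x) \<Longrightarrow> a_char \<tau> = a_char \<sigma>"
      using locally_constantD[OF locally_constant_kummer_char[OF alpha_pow alpha_pow_neq_0] s] by metis
    show "\<exists>F. finite F \<and> F \<subseteq> \<Omega> \<and> (\<forall>\<tau>\<in>H. (\<forall>x\<in>F. \<tau> x = \<sigma> x) \<longrightarrow> f \<tau> = f \<sigma>)"
    proof (intro exI[of _ "insert \<gamma> F"] conjI ballI impI)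
      fix \<tau> assume "\<tau> \<in> H" and eq: "\<forall>x\<in>insert \<gamma> F. \<tau> x = \<sigma> x"
      then have "a_char \<tau> = a_char \<sigma>" using F(3) by blast
      then show "f \<tau> = f \<sigma>" using eq by (simp add: f_def n_def)
    qed (use F \<gamma>m in auto)
  qed
  moreover have "\<zeta> powi (kummer_char b \<sigma> * a_char \<tau>) = \<zeta> powi (f \<sigma> + f \<tau> - f (compose \<Omega> \<sigma> \<tau>))"
    if s: "\<sigma> \<in> H" and t: "\<tau> \<in> H" for \<sigma> \<tau>
  proof -
    have ni: "int (n \<rho>) = a_char \<rho>" if "\<rho> \<in> H" for \<rho> using a_char_range[OF that] by (simp add: n_def)
    have nst: "n (compose \<Omega> \<sigma> \<tau>) = (n \<sigma> + n \<tau>) mod p"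
    proof -
      have "int (n (compose \<Omega> \<sigma> \<tau>)) = int ((n \<sigma> + n \<tau>) mod p)"
        using ni[OF compose_mem[OF s t]] a_char_compose[OF s t] ni[OF s] ni[OF t] by (simp add: of_nat_mod)
      then show ?thesis by simp
    qed
    define z where "z = \<zeta> powi (kummer_char b \<sigma> * a_char \<tau>)"
    have z: "z = (\<zeta> powi kummer_char b \<sigma>) ^ n \<tau>"
      unfolding z_def ni[OF t, symmetric] by (simp flip: power_int_of_nat power_int_mult)
    have sg: "\<sigma> (g (n \<tau>)) = (gen ^^ n \<sigma>) (partial_norm w (n \<tau>)) / (z * \<beta> ^ n \<tau>)"
    proof -
      have "\<sigma> (\<beta> ^ n \<tau>) = z * \<beta> ^ n \<tau>"
        using kummer_char(1)[OF \<beta> b s] aut_power[OF s \<beta>m] by (simp add: z power_mult_distrib)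
      then show ?thesis unfolding g_def
        using aut_divide[OF s L_subset_Omega[OF partial_norm_mem[OF w(1)]]] \<beta>m
          aut_eq_gen_pow[OF s partial_norm_mem[OF w(1)]] by (simp add: Omega_closed n_def)
    qed
    \<comment> \<open>The partial norms satisfy the exact cocycle rule, whereas \<sigma> multiplies
      \<beta>^n by a power of \<zeta>. The defect z is precisely the value of the cup
      product.\<close>
    have gg: "g (n \<sigma>) * \<sigma> (g (n \<tau>)) * z = g (n \<sigma> + n \<tau>)"
      unfolding sg using partial_norm_add[OF w(1), of "n \<sigma>" "n \<tau>"]
      by (simp add: g_def power_add z)
    have "compose \<Omega> \<sigma> \<tau> \<gamma> = \<sigma> (\<zeta> powi f \<tau> * (\<gamma> * g (n \<tau>)))" using f[OF t] \<gamma>m by (simp add: compose_def)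
    also have "\<dots> = \<zeta> powi f \<tau> * (\<sigma> \<gamma> * \<sigma> (g (n \<tau>)))"
      by (simp add: aut_mult[OF s] aut_zeta_powi[OF s] zeta_powi_mem \<gamma>m gm Omega_closed)
    finally have "\<zeta> powi f (compose \<Omega> \<sigma> \<tau>) * (\<gamma> * g (n \<sigma> + n \<tau>)) =
       \<zeta> powi f \<tau> * (\<zeta> powi f \<sigma> * (\<gamma> * g (n \<sigma>)) * \<sigma> (g (n \<tau>)))"
      using f[OF compose_mem[OF s t]] f[OF s] by (simp add: nst g_mod)
    then have "\<zeta> powi f (compose \<Omega> \<sigma> \<tau>) * (g (n \<sigma>) * \<sigma> (g (n \<tau>)) * z) =
       \<zeta> powi f \<tau> * \<zeta> powi f \<sigma> * (g (n \<sigma>) * \<sigma> (g (n \<tau>)))"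
      using \<gamma>0 unfolding gg by (simp add: mult_ac)
    then have "(\<zeta> powi f (compose \<Omega> \<sigma> \<tau>) * z) * (g (n \<sigma>) * \<sigma> (g (n \<tau>))) =
       (\<zeta> powi f \<tau> * \<zeta> powi f \<sigma>) * (g (n \<sigma>) * \<sigma> (g (n \<tau>)))"
      by (simp only: mult_ac)
    moreover have nz: "g (n \<sigma>) * \<sigma> (g (n \<tau>)) \<noteq> 0" using g0 aut_eq_0_iff[OF s gm] by simp
    ultimately have "\<zeta> powi f (compose \<Omega> \<sigma> \<tau>) * z = \<zeta> powi f \<tau> * \<zeta> powi f \<sigma>"
      using mult_right_cancel[OF nz] by blast
    then show ?thesis unfolding z_def by (simp add: power_int_diff power_int_add field_simps)
  qed
  ultimately show ?thesis unfolding cup_trivial_def b_def by blast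
qed

text \<open>
  On the stabilizer of \<open>\<alpha>\<close> the cochain \<open>f\<close> is a character, with Kummer generator \<open>\<gamma>\<close>; the element
  \<open>w = s(\<gamma>) \<beta> / (\<gamma> \<zeta>\<^sup>f\<^sup>(\<^sup>s\<^sup>))\<close> is the solution.
\<close>

theorem norm_of_cup_trivial:
  assumes b: "b \<in> fixed_field" "b \<noteq> 0" and cup: "cup_trivial b (\<alpha> ^ p)"
  obtains w where "w \<in> L" "w \<noteq> 0" "partial_norm w p = b"
proof -
  obtain f where lc: "locally_constant f" and f0: "\<And>\<sigma> \<tau>. \<sigma> \<in> H \<Longrightarrow> \<tau> \<in> H \<Longrightarrow>
     \<zeta> powi (kummer_char b \<sigma> * a_char \<tau>) = \<zeta> powi (f \<sigma> + f \<tau> - f (compose \<Omega> \<sigma> \<tau>))"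
    using cup unfolding cup_trivial_def by blast
  have f: "\<zeta> powi f (compose \<Omega> \<sigma> \<tau>) * \<zeta> powi (kummer_char b \<sigma> * a_char \<tau>) = \<zeta> powi f \<sigma> * \<zeta> powi f \<tau>"
    if "\<sigma> \<in> H" "\<tau> \<in> H" for \<sigma> \<tau>
    using f0[OF that] by (simp add: power_int_diff power_int_add)
  \<comment> \<open>The character of \<alpha>^p vanishes on the stabilizer, so f is multiplicative
    there, and even when only the second argument lies in the stabilizer.\<close>
  have fU: "\<zeta> powi f (compose \<Omega> \<sigma> \<tau>) = \<zeta> powi f \<sigma> * \<zeta> powi f \<tau>"
    if "\<sigma> \<in> H" "\<tau> \<in> root_stabilizer \<alpha>" for \<sigma> \<tau>
  proof -
    have "\<tau> \<in> H" using that(2) stabilizer_subset by auto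
    then show ?thesis using f[OF that(1), of \<tau>] that(2) stabilizer_iff_kummer_char[of \<tau>] by simp
  qed
  have "U.locally_constant f"
    using lc stabilizer_subset unfolding U.locally_constant_def locally_constant_def by (meson subsetD)
  then obtain \<gamma> where \<gamma>: "\<gamma> \<in> \<Omega>" "\<gamma> \<noteq> 0" "\<And>\<sigma>. \<sigma> \<in> root_stabilizer \<alpha> \<Longrightarrow> \<sigma> \<gamma> = \<zeta> powi f \<sigma> * \<gamma>"
    using U.exists_kummer_generator[of f] fU stabilizer_subset by (metis subsetD)
  obtain \<beta> where \<beta>: "\<beta> ^ p = b" using nth_root_exists[OF p_gt_0] by blast
  have \<beta>m: "\<beta> \<in> \<Omega>" and \<beta>0: "\<beta> \<noteq> 0" using fixed_root_mem \<beta> b by (auto simp: power_0_left)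
  define w where "w = gen \<gamma> * \<beta> / (\<gamma> * \<zeta> powi f gen)"
  have g\<gamma>: "gen \<gamma> \<in> \<Omega>" "gen \<gamma> \<noteq> 0" using aut_mem[OF gen_mem \<gamma>(1)] aut_eq_0_iff[OF gen_mem \<gamma>(1)] \<gamma>(2) by auto
  have w\<Omega>: "w \<in> \<Omega>" unfolding w_def by (intro Omega_closed g\<gamma> \<beta>m \<gamma> zeta_powi_mem)
  have w0: "w \<noteq> 0" unfolding w_def using g\<gamma> \<gamma> \<beta>0 by simp
  have gw: "gen \<gamma> = w * \<gamma> * \<zeta> powi f gen / \<beta>" unfolding w_def using \<gamma> \<beta>0 by simp
  have "\<tau> w = w" if tU: "\<tau> \<in> root_stabilizer \<alpha>" for \<tau>
  proof -
    have t: "\<tau> \<in> H" using tU stabilizer_subset by auto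
    define \<rho> where "\<rho> = compose \<Omega> (inverse_aut gen) (compose \<Omega> \<tau> gen)"
    have \<rho>: "\<rho> \<in> root_stabilizer \<alpha>" unfolding \<rho>_def by (rule conj_stabilizer[OF tU gen_mem])
    have \<rho>H: "\<rho> \<in> H" using \<rho> stabilizer_subset by auto
    have comm: "compose \<Omega> gen \<rho> = compose \<Omega> \<tau> gen"
    proof (rule aut_ext)
      fix x assume x: "x \<in> \<Omega>"
      then show "compose \<Omega> gen \<rho> x = compose \<Omega> \<tau> gen x"
        using inverse_aut(1)[OF gen_mem aut_mem[OF t aut_mem[OF gen_mem x]]] by (simp add: \<rho>_def compose_def)
    qed (intro compose_mem gen_mem \<rho>H t)+
    \<comment> \<open>The element \<tau> gen = gen \<rho> is expanded in both orders. The resulting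
      discrepancy between f at \<rho> and at \<tau> is the character of b at \<tau>, which the
      action of \<tau> on \<beta> compensates.\<close>
    have e1: "\<zeta> powi f (compose \<Omega> \<tau> gen) = \<zeta> powi f gen * \<zeta> powi f \<rho>" using fU[OF gen_mem \<rho>] comm by simp
    have "\<zeta> powi f (compose \<Omega> \<tau> gen) * \<zeta> powi kummer_char b \<tau> = \<zeta> powi f \<tau> * \<zeta> powi f gen"
      using f[OF t gen_mem] kummer_char_gen by simp
    then have e2: "\<zeta> powi f \<rho> * \<zeta> powi kummer_char b \<tau> = \<zeta> powi f \<tau>"
      unfolding e1 by (simp add: mult_ac)
    have "\<tau> (gen \<gamma>) = compose \<Omega> gen \<rho> \<gamma>" using comm \<gamma>(1) by (simp add: compose_def)
    also have "\<dots> = gen (\<zeta> powi f \<rho> * \<gamma>)" using \<gamma>(1,3) \<rho> by (simp add: compose_def)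
    also have "\<dots> = \<zeta> powi f \<rho> * gen \<gamma>" using aut_mult[OF gen_mem zeta_powi_mem \<gamma>(1)] aut_zeta_powi[OF gen_mem] by simp
    finally have t\<gamma>: "\<tau> (gen \<gamma>) = \<zeta> powi f \<rho> * gen \<gamma>" .
    have "\<tau> w = \<tau> (gen \<gamma>) * \<tau> \<beta> / (\<tau> \<gamma> * \<zeta> powi f gen)"
      unfolding w_def by (simp add: aut_divide[OF t] aut_mult[OF t] aut_zeta_powi[OF t] Omega_closed g\<gamma> \<beta>m \<gamma>(1) zeta_powi_mem)
    also have "\<dots> = (\<zeta> powi f \<rho> * \<zeta> powi kummer_char b \<tau>) * gen \<gamma> * \<beta> / (\<zeta> powi f \<tau> * \<gamma> * \<zeta> powi f gen)"
      using t\<gamma> kummer_char(1)[OF \<beta> b t] \<gamma>(3)[OF tU] by (simp add: mult_ac)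
    also have "\<dots> = w" unfolding e2 w_def by simp
    finally show ?thesis .
  qed
  then have wL: "w \<in> L" using w\<Omega> by (simp add: U.fixed_field_iff)
  \<comment> \<open>Iterating gen \<gamma> = w \<gamma> \<zeta>^f(gen) / \<beta>; the powers of
    \<zeta> coming from \<beta> are absorbed by the cup product relation for f.\<close>
  have main: "(gen ^^ n) \<gamma> = partial_norm w n * \<gamma> * \<zeta> powi f (aut_pow gen n) / \<beta> ^ n" for n
  proof (induction n)
    case 0
    have "compose \<Omega> (\<lambda>x\<in>\<Omega>. x) (\<lambda>x\<in>\<Omega>. x) = (\<lambda>x\<in>\<Omega>. x)" by (auto simp: compose_def)
    moreover have "(\<lambda>x\<in>\<Omega>. x) \<in> root_stabilizer \<alpha>" by (rule U.id_mem)
    ultimately have "\<zeta> powi f (\<lambda>x\<in>\<Omega>. x) = 1" using fU[OF id_mem, of "\<lambda>x\<in>\<Omega>. x"] by simp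
    then show ?case
      by (simp only: aut_pow.simps funpow_0 partial_norm_def lessThan_0 prod.empty mult_1 mult_1_right power_0 div_by_1)
  next
    case (Suc n)
    define z where "z = \<zeta> powi (int n * kummer_char b gen)"
    have z: "(\<zeta> powi kummer_char b gen) ^ n = z"
      unfolding z_def by (simp add: mult.commute flip: power_int_of_nat power_int_mult)
    have fn: "\<zeta> powi f (aut_pow gen (Suc n)) * z = \<zeta> powi f gen * \<zeta> powi f (aut_pow gen n)"
    proof -
      have "\<zeta> powi (kummer_char b gen * a_char (aut_pow gen n)) = z"
        unfolding z_def zeta_powi_eq_iff kummer_char_aut_pow[OF alpha_pow alpha_pow_neq_0 gen_mem]
        by (simp add: kummer_char_gen mod_mult_left_eq mult.commute[of "kummer_char b gen"])
      then show ?thesis using f[OF gen_mem aut_pow_mem[OF gen_mem, of n]] unfolding aut_pow.simps by metis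
    qed
    have g\<beta>: "gen (\<beta> ^ n) = z * \<beta> ^ n"
      using kummer_char(1)[OF \<beta> b gen_mem] aut_power[OF gen_mem \<beta>m] z by (simp add: power_mult_distrib)
    have "(gen ^^ Suc n) \<gamma> = gen (partial_norm w n * \<gamma> * \<zeta> powi f (aut_pow gen n) / \<beta> ^ n)"
      using Suc.IH by simp
    also have "\<dots> = gen (partial_norm w n) * gen \<gamma> * \<zeta> powi f (aut_pow gen n) / (z * \<beta> ^ n)"
      using g\<beta> L_subset_Omega[OF partial_norm_mem[OF wL]]
      by (simp add: aut_divide[OF gen_mem] aut_mult[OF gen_mem] aut_zeta_powi[OF gen_mem] Omega_closed \<beta>m \<gamma>(1) zeta_powi_mem)
    also have "\<dots> = (w * gen (partial_norm w n)) * \<gamma> * (\<zeta> powi f gen * \<zeta> powi f (aut_pow gen n)) / (z * \<beta> ^ Suc n)"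
      unfolding gw by (simp add: mult_ac)
    also have "\<dots> = partial_norm w (Suc n) * \<gamma> * \<zeta> powi f (aut_pow gen (Suc n)) / \<beta> ^ Suc n"
      unfolding fn[symmetric] partial_norm_Suc[OF wL] by (simp add: z_def)
    finally show ?case .
  qed
  \<comment> \<open>gen^p lies in the stabilizer and so acts on \<gamma> through f. Comparison with
    the formula for n = p leaves the norm of w equal to \<beta>^p.\<close>
  have "a_char (aut_pow gen p) = 0"
    using kummer_char_aut_pow[OF alpha_pow alpha_pow_neq_0 gen_mem, of p] kummer_char_gen by simp
  then have "aut_pow gen p \<in> root_stabilizer \<alpha>" using stabilizer_iff_kummer_char aut_pow_mem[OF gen_mem] by simp
  then have "(gen ^^ p) \<gamma> = \<zeta> powi f (aut_pow gen p) * \<gamma>" using \<gamma>(3) aut_pow_apply[OF gen_mem \<gamma>(1)] by metis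
  then have "partial_norm w p = b" using main[of p] \<gamma>(2) \<beta> b(2) by (simp add: field_simps)
  then show ?thesis using that wL w0 by blast
qed

end

context automorphism_group
begin

theorem cup_trivial_iff_norm:
  assumes b: "b \<in> fixed_field" "b \<noteq> 0" and a: "\<alpha> ^ p \<in> fixed_field" "\<alpha> \<noteq> 0"
  shows "cup_trivial b (\<alpha> ^ p) \<longleftrightarrow>
    b \<in> field_norm fixed_field (adjoin fixed_field \<alpha>) ` (adjoin fixed_field \<alpha> - {0})"
proof (cases "\<alpha> \<in> fixed_field")
  \<comment> \<open>If \<alpha> lies in the fixed field, its character is zero and the extension is
    trivial, so both sides hold.\<close>
  case True
  then have "kummer_char (\<alpha> ^ p) \<sigma> = 0" if "\<sigma> \<in> H" for \<sigma>
    using kummer_char_eq_0_iff[OF refl a(1) _ that] a(2) that by (simp add: fixed_field_iff)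
  then have "cup_trivial b (\<alpha> ^ p)"
    unfolding cup_trivial_def by (intro exI[of _ "\<lambda>_. 0"]) (auto simp: locally_constant_def)
  moreover have "b = field_norm fixed_field fixed_field b" using field_norm_self[OF subfield_fixed b(1)] by simp
  ultimately show ?thesis using b adjoin_self[OF subfield_fixed True] by auto
next
  case False
  interpret kummer_extension p \<zeta> \<Omega> H \<alpha> by unfold_locales (use False a in auto)
  have "b \<in> field_norm fixed_field (adjoin fixed_field \<alpha>) ` (adjoin fixed_field \<alpha> - {0}) \<longleftrightarrow>
    (\<exists>w\<in>L - {0}. partial_norm w p = b)"
    unfolding L_eq_adjoin[symmetric] image_iff
    by (rule bex_cong) (auto simp: field_norm_L partial_norm_def)
  also have "\<dots> \<longleftrightarrow> cup_trivial b (\<alpha> ^ p)"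
  proof
    assume "\<exists>w\<in>L - {0}. partial_norm w p = b"
    then show "cup_trivial b (\<alpha> ^ p)" using cup_trivial_of_norm by auto
  next
    assume "cup_trivial b (\<alpha> ^ p)"
    then show "\<exists>w\<in>L - {0}. partial_norm w p = b" by (rule norm_of_cup_trivial[OF b]) auto
  qed
  finally show ?thesis by simp
qed

end

section \<open>Cohomology in degrees one and two\<close>

text \<open>The topology enters only through a description of its open sets, so that the Krull
  topology and the subspace topology on a stabilizer are both instances.\<close>

locale krull_group = automorphism_group p \<zeta> \<Omega> H
  for p and \<zeta> :: "'c::alg_closed_field" and \<Omega> H +
  fixes T :: "('c \<Rightarrow> 'c) topology"
  assumes openin_T: "openin T S \<longleftrightarrow> S \<subseteq> H \<and>
    (\<forall>\<sigma>\<in>S. \<exists>F. finite F \<and> F \<subseteq> \<Omega> \<and> {\<tau> \<in> H. \<forall>x\<in>F. \<tau> x = \<sigma> x} \<subseteq> S)"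
begin

abbreviation G :: "('c \<Rightarrow> 'c) monoid" where
  "G \<equiv> (BijGroup \<Omega>)\<lparr>carrier := H\<rparr>"

lemma G_mult: "\<sigma> \<in> H \<Longrightarrow> \<tau> \<in> H \<Longrightarrow> \<sigma> \<otimes>\<^bsub>G\<^esub> \<tau> = compose \<Omega> \<sigma> \<tau>"
  by (simp add: BijGroup_def Bij)

lemma topspace_T: "topspace T = H"
proof -
  have "openin T H" unfolding openin_T by auto
  then show ?thesis using openin_T[of "topspace T"] openin_subset by auto
qed

lemma continuous_iff_locally_constant:
  "continuous_map T (discrete_topology S) f \<longleftrightarrow> f ` H \<subseteq> S \<and> locally_constant f"
proof
  assume c: "continuous_map T (discrete_topology S) f"
  then have im: "f ` H \<subseteq> S" using continuous_map_image_subset_topspace topspace_T by fastforce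
  moreover have "locally_constant f"
    unfolding locally_constant_def
  proof
    fix \<sigma> assume s: "\<sigma> \<in> H"
    have "openin T {x \<in> topspace T. f x \<in> {f \<sigma>}}"
      by (rule openin_continuous_map_preimage[OF c]) (use im s in auto)
    moreover have "\<sigma> \<in> {x \<in> topspace T. f x \<in> {f \<sigma>}}" using s topspace_T by simp
    ultimately obtain F where "finite F" "F \<subseteq> \<Omega>"
      "{\<tau> \<in> H. \<forall>x\<in>F. \<tau> x = \<sigma> x} \<subseteq> {x \<in> topspace T. f x \<in> {f \<sigma>}}"
      unfolding openin_T by blast
    then show "\<exists>F. finite F \<and> F \<subseteq> \<Omega> \<and> (\<forall>\<tau>\<in>H. (\<forall>x\<in>F. \<tau> x = \<sigma> x) \<longrightarrow> f \<tau> = f \<sigma>)"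
      by (intro exI[of _ F]) auto
  qed
  ultimately show "f ` H \<subseteq> S \<and> locally_constant f" by simp
next
  assume f: "f ` H \<subseteq> S \<and> locally_constant f"
  show "continuous_map T (discrete_topology S) f"
    unfolding continuous_map
  proof (intro conjI allI impI)
    fix U assume "openin (discrete_topology S) U"
    show "openin T {x \<in> topspace T. f x \<in> U}"
      unfolding openin_T topspace_T
    proof (intro conjI ballI)
      fix \<sigma> assume "\<sigma> \<in> {x \<in> H. f x \<in> U}"
      then obtain F where "finite F" "F \<subseteq> \<Omega>" "\<And>\<tau>. \<tau> \<in> H \<Longrightarrow> (\<And>x. x \<in> F \<Longrightarrow> \<tau> x = \<sigma> x) \<Longrightarrow> f \<tau> = f \<sigma>"
          "f \<sigma> \<in> U"
        using locally_constantD[of f \<sigma>] f by blast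
      then show "\<exists>F. finite F \<and> F \<subseteq> \<Omega> \<and> {\<tau> \<in> H. \<forall>x\<in>F. \<tau> x = \<sigma> x} \<subseteq> {x \<in> H. f x \<in> U}"
        by (intro exI[of _ F]) auto
    qed auto
  qed (use f topspace_T in auto)
qed

section \<open>Cochains as functions of one or two group elements\<close>

definition pt :: "('c \<Rightarrow> 'c) \<Rightarrow> nat \<Rightarrow> ('c \<Rightarrow> 'c)" where
  "pt \<sigma> = (\<lambda>i\<in>{..<1}. \<sigma>)"

definition pt2 :: "('c \<Rightarrow> 'c) \<Rightarrow> ('c \<Rightarrow> 'c) \<Rightarrow> nat \<Rightarrow> ('c \<Rightarrow> 'c)" where
  "pt2 \<sigma> \<tau> = (\<lambda>i\<in>{..<2}. if i = 0 then \<sigma> else \<tau>)"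

lemma pt_0 [simp]: "pt \<sigma> 0 = \<sigma>"
  by (simp add: pt_def)

lemma pt2_apply [simp]: "pt2 \<sigma> \<tau> 0 = \<sigma>" "pt2 \<sigma> \<tau> (Suc 0) = \<tau>"
  by (simp_all add: pt2_def)

lemma powers_1: "powers G 1 = pt ` H"
proof (rule Set.set_eqI)
  fix x
  show "x \<in> powers G 1 \<longleftrightarrow> x \<in> pt ` H"
  proof
    assume x: "x \<in> powers G 1"
    then have "x = pt (x 0)" unfolding pt_def by (intro extensionalityI[of _ "{..<1}"]) (auto simp: PiE_iff)
    then show "x \<in> pt ` H" using x by (auto simp: PiE_iff)
  qed (auto simp: pt_def PiE_iff)
qed

lemma powers_2: "powers G 2 = {pt2 \<sigma> \<tau> | \<sigma> \<tau>. \<sigma> \<in> H \<and> \<tau> \<in> H}"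
proof (rule Set.set_eqI)
  fix x
  show "x \<in> powers G 2 \<longleftrightarrow> x \<in> {pt2 \<sigma> \<tau> | \<sigma> \<tau>. \<sigma> \<in> H \<and> \<tau> \<in> H}"
  proof
    assume x: "x \<in> powers G 2"
    have "x = pt2 (x 0) (x 1)" unfolding pt2_def
      by (intro extensionalityI[of _ "{..<2}"]) (use x in \<open>auto simp: PiE_iff less_2_cases_iff\<close>)
    moreover have "x 0 \<in> H" "x 1 \<in> H" using x by (auto simp: PiE_iff)
    ultimately show "x \<in> {pt2 \<sigma> \<tau> | \<sigma> \<tau>. \<sigma> \<in> H \<and> \<tau> \<in> H}" by blast
  qed (auto simp: pt2_def PiE_iff)
qed

definition cochain1 :: "(('c \<Rightarrow> 'c) \<Rightarrow> int) \<Rightarrow> ((nat \<Rightarrow> ('c \<Rightarrow> 'c)) \<Rightarrow> int)" where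
  "cochain1 f = (\<lambda>x\<in>powers G 1. f (x 0))"

lemma cochain1_pt [simp]: "\<sigma> \<in> H \<Longrightarrow> cochain1 f (pt \<sigma>) = f \<sigma>"
  unfolding cochain1_def powers_1 by simp

lemma cochain1_cong: "(\<And>\<sigma>. \<sigma> \<in> H \<Longrightarrow> f \<sigma> = g \<sigma>) \<Longrightarrow> cochain1 f = cochain1 g"
  unfolding cochain1_def powers_1 by (auto intro!: restrict_ext)

lemma cochain1_eq_iff: "cochain1 f = cochain1 g \<longleftrightarrow> (\<forall>\<sigma>\<in>H. f \<sigma> = g \<sigma>)"
proof
  assume "cochain1 f = cochain1 g"
  then show "\<forall>\<sigma>\<in>H. f \<sigma> = g \<sigma>" using cochain1_pt[of _ f] cochain1_pt[of _ g] by simp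
qed (rule cochain1_cong, simp)

lemma eq_on_powers_1: "\<phi> \<in> extensional (powers G 1) \<Longrightarrow> \<phi> = cochain1 (\<lambda>\<sigma>. \<phi> (pt \<sigma>))"
proof (rule extensionalityI[of _ "powers G 1"])
  fix x assume x: "x \<in> powers G 1"
  then obtain \<sigma> where "x = pt \<sigma>" unfolding powers_1 by blast
  then show "\<phi> x = cochain1 (\<lambda>\<sigma>. \<phi> (pt \<sigma>)) x" using x unfolding cochain1_def by simp
qed (simp_all add: cochain1_def)

lemma cochains_1: "cochains p G T 1 = {cochain1 f | f. locally_constant f \<and> (\<forall>\<sigma>\<in>H. 0 \<le> f \<sigma> \<and> f \<sigma> < int p)}"
proof (rule Set.set_eqI, rule iffI)
  fix \<phi> assume \<phi>: "\<phi> \<in> cochains p G T 1"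
  have "continuous_map T (product_topology (\<lambda>_. T) {..<1}) pt"
    unfolding pt_def by (auto simp: continuous_map_componentwise)
  then have "continuous_map T (discrete_topology {0..<int p}) (\<phi> \<circ> pt)"
    by (rule continuous_map_compose) (use \<phi> in \<open>simp add: cochains_def\<close>)
  then have "(\<phi> \<circ> pt) ` H \<subseteq> {0..<int p}" "locally_constant (\<phi> \<circ> pt)"
    unfolding continuous_iff_locally_constant by auto
  moreover have "\<phi> = cochain1 (\<phi> \<circ> pt)" using eq_on_powers_1[of \<phi>] \<phi> by (simp add: cochains_def comp_def)
  ultimately show "\<phi> \<in> {cochain1 f | f. locally_constant f \<and> (\<forall>\<sigma>\<in>H. 0 \<le> f \<sigma> \<and> f \<sigma> < int p)}" by fastforce
next
  fix \<phi> assume "\<phi> \<in> {cochain1 f | f. locally_constant f \<and> (\<forall>\<sigma>\<in>H. 0 \<le> f \<sigma> \<and> f \<sigma> < int p)}"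
  then obtain f where f: "\<phi> = cochain1 f" "locally_constant f" "\<forall>\<sigma>\<in>H. 0 \<le> f \<sigma> \<and> f \<sigma> < int p" by blast
  then have "continuous_map T (discrete_topology {0..<int p}) f"
    unfolding continuous_iff_locally_constant by auto
  moreover have "continuous_map (product_topology (\<lambda>_. T) {..<1}) T (\<lambda>x. x (0::nat))"
    by (rule continuous_map_product_projection) simp
  ultimately have c: "continuous_map (product_topology (\<lambda>_. T) {..<1}) (discrete_topology {0..<int p}) (f \<circ> (\<lambda>x. x (0::nat)))"
    by (rule continuous_map_compose[rotated])
  have "continuous_map (product_topology (\<lambda>_. T) {..<1}) (discrete_topology {0..<int p}) (cochain1 f)"
    by (rule continuous_map_eq[OF c]) (auto simp: cochain1_def topspace_T)
  then show "\<phi> \<in> cochains p G T 1" unfolding cochains_def f(1) by (simp add: cochain1_def)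
qed

lemma coboundary_1:
  assumes "\<sigma> \<in> H" "\<tau> \<in> H"
  shows "coboundary p G 1 (cochain1 f) (pt2 \<sigma> \<tau>) = (f \<sigma> + f \<tau> - f (compose \<Omega> \<sigma> \<tau>)) mod int p"
proof -
  have "pt2 \<sigma> \<tau> \<in> powers G (1 + 1)" using powers_2 assms unfolding one_add_one by blast
  moreover have "face G 1 0 (pt2 \<sigma> \<tau>) = pt \<tau>" "face G 1 (Suc 0) (pt2 \<sigma> \<tau>) = pt (\<sigma> \<otimes>\<^bsub>G\<^esub> \<tau>)"
    "face G 1 (Suc (Suc 0)) (pt2 \<sigma> \<tau>) = pt \<sigma>"
    unfolding face_def pt_def by (auto intro!: restrict_ext simp: pt2_def)
  moreover have "{..1 + 1} = {0, Suc 0, Suc (Suc 0)}" by auto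
  ultimately show ?thesis using assms G_mult[OF assms] compose_mem[OF assms]
    unfolding coboundary_def by (simp add: algebra_simps)
qed

lemma coboundary_1_cochain: "coboundary p G 1 \<phi> \<in> extensional (powers G 2)"
  unfolding coboundary_def one_add_one by simp

lemma ext_powers_2:
  assumes "\<phi> \<in> extensional (powers G 2)" "\<psi> \<in> extensional (powers G 2)"
    "\<And>\<sigma> \<tau>. \<sigma> \<in> H \<Longrightarrow> \<tau> \<in> H \<Longrightarrow> \<phi> (pt2 \<sigma> \<tau>) = \<psi> (pt2 \<sigma> \<tau>)"
  shows "\<phi> = \<psi>"
proof (rule extensionalityI[OF assms(1,2)])
  fix x assume "x \<in> powers G 2"
  then obtain \<sigma> \<tau> where "x = pt2 \<sigma> \<tau>" "\<sigma> \<in> H" "\<tau> \<in> H" unfolding powers_2 by blast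
  then show "\<phi> x = \<psi> x" using assms(3) by simp
qed

lemma cocycles_1: "cocycles p G T 1 = {cochain1 f | f. locally_constant f \<and> (\<forall>\<sigma>\<in>H. 0 \<le> f \<sigma> \<and> f \<sigma> < int p) \<and>
   (\<forall>\<sigma>\<in>H. \<forall>\<tau>\<in>H. f (compose \<Omega> \<sigma> \<tau>) = (f \<sigma> + f \<tau>) mod int p)}"
proof -
  have "coboundary p G 1 (cochain1 f) = \<one>\<^bsub>cochain_group p G T (1 + 1)\<^esub> \<longleftrightarrow>
     (\<forall>\<sigma>\<in>H. \<forall>\<tau>\<in>H. f (compose \<Omega> \<sigma> \<tau>) = (f \<sigma> + f \<tau>) mod int p)"
    if f: "\<forall>\<sigma>\<in>H. 0 \<le> f \<sigma> \<and> f \<sigma> < int p" for f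
  proof -
    have one: "\<one>\<^bsub>cochain_group p G T (1 + 1)\<^esub> = (\<lambda>x\<in>powers G 2. 0)"
      unfolding cochain_group_def one_add_one by simp
    have "coboundary p G 1 (cochain1 f) = (\<lambda>x\<in>powers G 2. 0) \<longleftrightarrow>
      (\<forall>\<sigma>\<in>H. \<forall>\<tau>\<in>H. (f \<sigma> + f \<tau> - f (compose \<Omega> \<sigma> \<tau>)) mod int p = 0)" (is "?L = ?R \<longleftrightarrow> ?Q")
    proof
      assume e: "?L = ?R"
      show ?Q
      proof (intro ballI)
        fix \<sigma> \<tau> assume st: "\<sigma> \<in> H" "\<tau> \<in> H"
        then have "pt2 \<sigma> \<tau> \<in> powers G 2" using powers_2 by blast
        then show "(f \<sigma> + f \<tau> - f (compose \<Omega> \<sigma> \<tau>)) mod int p = 0"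
          using coboundary_1[OF st, of f] e by simp
      qed
    next
      assume q: ?Q
      show "?L = ?R"
      proof (rule ext_powers_2[OF coboundary_1_cochain])
        fix \<sigma> \<tau> assume st: "\<sigma> \<in> H" "\<tau> \<in> H"
        then have "pt2 \<sigma> \<tau> \<in> powers G 2" using powers_2 by blast
        then show "coboundary p G 1 (cochain1 f) (pt2 \<sigma> \<tau>) = (\<lambda>x\<in>powers G 2. 0) (pt2 \<sigma> \<tau>)"
          using coboundary_1[OF st, of f] q st by simp
      qed simp
    qed
    also have "\<dots> \<longleftrightarrow> (\<forall>\<sigma>\<in>H. \<forall>\<tau>\<in>H. f (compose \<Omega> \<sigma> \<tau>) = (f \<sigma> + f \<tau>) mod int p)"
    proof (intro ball_cong refl)
      fix \<sigma> \<tau> assume "\<sigma> \<in> H" "\<tau> \<in> H"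
      then have "f (compose \<Omega> \<sigma> \<tau>) mod int p = f (compose \<Omega> \<sigma> \<tau>)" using f compose_mem by simp
      then show "(f \<sigma> + f \<tau> - f (compose \<Omega> \<sigma> \<tau>)) mod int p = 0 \<longleftrightarrow> f (compose \<Omega> \<sigma> \<tau>) = (f \<sigma> + f \<tau>) mod int p"
        by (metis mod_eq_dvd_iff dvd_eq_mod_eq_0)
    qed
    finally show ?thesis unfolding one .
  qed
  then show ?thesis unfolding cocycles_def cochains_1 by blast
qed

text \<open>Both faces of a 1-tuple are the empty tuple, so with trivial coefficients the two terms
  of the coboundary cancel. Consequently classes of degree one are singletons.\<close>

lemma coboundaries_1: "coboundaries p G T 1 = {cochain1 (\<lambda>_. 0)}"
proof -
  have "coboundary p G 0 \<phi> = cochain1 (\<lambda>_. 0)" for \<phi>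
  proof -
    have "face G 0 i x = (\<lambda>_. undefined)" for i x by (auto simp: face_def)
    then show ?thesis unfolding coboundary_def cochain1_def by simp
  qed
  \<comment> \<open>One 0-cochain is exhibited, so that the image is the singleton and not the empty
    set.\<close>
  moreover have "(\<lambda>x\<in>powers G 0. 0) \<in> cochains p G T 0"
  proof -
    have "continuous_map (product_topology (\<lambda>_. T) {..<0::nat}) (discrete_topology {0..<int p}) (\<lambda>x. 0)"
      by simp
    then have "continuous_map (product_topology (\<lambda>_. T) {..<0::nat}) (discrete_topology {0..<int p}) (\<lambda>x\<in>powers G 0. 0)"
      by (rule continuous_map_eq) auto
    then show ?thesis by (simp add: cochains_def)
  qed
  ultimately have "coboundary p G 0 ` cochains p G T 0 = {cochain1 (\<lambda>_. 0)}" by auto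
  then show ?thesis unfolding coboundaries_def by simp
qed

lemma coboundaries_2: "coboundaries p G T 2 = coboundary p G 1 ` cochains p G T 1"
  by (simp add: coboundaries_def numeral_2_eq_2)

lemma cochain_group_1_mult:
  "cochain1 f \<otimes>\<^bsub>cochain_group p G T 1\<^esub> cochain1 g = cochain1 (\<lambda>\<sigma>. (f \<sigma> + g \<sigma>) mod int p)"
  unfolding cochain_group_def cochain1_def by (simp cong: restrict_cong)

lemma cochain_class_1:
  assumes "\<And>\<sigma>. \<sigma> \<in> H \<Longrightarrow> 0 \<le> f \<sigma> \<and> f \<sigma> < int p"
  shows "cochain_class p G T 1 (cochain1 f) = {cochain1 f}"
proof -
  have "cochain1 (\<lambda>_. 0) \<otimes>\<^bsub>cochain_group p G T 1\<^esub> cochain1 f = cochain1 f"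
    unfolding cochain_group_1_mult by (rule cochain1_cong) (use assms in simp)
  then show ?thesis unfolding coboundaries_1 r_coset_def by simp
qed

definition kappa :: "'c \<Rightarrow> ((nat \<Rightarrow> ('c \<Rightarrow> 'c)) \<Rightarrow> int)" where
  "kappa b = cochain1 (kummer_char b)"

text \<open>Cocycles of degree one with trivial coefficients are continuous homomorphisms, and
  surjectivity of the Kummer map presents each of them by an element b.\<close>

theorem carrier_cohomology_1: "carrier (cohomology p G T 1) = (\<lambda>b. {kappa b}) ` (fixed_field - {0})"
proof -
  have "carrier (cohomology p G T 1) = (\<lambda>\<phi>. coboundaries p G T 1 #>\<^bsub>cochain_group p G T 1\<^esub> \<phi>) ` cocycles p G T 1"
    unfolding cohomology_def by (auto simp: FactGroup_def RCOSETS_def r_coset_def)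
  also have "\<dots> = (\<lambda>\<phi>. {\<phi>}) ` cocycles p G T 1"
    by (rule image_cong[OF refl]) (use cocycles_1 cochain_class_1 in auto)
  also have "cocycles p G T 1 = kappa ` (fixed_field - {0})"
  proof
    show "cocycles p G T 1 \<subseteq> kappa ` (fixed_field - {0})"
    proof
      fix \<phi> assume "\<phi> \<in> cocycles p G T 1"
      then obtain f where f: "\<phi> = cochain1 f" "locally_constant f" "\<forall>\<sigma>\<in>H. 0 \<le> f \<sigma> \<and> f \<sigma> < int p"
        "\<forall>\<sigma>\<in>H. \<forall>\<tau>\<in>H. f (compose \<Omega> \<sigma> \<tau>) = (f \<sigma> + f \<tau>) mod int p" unfolding cocycles_1 by blast
      have "\<zeta> powi f (compose \<Omega> \<sigma> \<tau>) = \<zeta> powi f \<sigma> * \<zeta> powi f \<tau>" if "\<sigma> \<in> H" "\<tau> \<in> H" for \<sigma> \<tau>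
        using f(4) that by (simp add: zeta_powi_mod flip: zeta_powi_add)
      then obtain b where "b \<in> fixed_field" "b \<noteq> 0" "\<And>\<sigma>. \<sigma> \<in> H \<Longrightarrow> kummer_char b \<sigma> = f \<sigma>"
        by (rule kummer_char_surj[OF _ f(2)]) (use f(3) in auto)
      then show "\<phi> \<in> kappa ` (fixed_field - {0})" unfolding f(1) kappa_def
        by (intro image_eqI[of _ _ b]) (auto intro: cochain1_cong)
    qed
    show "kappa ` (fixed_field - {0}) \<subseteq> cocycles p G T 1"
      unfolding cocycles_1 kappa_def
      using locally_constant_kummer_char kummer_char_range kummer_char_compose by auto
  qed
  finally show ?thesis by (auto simp: image_image)
qed

lemma kappa_eq_iff:
  assumes "b \<in> fixed_field" "b \<noteq> 0" "c \<in> fixed_field" "c \<noteq> 0"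
  shows "kappa b = kappa c \<longleftrightarrow> (\<exists>d\<in>fixed_field - {0}. b = d ^ p * c)"
  unfolding kappa_def cochain1_eq_iff by (rule kummer_char_eq_iff[OF assms])

lemma kappa_mult:
  assumes "b \<in> fixed_field" "b \<noteq> 0" "c \<in> fixed_field" "c \<noteq> 0"
  shows "kappa b \<otimes>\<^bsub>cochain_group p G T 1\<^esub> kappa c = kappa (b * c)"
  unfolding kappa_def cochain_group_1_mult by (rule cochain1_cong) (simp add: kummer_char_mult[OF assms])

lemma mod_add_diff_eq: "(a mod m + b mod m - c mod m) mod m = (a + b - c) mod (m :: int)"
proof -
  have "(a mod m + b mod m - c mod m) mod m = ((a mod m + b mod m) mod m - c mod m) mod m"
    by (rule mod_diff_left_eq[symmetric])
  also have "\<dots> = ((a + b) mod m - c mod m) mod m" by (simp only: mod_add_eq)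
  also have "\<dots> = (a + b - c) mod m" by (rule mod_diff_eq)
  finally show ?thesis .
qed

lemma cochain_group_mult_apply:
  "x \<in> powers G n \<Longrightarrow> (\<phi> \<otimes>\<^bsub>cochain_group p G T n\<^esub> \<psi>) x = (\<phi> x + \<psi> x) mod int p"
  by (simp add: cochain_group_def)

lemma coboundary_add:
  "coboundary p G 1 (cochain1 f) \<otimes>\<^bsub>cochain_group p G T 2\<^esub> coboundary p G 1 (cochain1 g) =
   coboundary p G 1 (cochain1 (\<lambda>\<sigma>. (f \<sigma> + g \<sigma>) mod int p))"
proof (rule ext_powers_2[OF _ coboundary_1_cochain])
  fix \<sigma> \<tau> assume st: "\<sigma> \<in> H" "\<tau> \<in> H"
  then have "pt2 \<sigma> \<tau> \<in> powers G 2" using powers_2 by blast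
  then show "(coboundary p G 1 (cochain1 f) \<otimes>\<^bsub>cochain_group p G T 2\<^esub> coboundary p G 1 (cochain1 g)) (pt2 \<sigma> \<tau>) =
     coboundary p G 1 (cochain1 (\<lambda>\<sigma>. (f \<sigma> + g \<sigma>) mod int p)) (pt2 \<sigma> \<tau>)"
    unfolding cochain_group_mult_apply[OF \<open>pt2 \<sigma> \<tau> \<in> powers G 2\<close>] coboundary_1[OF st]
  proof -
    have "((a + b - c) mod m + (a' + b' - c') mod m) mod m =
        ((a + a') mod m + (b + b') mod m - (c + c') mod m) mod m" for a b c a' b' c' m :: int
    proof -
      have "((a + a') mod m + (b + b') mod m - (c + c') mod m) mod m = ((a + a') + (b + b') - (c + c')) mod m"
        by (rule mod_add_diff_eq)
      also have "(a + a') + (b + b') - (c + c') = (a + b - c) + (a' + b' - c')" by simp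
      finally show ?thesis by (simp only: mod_add_eq)
    qed
    then show "((f \<sigma> + f \<tau> - f (compose \<Omega> \<sigma> \<tau>)) mod int p + (g \<sigma> + g \<tau> - g (compose \<Omega> \<sigma> \<tau>)) mod int p) mod int p =
      ((f \<sigma> + g \<sigma>) mod int p + (f \<tau> + g \<tau>) mod int p - (f (compose \<Omega> \<sigma> \<tau>) + g (compose \<Omega> \<sigma> \<tau>)) mod int p) mod int p" .
  qed
qed (simp add: cochain_group_def)

lemma locally_constant_comp2:
  assumes "locally_constant f" "locally_constant g" shows "locally_constant (\<lambda>\<sigma>. h (f \<sigma>) (g \<sigma>))"
  unfolding locally_constant_def
proof
  fix \<sigma> assume s: "\<sigma> \<in> H"
  obtain F F' where F: "finite F" "F \<subseteq> \<Omega>" "\<And>\<tau>. \<tau> \<in> H \<Longrightarrow> (\<And>x. x \<in> F \<Longrightarrow> \<tau> x = \<sigma> x) \<Longrightarrow> f \<tau> = f \<sigma>"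
    "finite F'" "F' \<subseteq> \<Omega>" "\<And>\<tau>. \<tau> \<in> H \<Longrightarrow> (\<And>x. x \<in> F' \<Longrightarrow> \<tau> x = \<sigma> x) \<Longrightarrow> g \<tau> = g \<sigma>"
    using locally_constantD[OF assms(1) s] locally_constantD[OF assms(2) s] by metis
  show "\<exists>F. finite F \<and> F \<subseteq> \<Omega> \<and> (\<forall>\<tau>\<in>H. (\<forall>x\<in>F. \<tau> x = \<sigma> x) \<longrightarrow> h (f \<tau>) (g \<tau>) = h (f \<sigma>) (g \<sigma>))"
    by (intro exI[of _ "F \<union> F'"]) (use F in auto)
qed

lemma mod_cochain:
  assumes "locally_constant f" shows "cochain1 (\<lambda>\<sigma>. f \<sigma> mod int p) \<in> cochains p G T 1"
proof -
  have "locally_constant (\<lambda>\<sigma>. f \<sigma> mod int p)"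
    by (rule locally_constant_comp2[OF assms assms, of "\<lambda>a _. a mod int p"])
  moreover have "0 \<le> f \<sigma> mod int p \<and> f \<sigma> mod int p < int p" for \<sigma>
    using pos_mod_sign pos_mod_bound by simp
  ultimately show ?thesis unfolding cochains_1 by blast
qed

text \<open>A coset is the subgroup itself exactly when its representative lies in it. That c is
  reduced mod p ensures that adding the zero coboundary returns c.\<close>

lemma class_2_eq_one_iff:
  assumes c: "c \<in> extensional (powers G 2)" "\<And>x. x \<in> powers G 2 \<Longrightarrow> c x mod int p = c x"
  shows "cochain_class p G T 2 c = coboundaries p G T 2 \<longleftrightarrow> c \<in> coboundaries p G T 2"
proof
  assume e: "cochain_class p G T 2 c = coboundaries p G T 2"
  have 0: "coboundary p G 1 (cochain1 (\<lambda>_. 0)) \<in> coboundaries p G T 2"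
    unfolding coboundaries_2 using mod_cochain[of "\<lambda>_. 0"] by (auto simp: locally_constant_def)
  have "coboundary p G 1 (cochain1 (\<lambda>_. 0)) \<otimes>\<^bsub>cochain_group p G T 2\<^esub> c = c"
  proof (rule ext_powers_2[OF _ c(1)])
    fix \<sigma> \<tau> assume st: "\<sigma> \<in> H" "\<tau> \<in> H"
    then have "pt2 \<sigma> \<tau> \<in> powers G 2" using powers_2 by blast
    then show "(coboundary p G 1 (cochain1 (\<lambda>_. 0)) \<otimes>\<^bsub>cochain_group p G T 2\<^esub> c) (pt2 \<sigma> \<tau>) = c (pt2 \<sigma> \<tau>)"
      using c(2) unfolding cochain_group_mult_apply[OF \<open>pt2 \<sigma> \<tau> \<in> powers G 2\<close>] coboundary_1[OF st] by simp
  qed (simp add: cochain_group_def)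
  then have "c \<in> cochain_class p G T 2 c" unfolding r_coset_def by (intro UN_I[OF 0]) (simp only: singleton_iff)
  then show "c \<in> coboundaries p G T 2" using e by simp
next
  assume "c \<in> coboundaries p G T 2"
  then obtain f where f: "c = coboundary p G 1 (cochain1 f)" "locally_constant f"
    unfolding coboundaries_2 cochains_1 by auto
  show "cochain_class p G T 2 c = coboundaries p G T 2"
  proof
    show "cochain_class p G T 2 c \<subseteq> coboundaries p G T 2"
    proof
      fix d assume "d \<in> cochain_class p G T 2 c"
      then obtain g where g: "locally_constant g" "d = coboundary p G 1 (cochain1 g) \<otimes>\<^bsub>cochain_group p G T 2\<^esub> c"
        unfolding r_coset_def coboundaries_2 cochains_1 by blast
      show "d \<in> coboundaries p G T 2"
        unfolding g(2) f(1) coboundary_add coboundaries_2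
        by (intro imageI mod_cochain locally_constant_comp2[OF g(1) f(2)])
    qed
    show "coboundaries p G T 2 \<subseteq> cochain_class p G T 2 c"
    proof
      fix d assume "d \<in> coboundaries p G T 2"
      then obtain g where g: "d = coboundary p G 1 (cochain1 g)" "locally_constant g" "\<forall>\<sigma>\<in>H. 0 \<le> g \<sigma> \<and> g \<sigma> < int p"
        unfolding coboundaries_2 cochains_1 by auto
      let ?h = "\<lambda>\<sigma>. (g \<sigma> - f \<sigma>) mod int p"
      have "coboundary p G 1 (cochain1 ?h) \<in> coboundaries p G T 2"
        unfolding coboundaries_2 using mod_cochain[OF locally_constant_comp2[OF g(2) f(2), of "(-)"]] by blast
      moreover have "d = coboundary p G 1 (cochain1 ?h) \<otimes>\<^bsub>cochain_group p G T 2\<^esub> c"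
        unfolding f(1) coboundary_add g(1)
        by (intro arg_cong[of _ _ "coboundary p G 1"] cochain1_cong) (use g(3) in \<open>auto simp: mod_simps\<close>)
      ultimately show "d \<in> cochain_class p G T 2 c" unfolding r_coset_def by (intro UN_I) auto
    qed
  qed
qed

lemma cup_eq_one_iff:
  assumes b: "b \<in> fixed_field" "b \<noteq> 0" and a: "a \<in> fixed_field" "a \<noteq> 0"
  shows "cup p G T 1 1 {kappa b} {kappa a} = \<one>\<^bsub>cohomology p G T 2\<^esub> \<longleftrightarrow> cup_trivial b a"
proof -
  define c where "c = cochain_cup p G 1 1 (kappa b) (kappa a)"
  have ext: "c \<in> extensional (powers G 2)" unfolding c_def cochain_cup_def one_add_one by simp
  have c: "c (pt2 \<sigma> \<tau>) = (kummer_char b \<sigma> * kummer_char a \<tau>) mod int p" if st: "\<sigma> \<in> H" "\<tau> \<in> H" for \<sigma> \<tau>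
  proof -
    have "pt2 \<sigma> \<tau> \<in> powers G 2" using powers_2 st by blast
    moreover have "restrict (pt2 \<sigma> \<tau>) {..<1} = pt \<sigma>" "(\<lambda>i\<in>{..<1}. pt2 \<sigma> \<tau> (1 + i)) = pt \<tau>"
      unfolding pt_def by (auto intro!: restrict_ext)
    ultimately show ?thesis unfolding c_def cochain_cup_def one_add_one kappa_def
      using st by simp
  qed
  have cmod: "c x mod int p = c x" if "x \<in> powers G 2" for x
    using that c unfolding powers_2 by auto
  have "cup p G T 1 1 {kappa b} {kappa a} = cochain_class p G T 2 c"
    unfolding cup_def c_def one_add_one by simp
  moreover have "\<one>\<^bsub>cohomology p G T 2\<^esub> = coboundaries p G T 2" by (simp add: cohomology_def)
  moreover have "c \<in> coboundaries p G T 2 \<longleftrightarrow> cup_trivial b a"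
  proof
    assume "c \<in> coboundaries p G T 2"
    then obtain f where f: "c = coboundary p G 1 (cochain1 f)" "locally_constant f"
      unfolding coboundaries_2 cochains_1 by auto
    have "\<zeta> powi (kummer_char b \<sigma> * kummer_char a \<tau>) = \<zeta> powi (f \<sigma> + f \<tau> - f (compose \<Omega> \<sigma> \<tau>))"
      if st: "\<sigma> \<in> H" "\<tau> \<in> H" for \<sigma> \<tau>
      unfolding zeta_powi_eq_iff using c[OF st] coboundary_1[OF st, of f] f(1) by simp
    then show "cup_trivial b a" unfolding cup_trivial_def using f(2) by blast
  next
    assume "cup_trivial b a"
    then obtain f where f: "locally_constant f" "\<And>\<sigma> \<tau>. \<sigma> \<in> H \<Longrightarrow> \<tau> \<in> H \<Longrightarrow>
       \<zeta> powi (kummer_char b \<sigma> * kummer_char a \<tau>) = \<zeta> powi (f \<sigma> + f \<tau> - f (compose \<Omega> \<sigma> \<tau>))"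
      unfolding cup_trivial_def by blast
    have "c = coboundary p G 1 (cochain1 (\<lambda>\<sigma>. f \<sigma> mod int p))"
    proof (rule ext_powers_2[OF ext coboundary_1_cochain])
      fix \<sigma> \<tau> assume st: "\<sigma> \<in> H" "\<tau> \<in> H"
      show "c (pt2 \<sigma> \<tau>) = coboundary p G 1 (cochain1 (\<lambda>\<sigma>. f \<sigma> mod int p)) (pt2 \<sigma> \<tau>)"
        unfolding c[OF st] coboundary_1[OF st] using f(2)[OF st] unfolding zeta_powi_eq_iff
        by (simp only: mod_add_diff_eq)
    qed
    then show "c \<in> coboundaries p G T 2" unfolding coboundaries_2 using mod_cochain[OF f(1)] by blast
  qed
  ultimately show ?thesis using class_2_eq_one_iff[OF ext cmod] by simp
qed

section \<open>The radical of the group and the isomorphism of radicals\<close>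

theorem group_radical_eq: "group_radical p G T = (\<lambda>b. {kappa b}) ` p_radical p fixed_field"
proof -
  have rad: "b \<in> p_radical p fixed_field \<longleftrightarrow> (\<forall>a\<in>fixed_field - {0}. cup_trivial b a)"
    if b: "b \<in> fixed_field - {0}" for b
  proof
    assume r: "b \<in> p_radical p fixed_field"
    show "\<forall>a\<in>fixed_field - {0}. cup_trivial b a"
    proof
      fix a assume a: "a \<in> fixed_field - {0}"
      obtain \<alpha> where \<alpha>: "\<alpha> ^ p = a" using nth_root_exists[OF p_gt_0] by blast
      then have "\<alpha> \<noteq> 0" using a by (auto simp: power_0_left)
      moreover have "b \<in> field_norm fixed_field (adjoin fixed_field \<alpha>) ` (adjoin fixed_field \<alpha> - {0})"
        using r a \<alpha> unfolding p_radical_def by blast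
      ultimately show "cup_trivial b a" using cup_trivial_iff_norm[of b \<alpha>] a b \<alpha> by auto
    qed
  next
    assume c: "\<forall>a\<in>fixed_field - {0}. cup_trivial b a"
    show "b \<in> p_radical p fixed_field"
      unfolding p_radical_def
    proof (intro CollectI conjI ballI allI impI)
      fix a \<alpha> assume a: "a \<in> fixed_field - {0}" and \<alpha>: "\<alpha> ^ p = a"
      then have "\<alpha> \<noteq> 0" by (auto simp: power_0_left)
      then show "b \<in> field_norm fixed_field (adjoin fixed_field \<alpha>) ` (adjoin fixed_field \<alpha> - {0})"
        using cup_trivial_iff_norm[of b \<alpha>] a b \<alpha> c by auto
    qed (rule b)
  qed
  have "{kappa b} \<in> group_radical p G T \<longleftrightarrow> b \<in> p_radical p fixed_field" if b: "b \<in> fixed_field - {0}" for b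
    unfolding rad[OF b] group_radical_def carrier_cohomology_1 using cup_eq_one_iff[of b] b by auto
  moreover have "group_radical p G T \<subseteq> (\<lambda>b. {kappa b}) ` (fixed_field - {0})"
    unfolding group_radical_def carrier_cohomology_1 by blast
  moreover have "p_radical p fixed_field \<subseteq> fixed_field - {0}" by (auto simp: p_radical_def)
  ultimately show ?thesis by blast
qed

text \<open>The isomorphism is the direct image under \<open>kappa\<close>: on a coset of p-th
  powers \<open>kappa\<close> is constant, so the image is a singleton class. In this form
  multiplicativity is a comparison of set products.\<close>

theorem radical_iso:
  assumes R: "R \<subseteq> fixed_field - {0}" and rad: "group_radical p G T = (\<lambda>b. {kappa b}) ` R"
  shows "mod_powers p fixed_field R \<cong> (cohomology p G T 1)\<lparr>carrier := group_radical p G T\<rparr>"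
proof -
  define N where "N = (\<lambda>x. x ^ p) ` (fixed_field - {0})"
  define A where "A = (Multiplicative_Group.mult_of (field_on fixed_field))\<lparr>carrier := R\<rparr>"
  have Am [simp]: "x \<otimes>\<^bsub>A\<^esub> y = x * y" for x y by (simp add: A_def)
  have mp: "mod_powers p fixed_field R = A Mod N" by (simp add: mod_powers_def A_def N_def)
  have carr: "carrier (A Mod N) = (\<lambda>b. N #>\<^bsub>A\<^esub> b) ` R" by (auto simp: FactGroup_def RCOSETS_def A_def)
  have coset: "N #>\<^bsub>A\<^esub> b = (\<lambda>d. d ^ p * b) ` (fixed_field - {0})" for b by (auto simp: r_coset_def N_def)
  have cosetK: "N #>\<^bsub>A\<^esub> b \<subseteq> fixed_field - {0}" if "b \<in> fixed_field - {0}" for b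
    unfolding coset using that by (auto intro!: is_subfield_closed[OF subfield_fixed])
  have self: "b \<in> N #>\<^bsub>A\<^esub> b" for b
    unfolding coset using is_subfield_1[OF subfield_fixed] by (intro image_eqI[of _ _ 1]) auto
  have img: "kappa ` (N #>\<^bsub>A\<^esub> b) = {kappa b}" if b: "b \<in> fixed_field - {0}" for b
  proof -
    have "kappa c = kappa b" if "c \<in> N #>\<^bsub>A\<^esub> b" for c
      using kappa_eq_iff[of c b] cosetK[OF b] that b unfolding coset by auto
    then have "kappa ` (N #>\<^bsub>A\<^esub> b) \<subseteq> {kappa b}" by blast
    moreover have "kappa b \<in> kappa ` (N #>\<^bsub>A\<^esub> b)" using self by (rule imageI)
    ultimately show ?thesis by blast
  qed
  define h where "h C = kappa ` C" for C
  have "h \<in> hom (A Mod N) ((cohomology p G T 1)\<lparr>carrier := group_radical p G T\<rparr>)"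
  proof (rule homI)
    fix C assume "C \<in> carrier (A Mod N)"
    then obtain b where b: "b \<in> R" "C = N #>\<^bsub>A\<^esub> b" unfolding carr by blast
    then have "h C = {kappa b}" unfolding h_def b(2) using R by (intro img) auto
    then show "h C \<in> carrier ((cohomology p G T 1)\<lparr>carrier := group_radical p G T\<rparr>)" using b(1) rad by auto
  next
    fix C D assume CD: "C \<in> carrier (A Mod N)" "D \<in> carrier (A Mod N)"
    then have sub: "C \<subseteq> fixed_field - {0}" "D \<subseteq> fixed_field - {0}" unfolding carr using cosetK R by blast+
    have "h (C <#>\<^bsub>A\<^esub> D) = h C <#>\<^bsub>cochain_group p G T 1\<^esub> h D"
    proof -
      have "h (C <#>\<^bsub>A\<^esub> D) = (\<Union>c\<in>C. \<Union>d\<in>D. {kappa (c * d)})" by (auto simp: h_def set_mult_def)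
      also have "\<dots> = (\<Union>c\<in>C. \<Union>d\<in>D. {kappa c \<otimes>\<^bsub>cochain_group p G T 1\<^esub> kappa d})"
        using sub by (intro SUP_cong refl) (subst kappa_mult, auto)
      also have "\<dots> = h C <#>\<^bsub>cochain_group p G T 1\<^esub> h D" by (auto simp: h_def set_mult_def)
      finally show ?thesis .
    qed
    then show "h (C \<otimes>\<^bsub>A Mod N\<^esub> D) = h C \<otimes>\<^bsub>(cohomology p G T 1)\<lparr>carrier := group_radical p G T\<rparr>\<^esub> h D"
      by (simp add: cohomology_def FactGroup_def set_mult_def)
  qed
  moreover have "bij_betw h (carrier (A Mod N)) (group_radical p G T)"
    unfolding bij_betw_def
  proof
    show "inj_on h (carrier (A Mod N))"
    proof (rule inj_onI)
      fix C D assume CD: "C \<in> carrier (A Mod N)" "D \<in> carrier (A Mod N)" "h C = h D"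
      then obtain b c where bc: "b \<in> R" "C = N #>\<^bsub>A\<^esub> b" "c \<in> R" "D = N #>\<^bsub>A\<^esub> c" unfolding carr by blast
      then have m: "b \<in> fixed_field - {0}" "c \<in> fixed_field - {0}" using R by auto
      have "kappa b = kappa c" using CD(3) img m unfolding h_def bc by simp
      then obtain d where d: "d \<in> fixed_field - {0}" "b = d ^ p * c" using kappa_eq_iff m by auto
      show "C = D" unfolding bc coset
      proof
        show "(\<lambda>d. d ^ p * b) ` (fixed_field - {0}) \<subseteq> (\<lambda>d. d ^ p * c) ` (fixed_field - {0})"
        proof
          fix x assume "x \<in> (\<lambda>d. d ^ p * b) ` (fixed_field - {0})"
          then obtain e where "e \<in> fixed_field - {0}" "x = e ^ p * b" by blast
          then show "x \<in> (\<lambda>d. d ^ p * c) ` (fixed_field - {0})" using d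
            by (intro image_eqI[of _ _ "e * d"]) (auto simp: power_mult_distrib is_subfield_mult[OF subfield_fixed])
        qed
        show "(\<lambda>d. d ^ p * c) ` (fixed_field - {0}) \<subseteq> (\<lambda>d. d ^ p * b) ` (fixed_field - {0})"
        proof
          fix x assume "x \<in> (\<lambda>d. d ^ p * c) ` (fixed_field - {0})"
          then obtain e where "e \<in> fixed_field - {0}" "x = e ^ p * c" by blast
          then show "x \<in> (\<lambda>d. d ^ p * b) ` (fixed_field - {0})" using d
            by (intro image_eqI[of _ _ "e / d"]) (auto simp: power_divide is_subfield_divide[OF subfield_fixed])
        qed
      qed
    qed
    show "h ` carrier (A Mod N) = group_radical p G T"
      unfolding carr rad image_image
    proof (rule image_cong[OF refl])
      fix b assume "b \<in> R"
      then show "h (N #>\<^bsub>A\<^esub> b) = {kappa b}" unfolding h_def using R by (intro img) auto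
    qed
  qed
  ultimately show ?thesis unfolding mp is_iso_def iso_def by auto
qed

end

section \<open>The absolute Galois group\<close>

context
  fixes K :: "'c::alg_closed_field set"
  assumes K: "is_subfield K"
begin

lemma subfield_separable_closure: "is_subfield (separable_closure K)"
  using subfield_sep_gen[OF K] unfolding sep_gen_eq[OF K] .

lemma carrier_absolute_galois_group:
  "carrier (absolute_galois_group K) = {\<sigma> \<in> Bij (separable_closure K).
     field_embedding (separable_closure K) \<sigma> \<and> (\<forall>x\<in>K. \<sigma> x = x)}"
  unfolding absolute_galois_group_def
  by (auto simp: Ring.ring_hom_def field_embedding_def Bij_imp_funcset[THEN funcset_mem])

text \<open>An embedding over K is automatically onto the separable closure; restriction only makes
  it extensional, as elements of \<open>Bij\<close> are.\<close>

lemma restrict_emb_mem: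
  assumes "field_embedding (separable_closure K) \<phi>" "\<And>y. y \<in> K \<Longrightarrow> \<phi> y = y"
  shows "restrict \<phi> (separable_closure K) \<in> carrier (absolute_galois_group K)"
proof -
  note S = subfield_separable_closure
  have "\<phi> ` separable_closure K = separable_closure K"
    using emb_sep_gen_onto[OF K, of \<phi>] assms unfolding sep_gen_eq[OF K] by blast
  moreover have "inj_on \<phi> (separable_closure K)" using emb_eq_iff[OF S assms(1)] by (auto simp: inj_on_def)
  ultimately have "restrict \<phi> (separable_closure K) \<in> Bij (separable_closure K)"
    by (simp add: Bij_def bij_betw_def inj_on_def)
  moreover have "field_embedding (separable_closure K) (restrict \<phi> (separable_closure K))"
    by (rule field_embedding_cong[OF assms(1) S]) simp
  moreover have "K \<subseteq> separable_closure K" using sep_gen_incl(1)[OF K] unfolding sep_gen_eq[OF K] .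
  ultimately show ?thesis unfolding carrier_absolute_galois_group using assms(2) by auto
qed

theorem krull_group_absolute_galois_group:
  assumes p: "Factorial_Ring.prime p" and zeta: "primitive_root_of_unity p \<zeta>" "\<zeta> \<in> K"
  shows "krull_group p \<zeta> (separable_closure K) (carrier (absolute_galois_group K)) (krull_topology K)"
proof (intro krull_group.intro automorphism_group.intro root_of_unity.intro
    automorphism_group_axioms.intro krull_group_axioms.intro)
  note S = subfield_separable_closure
  let ?H = "carrier (absolute_galois_group K)" and ?S = "separable_closure K"
  have KS: "K \<subseteq> ?S" using sep_gen_incl(1)[OF K] unfolding sep_gen_eq[OF K] .
  show "is_subfield ?S" by (rule S)
  fix \<sigma> assume s: "\<sigma> \<in> ?H"
  then have sB: "\<sigma> \<in> Bij ?S" and se: "field_embedding ?S \<sigma>" and sK: "\<And>x. x \<in> K \<Longrightarrow> \<sigma> x = x"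
    unfolding carrier_absolute_galois_group by auto
  show "\<sigma> \<in> Bij ?S" "field_embedding ?S \<sigma>" by fact+
  show "\<sigma> \<zeta> = \<zeta>" using sK zeta(2) .
  have sS: "\<sigma> x \<in> ?S" if "x \<in> ?S" for x using sB that Bij_imp_funcset by blast
  show "restrict (inv_into ?S \<sigma>) ?S \<in> ?H"
  proof -
    have img: "\<sigma> ` ?S = ?S" and inj: "inj_on \<sigma> ?S" using sB by (auto simp: Bij_def bij_betw_def)
    have l: "inv_into ?S \<sigma> (\<sigma> x) = x" if "x \<in> ?S" for x using inj that by simp
    have "field_embedding ?S (inv_into ?S \<sigma>)"
      unfolding field_embedding_def
    proof (intro conjI ballI)
      show "inv_into ?S \<sigma> 1 = 1" using l[OF is_subfield_1[OF S]] emb_1[OF S se] by simp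
      fix x y assume "x \<in> ?S" "y \<in> ?S"
      then obtain u v where uv: "u \<in> ?S" "v \<in> ?S" "x = \<sigma> u" "y = \<sigma> v" using img by (metis imageE)
      then show "inv_into ?S \<sigma> (x + y) = inv_into ?S \<sigma> x + inv_into ?S \<sigma> y"
        using l[OF is_subfield_add[OF S uv(1,2)]] emb_add[OF S se uv(1,2)] l by simp
      show "inv_into ?S \<sigma> (x * y) = inv_into ?S \<sigma> x * inv_into ?S \<sigma> y"
        using l[OF is_subfield_mult[OF S uv(1,2)]] emb_mult[OF S se uv(1,2)] l uv by simp
    qed
    moreover have "inv_into ?S \<sigma> y = y" if "y \<in> K" for y using l[of y] sK[OF that] that KS by auto
    ultimately show ?thesis by (rule restrict_emb_mem)
  qed
  fix \<tau> assume t: "\<tau> \<in> ?H"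
  show "compose ?S \<sigma> \<tau> \<in> ?H"
  proof -
    have te: "field_embedding ?S \<tau>" and tK: "\<And>x. x \<in> K \<Longrightarrow> \<tau> x = x" and tB: "\<tau> \<in> Bij ?S"
      using t unfolding carrier_absolute_galois_group by auto
    have tS: "\<tau> x \<in> ?S" if "x \<in> ?S" for x using tB that Bij_imp_funcset by blast
    have "field_embedding ?S (\<lambda>x. \<sigma> (\<tau> x))"
      unfolding field_embedding_def
      using emb_1[OF S se] emb_1[OF S te] emb_add[OF S se] emb_add[OF S te] emb_mult[OF S se] emb_mult[OF S te] tS
      by simp
    then have "restrict (\<lambda>x. \<sigma> (\<tau> x)) ?S \<in> ?H" by (rule restrict_emb_mem) (simp add: sK tK)
    then show ?thesis by (simp add: compose_def)
  qed
next
  let ?H = "carrier (absolute_galois_group K)" and ?S = "separable_closure K"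
  have "field_embedding ?S (\<lambda>x. x)" by (simp add: field_embedding_def)
  then show "(\<lambda>x\<in>?S. x) \<in> ?H" by (rule restrict_emb_mem) simp
next
  let ?H = "carrier (absolute_galois_group K)" and ?S = "separable_closure K"
  fix x assume "x \<in> ?S"
  then have "finite {\<phi> x | \<phi>. field_embedding ?S \<phi> \<and> (\<forall>y\<in>K. \<phi> y = y)}"
    using finite_emb_orbit[OF K, of x] unfolding sep_gen_eq[OF K] by simp
  then show "finite {\<sigma> x | \<sigma>. \<sigma> \<in> ?H}"
    by (rule finite_subset[rotated]) (auto simp: carrier_absolute_galois_group)
next
  fix x assume "x ^ p \<in> separable_closure K"
  then show "x \<in> separable_closure K"
    using sep_gen_root_closed[OF K of_nat_neq_0_of_primitive_root[OF p zeta(1)], of x] unfolding sep_gen_eq[OF K] by simp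
next
  fix U show "openin (krull_topology K) U \<longleftrightarrow> U \<subseteq> carrier (absolute_galois_group K) \<and>
    (\<forall>\<sigma>\<in>U. \<exists>F. finite F \<and> F \<subseteq> separable_closure K \<and>
      {\<tau> \<in> carrier (absolute_galois_group K). \<forall>x\<in>F. \<tau> x = \<sigma> x} \<subseteq> U)"
    unfolding openin_krull_topology krull_open_def ..
qed (rule p zeta)+

text \<open>Every separable element outside K is moved by an embedding, whose restriction is an
  element of the Galois group. This identifies the fixed field of the abstract development with
  K.\<close>

theorem fixed_field_absolute_galois_group:
  "{x \<in> separable_closure K. \<forall>\<sigma>\<in>carrier (absolute_galois_group K). \<sigma> x = x} = K"
proof
  have KS: "K \<subseteq> separable_closure K" using sep_gen_incl(1)[OF K] unfolding sep_gen_eq[OF K] .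
  show "K \<subseteq> {x \<in> separable_closure K. \<forall>\<sigma>\<in>carrier (absolute_galois_group K). \<sigma> x = x}"
    using KS by (auto simp: carrier_absolute_galois_group)
  show "{x \<in> separable_closure K. \<forall>\<sigma>\<in>carrier (absolute_galois_group K). \<sigma> x = x} \<subseteq> K"
  proof
    fix x assume x: "x \<in> {x \<in> separable_closure K. \<forall>\<sigma>\<in>carrier (absolute_galois_group K). \<sigma> x = x}"
    then have xS: "x \<in> separable_closure K" by simp
    show "x \<in> K"
    proof (rule ccontr)
      assume nK: "x \<notin> K"
      obtain \<phi> where \<phi>: "field_embedding (separable_closure K) \<phi>" "\<And>y. y \<in> K \<Longrightarrow> \<phi> y = y" "\<phi> x \<noteq> x"
        by (rule exists_moving_embedding[OF K, unfolded sep_gen_eq[OF K], OF xS nK]) blast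
      then have "restrict \<phi> (separable_closure K) \<in> carrier (absolute_galois_group K)" by (intro restrict_emb_mem)
      then show False using x \<phi>(3) by auto
    qed
  qed
qed

end

section \<open>Corestriction\<close>

context automorphism_group
begin

lemma subgroup_H: "subgroup H (BijGroup \<Omega>)"
proof (rule group.subgroupI[OF group_BijGroup])
  show "H \<noteq> {}" using id_mem by blast
  fix \<sigma> assume s: "\<sigma> \<in> H"
  show "inv\<^bsub>BijGroup \<Omega>\<^esub> \<sigma> \<in> H" using inv_BijGroup[OF Bij[OF s]] inv_mem[OF s] by simp
  fix \<tau> assume "\<tau> \<in> H"
  then show "\<sigma> \<otimes>\<^bsub>BijGroup \<Omega>\<^esub> \<tau> \<in> H" using s compose_mem Bij by (simp add: BijGroup_def)
qed (simp add: BijGroup_def Bij subset_iff)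

lemma group_G: "Group.group ((BijGroup \<Omega>)\<lparr>carrier := H\<rparr>)"
  by (rule subgroup.subgroup_is_group[OF subgroup_H group_BijGroup])

lemma inv_G: "\<sigma> \<in> H \<Longrightarrow> inv\<^bsub>(BijGroup \<Omega>)\<lparr>carrier := H\<rparr>\<^esub> \<sigma> = inverse_aut \<sigma>"
  by (simp add: group.m_inv_consistent[OF group_BijGroup subgroup_H] inv_BijGroup[OF Bij] inverse_aut_def)

end

locale krull_kummer = krull_group p \<zeta> \<Omega> H T + kummer_extension p \<zeta> \<Omega> H \<alpha>
  for p and \<zeta> :: "'c::alg_closed_field" and \<Omega> H T \<alpha>
begin

abbreviation Ust :: "('c \<Rightarrow> 'c) set" where
  "Ust \<equiv> root_stabilizer \<alpha>"

lemma openin_stabilizer: "openin T Ust"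
  unfolding openin_T
proof (intro conjI ballI)
  fix \<sigma> assume "\<sigma> \<in> Ust"
  then show "\<exists>F. finite F \<and> F \<subseteq> \<Omega> \<and> {\<tau> \<in> H. \<forall>x\<in>F. \<tau> x = \<sigma> x} \<subseteq> Ust"
    using alpha_mem by (intro exI[of _ "{\<alpha>}"]) (auto simp: root_stabilizer_def)
qed (rule stabilizer_subset)

sublocale UK: krull_group p \<zeta> \<Omega> "root_stabilizer \<alpha>" "subtopology T (root_stabilizer \<alpha>)"
proof
  fix S
  have "openin (subtopology T Ust) S \<longleftrightarrow> openin T S \<and> S \<subseteq> Ust"
    by (rule openin_open_subtopology[OF openin_stabilizer])
  also have "\<dots> \<longleftrightarrow> S \<subseteq> Ust \<and> (\<forall>\<sigma>\<in>S. \<exists>F. finite F \<and> F \<subseteq> \<Omega> \<and> {\<tau> \<in> Ust. \<forall>x\<in>F. \<tau> x = \<sigma> x} \<subseteq> S)"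
  proof
    assume S: "openin T S \<and> S \<subseteq> Ust"
    show "S \<subseteq> Ust \<and> (\<forall>\<sigma>\<in>S. \<exists>F. finite F \<and> F \<subseteq> \<Omega> \<and> {\<tau> \<in> Ust. \<forall>x\<in>F. \<tau> x = \<sigma> x} \<subseteq> S)"
    proof (intro conjI ballI)
      fix \<sigma> assume "\<sigma> \<in> S"
      then obtain F where "finite F" "F \<subseteq> \<Omega>" "{\<tau> \<in> H. \<forall>x\<in>F. \<tau> x = \<sigma> x} \<subseteq> S"
        using S unfolding openin_T by blast
      moreover have "{\<tau> \<in> Ust. \<forall>x\<in>F. \<tau> x = \<sigma> x} \<subseteq> {\<tau> \<in> H. \<forall>x\<in>F. \<tau> x = \<sigma> x}"
        using stabilizer_subset by blast
      ultimately show "\<exists>F. finite F \<and> F \<subseteq> \<Omega> \<and> {\<tau> \<in> Ust. \<forall>x\<in>F. \<tau> x = \<sigma> x} \<subseteq> S" by blast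
    qed (use S in blast)
  next
    assume S: "S \<subseteq> Ust \<and> (\<forall>\<sigma>\<in>S. \<exists>F. finite F \<and> F \<subseteq> \<Omega> \<and> {\<tau> \<in> Ust. \<forall>x\<in>F. \<tau> x = \<sigma> x} \<subseteq> S)"
    have "openin T S"
      unfolding openin_T
    proof (intro conjI ballI)
      show "S \<subseteq> H" using S stabilizer_subset by blast
      fix \<sigma> assume s: "\<sigma> \<in> S"
      then obtain F where F: "finite F" "F \<subseteq> \<Omega>" "{\<tau> \<in> Ust. \<forall>x\<in>F. \<tau> x = \<sigma> x} \<subseteq> S" using S by blast
      have "\<sigma> \<alpha> = \<alpha>" using s S by (auto simp: root_stabilizer_def)
      \<comment> \<open>Adding \<alpha> to F forces \<tau> into the stabilizer, so a neighbourhood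
        in the stabilizer is one in the whole group.\<close>
      then show "\<exists>F. finite F \<and> F \<subseteq> \<Omega> \<and> {\<tau> \<in> H. \<forall>x\<in>F. \<tau> x = \<sigma> x} \<subseteq> S"
        using F alpha_mem by (intro exI[of _ "insert \<alpha> F"]) (auto simp: root_stabilizer_def)
    qed
    then show "openin T S \<and> S \<subseteq> Ust" using S by blast
  qed
  finally show "openin (subtopology T Ust) S \<longleftrightarrow> S \<subseteq> Ust \<and>
    (\<forall>\<sigma>\<in>S. \<exists>F. finite F \<and> F \<subseteq> \<Omega> \<and> {\<tau> \<in> Ust. \<forall>x\<in>F. \<tau> x = \<sigma> x} \<subseteq> S)" .
qed

lemma a_char_inverse: "\<sigma> \<in> H \<Longrightarrow> a_char (inverse_aut \<sigma>) = (- a_char \<sigma>) mod int p"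
proof -
  assume s: "\<sigma> \<in> H"
  have "compose \<Omega> \<sigma> (inverse_aut \<sigma>) = (\<lambda>x\<in>\<Omega>. x)"
    using inverse_aut(1)[OF s] by (auto simp: compose_def)
  moreover have "a_char (\<lambda>x\<in>\<Omega>. x) = 0" using stabilizer_iff_kummer_char[OF id_mem] U.id_mem by simp
  ultimately have "(a_char \<sigma> + a_char (inverse_aut \<sigma>)) mod int p = 0"
    using a_char_compose[OF s inverse_aut_mem[OF s]] by simp
  then have "int p dvd a_char (inverse_aut \<sigma>) - (- a_char \<sigma>)" by (simp add: dvd_eq_mod_eq_0 add.commute)
  then have "a_char (inverse_aut \<sigma>) mod int p = (- a_char \<sigma>) mod int p" by (simp add: mod_eq_dvd_iff)
  then show ?thesis using a_char_range[OF inverse_aut_mem[OF s]] by simp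
qed

text \<open>The fibres of the character, which turn out to be the cosets of the stabilizer. Sums
  over cosets thus become sums over residues, on which right multiplication acts by shifts.\<close>

definition char_coset :: "int \<Rightarrow> ('c \<Rightarrow> 'c) set" where
  "char_coset k = {\<sigma> \<in> H. a_char \<sigma> = k}"

lemma coset_stabilizer: assumes s: "\<sigma> \<in> H" shows "Ust #>\<^bsub>G\<^esub> \<sigma> = char_coset (a_char \<sigma>)"
proof
  show "Ust #>\<^bsub>G\<^esub> \<sigma> \<subseteq> char_coset (a_char \<sigma>)"
  proof
    fix \<tau> assume "\<tau> \<in> Ust #>\<^bsub>G\<^esub> \<sigma>"
    then obtain u where u: "u \<in> Ust" "\<tau> = u \<otimes>\<^bsub>G\<^esub> \<sigma>" unfolding r_coset_def by blast
    then have "u \<in> H" "a_char u = 0" using stabilizer_subset stabilizer_iff_kummer_char by auto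
    then show "\<tau> \<in> char_coset (a_char \<sigma>)"
      using u(2) G_mult[OF \<open>u \<in> H\<close> s] a_char_compose[OF \<open>u \<in> H\<close> s] compose_mem[OF \<open>u \<in> H\<close> s] a_char_range[OF s]
      by (simp add: char_coset_def)
  qed
  show "char_coset (a_char \<sigma>) \<subseteq> Ust #>\<^bsub>G\<^esub> \<sigma>"
  proof
    fix \<tau> assume "\<tau> \<in> char_coset (a_char \<sigma>)"
    then have t: "\<tau> \<in> H" "a_char \<tau> = a_char \<sigma>" by (auto simp: char_coset_def)
    define u where "u = compose \<Omega> \<tau> (inverse_aut \<sigma>)"
    have uH: "u \<in> H" unfolding u_def by (intro compose_mem inverse_aut_mem t s)
    have "a_char u = (a_char \<tau> + (- a_char \<sigma>) mod int p) mod int p"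
      unfolding u_def using a_char_compose[OF t(1) inverse_aut_mem[OF s]] a_char_inverse[OF s] by simp
    then have "a_char u = 0" using t(2) by (simp add: mod_add_right_eq)
    then have "u \<in> Ust" using uH stabilizer_iff_kummer_char by simp
    moreover have "\<tau> = u \<otimes>\<^bsub>G\<^esub> \<sigma>"
      unfolding G_mult[OF uH s]
      by (rule aut_ext[OF t(1) compose_mem[OF uH s]])
        (use inverse_aut(2)[OF s] aut_mem[OF s] in \<open>auto simp: u_def compose_def\<close>)
    ultimately show "\<tau> \<in> Ust #>\<^bsub>G\<^esub> \<sigma>" unfolding r_coset_def by (intro UN_I) auto
  qed
qed

lemma char_coset_nonempty: "k \<in> {0..<int p} \<Longrightarrow> \<exists>\<sigma>\<in>H. a_char \<sigma> = k"
  using kummer_char_aut_pow[OF alpha_pow alpha_pow_neq_0 gen_mem, of "nat k"] kummer_char_gen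
  by (intro bexI[OF _ aut_pow_mem[OF gen_mem]]) auto

lemma rcosets_stabilizer: "rcosets\<^bsub>G\<^esub> Ust = char_coset ` {0..<int p}"
proof
  show "rcosets\<^bsub>G\<^esub> Ust \<subseteq> char_coset ` {0..<int p}"
    unfolding RCOSETS_def using coset_stabilizer a_char_range by auto
  show "char_coset ` {0..<int p} \<subseteq> rcosets\<^bsub>G\<^esub> Ust"
  proof
    fix C assume "C \<in> char_coset ` {0..<int p}"
    then obtain k where "k \<in> {0..<int p}" "C = char_coset k" by blast
    moreover from this obtain \<sigma> where "\<sigma> \<in> H" "a_char \<sigma> = k" using char_coset_nonempty by blast
    ultimately show "C \<in> rcosets\<^bsub>G\<^esub> Ust" unfolding RCOSETS_def using coset_stabilizer by auto
  qed
qed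

lemma inj_char_coset: "inj_on char_coset {0..<int p}"
proof (rule inj_onI)
  fix k l assume kl: "k \<in> {0..<int p}" "l \<in> {0..<int p}" "char_coset k = char_coset l"
  obtain \<sigma> where "\<sigma> \<in> H" "a_char \<sigma> = k" using char_coset_nonempty[OF kl(1)] by blast
  then have "\<sigma> \<in> char_coset l" using kl(3) by (auto simp: char_coset_def)
  then show "k = l" using \<open>a_char \<sigma> = k\<close> by (simp add: char_coset_def)
qed

lemma card_rcosets_stabilizer: "card (rcosets\<^bsub>G\<^esub> Ust) = p"
  unfolding rcosets_stabilizer by (simp add: card_image[OF inj_char_coset])

lemma char_coset_mult:
  assumes k: "k \<in> {0..<int p}" and s: "\<sigma> \<in> H"
  shows "char_coset k #>\<^bsub>G\<^esub> \<sigma> = char_coset ((k + a_char \<sigma>) mod int p)"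
proof -
  obtain \<tau> where t: "\<tau> \<in> H" "a_char \<tau> = k" using char_coset_nonempty[OF k] by blast
  have "char_coset k #>\<^bsub>G\<^esub> \<sigma> = (Ust #>\<^bsub>G\<^esub> \<tau>) #>\<^bsub>G\<^esub> \<sigma>" using coset_stabilizer[OF t(1)] t(2) by simp
  also have "\<dots> = Ust #>\<^bsub>G\<^esub> (\<tau> \<otimes>\<^bsub>G\<^esub> \<sigma>)"
    by (rule group.coset_mult_assoc[OF group_G]) (use t s stabilizer_subset in auto)
  also have "\<dots> = char_coset ((k + a_char \<sigma>) mod int p)"
    unfolding G_mult[OF t(1) s] coset_stabilizer[OF compose_mem[OF t(1) s]] a_char_compose[OF t(1) s] t(2) ..
  finally show ?thesis .
qed

lemma normal_stabilizer: "Ust \<lhd> G"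
  unfolding group.normal_inv_iff[OF group_G]
proof (intro conjI ballI)
  show "subgroup Ust G"
  proof (rule group.subgroupI[OF group_G])
    show "Ust \<subseteq> carrier G" using stabilizer_subset by simp
    show "Ust \<noteq> {}" using U.id_mem by blast
    fix \<sigma> assume s: "\<sigma> \<in> Ust"
    then have sH: "\<sigma> \<in> H" using stabilizer_subset by auto
    show "inv\<^bsub>G\<^esub> \<sigma> \<in> Ust" unfolding inv_G[OF sH] by (rule U.inverse_aut_mem[OF s])
    fix \<tau> assume t: "\<tau> \<in> Ust"
    then have tH: "\<tau> \<in> H" using stabilizer_subset by auto
    show "\<sigma> \<otimes>\<^bsub>G\<^esub> \<tau> \<in> Ust" unfolding G_mult[OF sH tH] by (rule U.compose_mem[OF s t])
  qed
  fix \<sigma> \<tau> assume "\<sigma> \<in> carrier G" and t: "\<tau> \<in> Ust"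
  then have s: "\<sigma> \<in> H" and tH: "\<tau> \<in> H" using stabilizer_subset by auto
  note c = compose_mem[OF s tH] inverse_aut_mem[OF s]
  have "a_char \<tau> = 0" using t tH stabilizer_iff_kummer_char by simp
  then have "a_char (compose \<Omega> (compose \<Omega> \<sigma> \<tau>) (inverse_aut \<sigma>)) = 0"
    unfolding a_char_compose[OF c] a_char_compose[OF s tH] a_char_inverse[OF s] by (simp add: mod_simps)
  then show "\<sigma> \<otimes>\<^bsub>G\<^esub> \<tau> \<otimes>\<^bsub>G\<^esub> inv\<^bsub>G\<^esub> \<sigma> \<in> Ust"
    unfolding inv_G[OF s] G_mult[OF s tH] G_mult[OF c] using stabilizer_iff_kummer_char[OF compose_mem[OF c]] by simp
qed

lemma bij_betw_mod_shift: "bij_betw (\<lambda>k. (k + m) mod int p) {0..<int p} {0..<int p}"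
proof -
  have "inj_on (\<lambda>k. (k + m) mod int p) {0..<int p}"
  proof (rule inj_onI)
    fix k l assume kl: "k \<in> {0..<int p}" "l \<in> {0..<int p}" "(k + m) mod int p = (l + m) mod int p"
    then have "k mod int p = l mod int p" by (metis add_diff_cancel_right' mod_diff_left_eq)
    then show "k = l" using kl by simp
  qed
  moreover from this have "(\<lambda>k. (k + m) mod int p) ` {0..<int p} = {0..<int p}"
    by (intro endo_inj_surj) auto
  ultimately show ?thesis by (simp add: bij_betw_def)
qed

lemma bij_betw_mod_neg: "bij_betw (\<lambda>k. (- k) mod int p) {0..<int p} {0..<int p}"
proof -
  have "inj_on (\<lambda>k. (- k) mod int p) {0..<int p}"
  proof (rule inj_onI)
    fix k l assume kl: "k \<in> {0..<int p}" "l \<in> {0..<int p}" "(- k) mod int p = (- l) mod int p"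
    then have "k mod int p = l mod int p" by (metis minus_minus mod_minus_eq)
    then show "k = l" using kl by simp
  qed
  moreover from this have "(\<lambda>k. (- k) mod int p) ` {0..<int p} = {0..<int p}"
    by (intro endo_inj_surj) auto
  ultimately show ?thesis by (simp add: bij_betw_def)
qed

text \<open>
  Write \<open>r(C)\<close> for the representatives. For \<open>\<xi>\<^sup>p = y\<close>, the element \<open>\<beta> = \<Prod>\<^sub>C r(C)\<^sup>-\<^sup>1 \<xi>\<close> is a
  \<open>p\<close>-th root of the norm of \<open>y\<close>, and \<open>g \<beta> / \<beta>\<close> is the value of the corestricted character at \<open>g\<close>.
\<close>

theorem cores_kappa:
  assumes y: "y \<in> L" "y \<noteq> 0"
  shows "cochain_cores p G Ust 1 (UK.kappa y) = kappa (partial_norm y p)"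
proof -
  define N where "N = partial_norm y p"
  have N: "N \<in> fixed_field" "N \<noteq> 0" unfolding N_def using partial_norm_p_mem partial_norm_neq_0 y by auto
  define r where "r k = coset_rep (char_coset k)" for k
  have r: "r k \<in> H" "a_char (r k) = k" if k: "k \<in> {0..<int p}" for k
  proof -
    obtain \<sigma> where "\<sigma> \<in> char_coset k" using char_coset_nonempty[OF k] by (auto simp: char_coset_def)
    then have "r k \<in> char_coset k" unfolding r_def coset_rep_def by (rule someI[of "\<lambda>r. r \<in> char_coset k"])
    then show "r k \<in> H" "a_char (r k) = k" by (auto simp: char_coset_def)
  qed
  obtain \<xi> where \<xi>: "\<xi> ^ p = y" using nth_root_exists[OF p_gt_0] by blast
  have \<xi>m: "\<xi> \<in> \<Omega>" using root_closed[of \<xi>] \<xi> L_subset_Omega[OF y(1)] by simp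
  define b where "b k = inverse_aut (r k) \<xi>" for k
  have bm: "b k \<in> \<Omega>" if "k \<in> {0..<int p}" for k
    unfolding b_def by (rule aut_mem[OF inverse_aut_mem[OF r(1)[OF that]] \<xi>m])
  define \<beta> where "\<beta> = (\<Prod>k\<in>{0..<int p}. b k)"
  have \<beta>N: "\<beta> ^ p = N"
  proof -
    \<comment> \<open>\<open>r k\<close> has character value k, so its inverse acts on L as
      gen^(-k). Negation permutes the residues, and the product over k becomes the norm.\<close>
    have bp: "b k ^ p = (gen ^^ nat ((- k) mod int p)) y" if k: "k \<in> {0..<int p}" for k
    proof -
      have "b k ^ p = inverse_aut (r k) y"
        using aut_power[OF inverse_aut_mem[OF r(1)[OF k]] \<xi>m, of p] \<xi> by (simp add: b_def)
      then show ?thesis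
        using aut_eq_gen_pow[OF inverse_aut_mem[OF r(1)[OF k]] y(1)] a_char_inverse[OF r(1)[OF k]] r(2)[OF k] by simp
    qed
    have "\<beta> ^ p = (\<Prod>k\<in>{0..<int p}. b k ^ p)" unfolding \<beta>_def by (rule prod_power_distrib)
    also have "\<dots> = (\<Prod>k\<in>{0..<int p}. (gen ^^ nat ((- k) mod int p)) y)"
      by (rule prod.cong[OF refl bp])
    also have "\<dots> = (\<Prod>k\<in>{0..<int p}. (gen ^^ nat k) y)"
      by (rule prod.reindex_bij_betw[OF bij_betw_mod_neg])
    also have "\<dots> = (\<Prod>k<p. (gen ^^ k) y)"
      by (rule prod.reindex_bij_witness[of _ int nat]) auto
    finally show ?thesis by (simp add: N_def partial_norm_def)
  qed
  \<comment> \<open>For the coset C with value k this is r(C) g r(Cg)^-1, the argument of the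
    cochain in the corestriction formula.\<close>
  define e where "e g k = compose \<Omega> (compose \<Omega> (r k) g) (inverse_aut (r ((k + a_char g) mod int p)))" for g k
  have kmod: "(k + m) mod int p \<in> {0..<int p}" for k m by simp
  have eU: "e g k \<in> Ust" if g: "g \<in> H" and k: "k \<in> {0..<int p}" for g k
  proof -
    note c = compose_mem[OF r(1)[OF k] g] inverse_aut_mem[OF r(1)[OF kmod[of k "a_char g"]]]
    have "a_char (e g k) = 0"
      unfolding e_def a_char_compose[OF c] a_char_compose[OF r(1)[OF k] g] a_char_inverse[OF r(1)[OF kmod]]
        r(2)[OF k] r(2)[OF kmod] by (simp add: mod_simps)
    moreover have "e g k \<in> H" unfolding e_def by (intro compose_mem c)
    ultimately show ?thesis using stabilizer_iff_kummer_char by simp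
  qed
  have main: "kummer_char N g = (\<Sum>k\<in>{0..<int p}. kummer_char y (e g k)) mod int p" if g: "g \<in> H" for g
  proof (rule kummer_char_unique[OF \<beta>N N g])
    \<comment> \<open>Applying r(C)^-1 to e \<xi> gives g applied to the factor of the coset Cg,
      while e lies in the stabilizer and multiplies \<xi> by a power of \<zeta>.\<close>
    have fac: "g (b ((k + a_char g) mod int p)) = \<zeta> powi kummer_char y (e g k) * b k" if k: "k \<in> {0..<int p}" for k
    proof -
      have "e g k \<xi> = r k (g (b ((k + a_char g) mod int p)))"
        using \<xi>m aut_mem[OF inverse_aut_mem[OF r(1)[OF kmod]] \<xi>m] by (simp add: e_def compose_def b_def)
      then have "inverse_aut (r k) (e g k \<xi>) = g (b ((k + a_char g) mod int p))"
        using inverse_aut(2)[OF r(1)[OF k] aut_mem[OF g bm[OF kmod]]] by simp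
      moreover have "e g k \<xi> = \<zeta> powi kummer_char y (e g k) * \<xi>"
        by (rule U.kummer_char(1)[OF \<xi> y eU[OF g k]])
      moreover have "inverse_aut (r k) (\<zeta> powi kummer_char y (e g k) * \<xi>) = \<zeta> powi kummer_char y (e g k) * b k"
        using aut_mult[OF inverse_aut_mem[OF r(1)[OF k]] zeta_powi_mem \<xi>m] aut_zeta_powi[OF inverse_aut_mem[OF r(1)[OF k]]]
        by (simp add: b_def)
      ultimately show ?thesis by simp
    qed
    have "g \<beta> = (\<Prod>k\<in>{0..<int p}. g (b k))" unfolding \<beta>_def by (rule aut_prod[OF g bm])
    \<comment> \<open>Right multiplication by g permutes the cosets, that is, shifts the residues by
      \<open>a_char g\<close>.\<close>
    also have "\<dots> = (\<Prod>k\<in>{0..<int p}. g (b ((k + a_char g) mod int p)))"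
      by (rule prod.reindex_bij_betw[OF bij_betw_mod_shift, symmetric])
    also have "\<dots> = (\<Prod>k\<in>{0..<int p}. \<zeta> powi kummer_char y (e g k) * b k)"
      by (rule prod.cong[OF refl fac])
    also have "\<dots> = (\<Prod>k\<in>{0..<int p}. \<zeta> powi kummer_char y (e g k)) * \<beta>"
      by (simp add: prod.distrib \<beta>_def)
    also have "(\<Prod>k\<in>{0..<int p}. \<zeta> powi kummer_char y (e g k)) = \<zeta> powi (\<Sum>k\<in>{0..<int p}. kummer_char y (e g k))"
    proof -
      have "finite A \<Longrightarrow> (\<Prod>k\<in>A. \<zeta> powi f k) = \<zeta> powi (\<Sum>k\<in>A. f k)" for A :: "int set" and f
        by (induction A rule: finite_induct) (auto simp: zeta_powi_add)
      then show ?thesis by simp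
    qed
    finally show "g \<beta> = \<zeta> powi (\<Sum>k\<in>{0..<int p}. kummer_char y (e g k)) * \<beta>" .
  qed
  show ?thesis
  proof (rule extensionalityI[of _ "powers G 1"])
    fix x assume x: "x \<in> powers G 1"
    then obtain g where xg: "x = pt g" and g: "g \<in> H" unfolding powers_1 by blast
    have one: "\<one>\<^bsub>G\<^esub> = (\<lambda>x\<in>\<Omega>. x)" by (simp add: BijGroup_def)
    have oneg: "\<one>\<^bsub>G\<^esub> \<otimes>\<^bsub>G\<^esub> g = g" by (rule group.is_monoid[OF group_G, THEN monoid.l_one]) (simp add: g)
    have summand: "UK.kappa y (\<lambda>i\<in>{..<1}.
        coset_rep (char_coset k #>\<^bsub>G\<^esub> partial_product G x i) \<otimes>\<^bsub>G\<^esub> x i \<otimes>\<^bsub>G\<^esub>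
        inv\<^bsub>G\<^esub> (coset_rep (char_coset k #>\<^bsub>G\<^esub> partial_product G x (Suc i)))) = kummer_char y (e g k)"
      if k: "k \<in> {0..<int p}" for k
    proof -
      have c1: "char_coset k #>\<^bsub>G\<^esub> \<one>\<^bsub>G\<^esub> = char_coset k"
        by (rule group.coset_mult_one[OF group_G]) (auto simp: char_coset_def)
      have pp: "partial_product G x 0 = \<one>\<^bsub>G\<^esub>" "partial_product G x (Suc 0) = g" by (simp_all only: partial_product.simps xg pt_0 oneg)
      have "(\<lambda>i\<in>{..<1}. coset_rep (char_coset k #>\<^bsub>G\<^esub> partial_product G x i) \<otimes>\<^bsub>G\<^esub> x i \<otimes>\<^bsub>G\<^esub>
        inv\<^bsub>G\<^esub> (coset_rep (char_coset k #>\<^bsub>G\<^esub> partial_product G x (Suc i)))) = pt (e g k)"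
        unfolding pt_def
      proof (rule restrict_ext)
        fix i assume "i \<in> {..<1::nat}"
        then have i: "i = 0" by simp
        note c = compose_mem[OF r(1)[OF k] g] inverse_aut_mem[OF r(1)[OF kmod[of k "a_char g"]]]
        show "coset_rep (char_coset k #>\<^bsub>G\<^esub> partial_product G x i) \<otimes>\<^bsub>G\<^esub> x i \<otimes>\<^bsub>G\<^esub>
          inv\<^bsub>G\<^esub> (coset_rep (char_coset k #>\<^bsub>G\<^esub> partial_product G x (Suc i))) = e g k"
          unfolding i xg pp[unfolded xg] c1 char_coset_mult[OF k g] r_def[symmetric] pt_0
            inv_G[OF r(1)[OF kmod]] G_mult[OF r(1)[OF k] g] G_mult[OF c] e_def ..
      qed
      then show ?thesis unfolding UK.kappa_def using UK.cochain1_pt[OF eU[OF g k]] by (simp only: UK.pt_def pt_def)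
    qed
    have "cochain_cores p G Ust 1 (UK.kappa y) x = (\<Sum>C\<in>char_coset ` {0..<int p}. UK.kappa y (\<lambda>i\<in>{..<1}.
        coset_rep (C #>\<^bsub>G\<^esub> partial_product G x i) \<otimes>\<^bsub>G\<^esub> x i \<otimes>\<^bsub>G\<^esub>
        inv\<^bsub>G\<^esub> (coset_rep (C #>\<^bsub>G\<^esub> partial_product G x (Suc i))))) mod int p"
      unfolding cochain_cores_def rcosets_stabilizer using x by (simp only: restrict_apply' if_True)
    also have "\<dots> = (\<Sum>k\<in>{0..<int p}. kummer_char y (e g k)) mod int p"
      by (rule arg_cong[where f = "\<lambda>s. s mod int p"], subst sum.reindex[OF inj_char_coset],
          rule sum.cong[OF refl], unfold comp_def, rule summand)
    also have "\<dots> = kappa N x" using main[OF g] unfolding kappa_def xg cochain1_pt[OF g] by simp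
    finally show "cochain_cores p G Ust 1 (UK.kappa y) x = kappa (partial_norm y p) x" unfolding N_def .
  qed (simp_all add: cochain_cores_def kappa_def cochain1_def)
qed

theorem corestriction_kappa:
  assumes "y \<in> L" "y \<noteq> 0"
  shows "corestriction p G T Ust 1 {UK.kappa y} = {kappa (partial_norm y p)}"
proof -
  have "corestriction p G T Ust 1 {UK.kappa y} = cochain_class p G T 1 (kappa (partial_norm y p))"
    unfolding corestriction_def using cores_kappa[OF assms] by simp
  also have "\<dots> = {kappa (partial_norm y p)}"
    unfolding kappa_def by (rule cochain_class_1)
      (use kummer_char_range partial_norm_p_mem partial_norm_neq_0 assms in auto)
  finally show ?thesis .
qed

end

section \<open>Quadratic extensions\<close>

lemma represented_iff: "x \<in> represented K a \<longleftrightarrow> x \<noteq> 0 \<and> (\<exists>u\<in>K. \<exists>v\<in>K. x = u ^ 2 - a * v ^ 2)"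
  by (auto simp: represented_def)

context
  fixes K :: "'c::field set"
  assumes K: "is_subfield K" and two: "(2 :: 'c) \<noteq> 0"
begin

lemma two_mem: "2 \<in> K"
  using is_subfield_of_nat[OF K, of 2] by simp

lemma represented_square:
  assumes "d \<in> K" "d \<noteq> 0" "b \<in> K" "b \<noteq> 0"
  shows "b \<in> represented K (d ^ 2)"
  unfolding represented_iff
proof (intro conjI bexI)
  \<comment> \<open>X^2 - d^2 Y^2 factors as (X - dY)(X + dY); the witnesses solve X - dY = 1 and X
    + dY = b.\<close>
  show "b = ((b + 1) / 2) ^ 2 - d ^ 2 * ((b - 1) / (2 * d)) ^ 2"
  proof -
    have "d ^ 2 * ((b - 1) / (2 * d)) ^ 2 = ((b - 1) / 2) ^ 2" using assms(2) by (simp add: power_divide power_mult_distrib)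
    moreover have "((b + 1) / 2) ^ 2 - ((b - 1) / 2) ^ 2 = ((b + 1) / 2 - (b - 1) / 2) * ((b + 1) / 2 + (b - 1) / 2)"
      by (simp add: power2_eq_square algebra_simps)
    moreover have "(b + 1) / 2 - (b - 1) / 2 = 1" "(b + 1) / 2 + (b - 1) / 2 = b"
      using two by (simp_all flip: add_divide_distrib diff_divide_distrib)
    ultimately show ?thesis by simp
  qed
qed (use assms two_mem in \<open>auto intro!: is_subfield_closed[OF K]\<close>)

text \<open>Solving b = u^2 - a v^2 for a, after division by v^2, exchanges the roles of a and b. If
  v = 0 then b is a square and X^2 - b Y^2 represents everything nonzero.\<close>

lemma represented_sym:
  assumes a: "a \<in> K" "a \<noteq> 0" and b: "b \<in> represented K a"
  shows "a \<in> represented K b"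
proof -
  obtain u v where uv: "u \<in> K" "v \<in> K" "b = u ^ 2 - a * v ^ 2" "b \<noteq> 0" using b unfolding represented_iff by blast
  show ?thesis
  proof (cases "v = 0")
    case True
    then have "b = u ^ 2" "u \<noteq> 0" using uv by auto
    then show ?thesis using represented_square[OF uv(1) _ a] by simp
  next
    case False
    have "a = (u / v) ^ 2 - b * (1 / v) ^ 2" using False uv(3) by (simp add: power_divide field_simps)
    moreover have "u / v \<in> K" "1 / v \<in> K" using uv by (auto intro: is_subfield_closed[OF K])
    ultimately show ?thesis unfolding represented_iff using a(2) by blast
  qed
qed

text \<open>The values are norms of elements u + v sqrt a; the witnesses are the coordinates of a
  product of two such elements.\<close>

lemma represented_mult:
  assumes "a \<in> K" "b \<in> represented K a" "c \<in> represented K a"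
  shows "b * c \<in> represented K a"
proof -
  obtain u v where uv: "u \<in> K" "v \<in> K" "b = u ^ 2 - a * v ^ 2" "b \<noteq> 0" using assms(2) unfolding represented_iff by blast
  obtain x y where xy: "x \<in> K" "y \<in> K" "c = x ^ 2 - a * y ^ 2" "c \<noteq> 0" using assms(3) unfolding represented_iff by blast
  have "b * c = (u * x + a * v * y) ^ 2 - a * (u * y + v * x) ^ 2"
    unfolding uv(3) xy(3) by (simp add: power2_eq_square algebra_simps)
  moreover have "u * x + a * v * y \<in> K" "u * y + v * x \<in> K"
    using uv xy assms(1) by (auto intro!: is_subfield_closed[OF K])
  moreover have "b * c \<noteq> 0" using uv xy by simp
  ultimately show ?thesis unfolding represented_iff by blast
qed

text \<open>Symmetry of representation turns universality of one form into a condition over all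
  quadratic extensions, which matches the p-radical and is visibly multiplicative.\<close>

lemma kaplansky_radical_iff:
  "b \<in> kaplansky_radical K \<longleftrightarrow> b \<in> K - {0} \<and> (\<forall>a\<in>K - {0}. b \<in> represented K a)"
proof -
  have sub: "represented K b \<subseteq> K - {0}" if "b \<in> K" for b
    using that unfolding represented_iff subset_iff by (auto intro!: is_subfield_closed[OF K])
  show ?thesis
  proof
    assume b: "b \<in> kaplansky_radical K"
    then have bK: "b \<in> K" "b \<noteq> 0" "represented K b = K - {0}" by (auto simp: kaplansky_radical_def)
    then show "b \<in> K - {0} \<and> (\<forall>a\<in>K - {0}. b \<in> represented K a)" using represented_sym by auto
  next
    assume b: "b \<in> K - {0} \<and> (\<forall>a\<in>K - {0}. b \<in> represented K a)"
    have "K - {0} \<subseteq> represented K b"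
    proof
      fix a assume "a \<in> K - {0}"
      then show "a \<in> represented K b" using b represented_sym[of a b] by auto
    qed
    then show "b \<in> kaplansky_radical K" using b sub[of b] by (auto simp: kaplansky_radical_def)
  qed
qed

lemma kaplansky_radical_mult:
  "b \<in> kaplansky_radical K \<Longrightarrow> c \<in> kaplansky_radical K \<Longrightarrow> b * c \<in> kaplansky_radical K"
  unfolding kaplansky_radical_iff using represented_mult by (auto intro: is_subfield_closed[OF K])

lemma kaplansky_radical_square:
  assumes "d \<in> K" "d \<noteq> 0" shows "d ^ 2 \<in> kaplansky_radical K"
  unfolding kaplansky_radical_iff
proof (intro conjI ballI)
  fix a assume "a \<in> K - {0}"
  have "d ^ 2 = d ^ 2 - a * 0 ^ 2" by simp
  then show "d ^ 2 \<in> represented K a" unfolding represented_iff using assms is_subfield_0[OF K] by (metis power_not_zero)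
qed (use assms in \<open>auto intro: is_subfield_closed[OF K]\<close>)

end

section \<open>Norms and radicals for p = 2\<close>

context automorphism_group
begin

context
  assumes p2: "p = 2"
begin

lemma two_neq_0: "(2 :: 'c) \<noteq> 0"
  using p_neq_0 p2 by simp

lemma zeta_eq: "\<zeta> = - 1"
proof -
  have "\<zeta> ^ 2 = 1" using zeta_pow p2 by simp
  moreover have "\<zeta> ^ 1 \<noteq> 1" using zeta p2 unfolding primitive_root_of_unity_def by fastforce
  ultimately show ?thesis by (auto simp: power2_eq_1_iff)
qed

end

end

context kummer_extension
begin

context
  assumes p2: "p = 2"
begin

lemma gen_alpha_2: "gen \<alpha> = - \<alpha>"
  using gen_alpha zeta_eq[OF p2] by simp

lemma partial_norm_2: "partial_norm w p = w * gen w"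
proof -
  have "partial_norm w p = partial_norm w 2" using arg_cong[OF p2, of "partial_norm w"] .
  then show ?thesis by (simp add: partial_norm_def numeral_2_eq_2)
qed

lemma gen_gen: "x \<in> L \<Longrightarrow> gen (gen x) = x"
  using gen_pow_p[of x] arg_cong[OF p2, of "\<lambda>n. (gen ^^ n) x"] by (simp add: numeral_2_eq_2)

lemma L_iff: "x \<in> L \<longleftrightarrow> (\<exists>u\<in>fixed_field. \<exists>v\<in>fixed_field. x = u + v * \<alpha>)"
proof
  assume "x \<in> L"
  then obtain c where c: "\<And>i. i < p \<Longrightarrow> c i \<in> fixed_field" "x = (\<Sum>i<p. c i * \<alpha> ^ i)"
    using L_decomposition by metis
  have "x = c 0 + c 1 * \<alpha>" using c(2) by (simp add: p2 numeral_2_eq_2)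
  moreover have "c 0 \<in> fixed_field" "c 1 \<in> fixed_field" using c(1) p2 by auto
  ultimately show "\<exists>u\<in>fixed_field. \<exists>v\<in>fixed_field. x = u + v * \<alpha>" by blast
next
  assume "\<exists>u\<in>fixed_field. \<exists>v\<in>fixed_field. x = u + v * \<alpha>"
  then obtain u v where "u \<in> fixed_field" "v \<in> fixed_field" "x = u + v * \<alpha>" by blast
  then show "x \<in> L" using fixed_subset_L alpha_mem_L
    by (auto intro!: is_subfield_add[OF U.subfield_fixed] is_subfield_mult[OF U.subfield_fixed])
qed

lemma norm_formula:
  assumes "u \<in> fixed_field" "v \<in> fixed_field"
  shows "(u + v * \<alpha>) * gen (u + v * \<alpha>) = u ^ 2 - \<alpha> ^ p * v ^ 2"
proof -
  have uv: "u \<in> \<Omega>" "v \<in> \<Omega>" "gen u = u" "gen v = v" using assms gen_mem by (auto simp: fixed_field_iff)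
  have g: "gen (u + v * \<alpha>) = u - v * \<alpha>"
    using uv alpha_mem gen_alpha_2 by (simp add: aut_add[OF gen_mem] aut_mult[OF gen_mem] Omega_closed)
  have a: "\<alpha> ^ p = \<alpha> * \<alpha>" by (simp add: p2 power2_eq_square)
  show ?thesis unfolding g a by (simp add: power2_eq_square algebra_simps)
qed

lemma norm_image_eq_represented:
  "field_norm fixed_field L ` (L - {0}) = represented fixed_field (\<alpha> ^ p)"
proof
  have fn: "field_norm fixed_field L w = w * gen w" if "w \<in> L" for w
    using field_norm_L[OF that] partial_norm_2[of w] by (simp add: partial_norm_def)
  show "field_norm fixed_field L ` (L - {0}) \<subseteq> represented fixed_field (\<alpha> ^ p)"
  proof
    fix x assume "x \<in> field_norm fixed_field L ` (L - {0})"
    then obtain w where w: "w \<in> L" "w \<noteq> 0" "x = w * gen w" using fn by auto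
    then obtain u v where uv: "u \<in> fixed_field" "v \<in> fixed_field" "w = u + v * \<alpha>" using L_iff by blast
    have "x \<noteq> 0" using w gen_pow_neq_0[of w 1] by simp
    then show "x \<in> represented fixed_field (\<alpha> ^ p)"
      using norm_formula[OF uv(1,2)] uv w(3) unfolding represented_iff by metis
  qed
  show "represented fixed_field (\<alpha> ^ p) \<subseteq> field_norm fixed_field L ` (L - {0})"
  proof
    fix x assume "x \<in> represented fixed_field (\<alpha> ^ p)"
    then obtain u v where uv: "u \<in> fixed_field" "v \<in> fixed_field" "x = u ^ 2 - \<alpha> ^ p * v ^ 2" "x \<noteq> 0"
      unfolding represented_iff by blast
    define w where "w = u + v * \<alpha>"
    have w: "w \<in> L" unfolding w_def L_iff using uv by blast
    have x: "x = w * gen w" using norm_formula[OF uv(1,2)] uv(3) by (simp add: w_def)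
    then show "x \<in> field_norm fixed_field L ` (L - {0})" using w uv(4) fn[OF w]
      by (intro image_eqI[of _ _ w]) auto
  qed
qed

end

end

lemma (in automorphism_group) p_radical_eq_kaplansky_radical:
  assumes p2: "p = 2" shows "p_radical p fixed_field = kaplansky_radical fixed_field"
proof (rule Set.set_eqI)
  fix b
  note S = subfield_fixed two_neq_0[OF p2]
  have norm_iff: "b \<in> field_norm fixed_field (adjoin fixed_field \<alpha>) ` (adjoin fixed_field \<alpha> - {0}) \<longleftrightarrow>
      b \<in> represented fixed_field a"
    if b: "b \<in> fixed_field - {0}" and a: "a \<in> fixed_field - {0}" and \<alpha>: "\<alpha> ^ p = a" for a \<alpha>
  proof (cases "\<alpha> \<in> fixed_field")
    \<comment> \<open>A root in the fixed field makes the extension trivial and the form X^2 - a Y^2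
      hyperbolic, so both conditions hold for every b.\<close>
    case True
    have "b = field_norm fixed_field fixed_field b" using b field_norm_self[OF subfield_fixed, of b] by simp
    then have "b \<in> field_norm fixed_field (adjoin fixed_field \<alpha>) ` (adjoin fixed_field \<alpha> - {0})"
      unfolding adjoin_self[OF subfield_fixed True] using b by (intro image_eqI) auto
    moreover have "\<alpha> \<noteq> 0" using a \<alpha> by (auto simp: power_0_left)
    then have "b \<in> represented fixed_field a" using represented_square[OF S True] b \<alpha> p2 by auto
    ultimately show ?thesis by simp
  next
    case False
    interpret kummer_extension p \<zeta> \<Omega> H \<alpha> by unfold_locales (use False a \<alpha> in auto)
    show ?thesis using norm_image_eq_represented[OF p2] \<alpha> unfolding L_eq_adjoin[symmetric] by simp
  qed
  show "b \<in> p_radical p fixed_field \<longleftrightarrow> b \<in> kaplansky_radical fixed_field"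
    unfolding kaplansky_radical_iff[OF S]
  proof
    assume b: "b \<in> p_radical p fixed_field"
    then have bK: "b \<in> fixed_field - {0}" by (simp add: p_radical_def)
    have "b \<in> represented fixed_field a" if a: "a \<in> fixed_field - {0}" for a
    proof -
      obtain \<alpha> where \<alpha>: "\<alpha> ^ p = a" using nth_root_exists[OF p_gt_0] by blast
      then have "b \<in> field_norm fixed_field (adjoin fixed_field \<alpha>) ` (adjoin fixed_field \<alpha> - {0})"
        using b a unfolding p_radical_def by blast
      then show ?thesis using norm_iff[OF bK a \<alpha>] by simp
    qed
    then show "b \<in> fixed_field - {0} \<and> (\<forall>a\<in>fixed_field - {0}. b \<in> represented fixed_field a)" using bK by blast
  next
    assume b: "b \<in> fixed_field - {0} \<and> (\<forall>a\<in>fixed_field - {0}. b \<in> represented fixed_field a)"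
    show "b \<in> p_radical p fixed_field"
      unfolding p_radical_def
    proof (intro CollectI conjI ballI allI impI)
      fix a \<alpha> assume "a \<in> fixed_field - {0}" "\<alpha> ^ p = a"
      then show "b \<in> field_norm fixed_field (adjoin fixed_field \<alpha>) ` (adjoin fixed_field \<alpha> - {0})"
        using norm_iff[of a \<alpha>] b by blast
    qed (use b in blast)
  qed
qed

section \<open>The norm condition shared by the two properties\<close>

context krull_kummer
begin

context
  assumes p2: "p = 2"
begin

text \<open>The square c^2 expresses that \<open>kappa\<close> sees elements only up to squares; on
  the field side c becomes the factor from K in the H-condition.\<close>

definition norm_onto_radical :: bool where
  "norm_onto_radical \<longleftrightarrow> (\<forall>r\<in>kaplansky_radical fixed_field. \<exists>y\<in>kaplansky_radical L.
     \<exists>c\<in>fixed_field - {0}. r = c ^ 2 * (y * gen y))"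

lemmas S_K = subfield_fixed two_neq_0[OF p2]
lemmas S_L = U.subfield_fixed two_neq_0[OF p2]

lemma norm_mem: assumes "y \<in> L" "y \<noteq> 0" shows "y * gen y \<in> fixed_field" "y * gen y \<noteq> 0"
  using partial_norm_p_mem[OF assms(1)] partial_norm_neq_0[OF assms, of p] unfolding partial_norm_2[OF p2] by auto

text \<open>
  If \<open>y = u\<^sup>2 - b v\<^sup>2\<close> over \<open>L\<close> with \<open>b \<in> K\<close>, the norm of \<open>y\<close> to \<open>K\<close> is again represented by
  \<open>X\<^sup>2 - b Y\<^sup>2\<close>, because norms are transitive in \<open>L(\<surd>b)\<close>; the identity below makes this explicit.
\<close>

lemma norm_kaplansky_radical:
  assumes y: "y \<in> kaplansky_radical L" shows "y * gen y \<in> kaplansky_radical fixed_field"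
proof -
  have yL: "y \<in> L" "y \<noteq> 0" using y unfolding kaplansky_radical_iff[OF S_L] by auto
  note g = U.subfield_fixed field_embedding_mono[OF emb[OF gen_mem] U.fixed_field_subset]
  have gL: "gen x \<in> L" if "x \<in> L" for x by (rule aut_mem_L[OF gen_mem that])
  have "y * gen y \<in> represented fixed_field b" if b: "b \<in> fixed_field - {0}" for b
  proof -
    have bL: "b \<in> L" and gb: "gen b = b" using b fixed_subset_L gen_mem by (auto simp: fixed_field_iff)
    have "y \<in> represented L b" using y b bL unfolding kaplansky_radical_iff[OF S_L] by auto
    then obtain u v where uv: "u \<in> L" "v \<in> L" "y = u ^ 2 - b * v ^ 2" unfolding represented_iff by blast
    have gy: "gen y = gen u ^ 2 - b * gen v ^ 2"
      unfolding uv(3) using uv bL gb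
      by (simp add: emb_diff[OF g] emb_mult[OF g] emb_power[OF g] is_subfield_closed[OF U.subfield_fixed])
    \<comment> \<open>m + n sqrt b is the product of u + v sqrt b with its conjugate
      \<open>gen u + gen v\<close> sqrt b, that is, its norm down to K(sqrt b).\<close>
    define m n where "m = u * gen u + b * (v * gen v)" and "n = u * gen v + v * gen u"
    have "y * gen y = m ^ 2 - b * n ^ 2"
      unfolding gy unfolding uv(3) m_def n_def by (simp add: power2_eq_square algebra_simps)
    moreover have "m \<in> fixed_field" "n \<in> fixed_field"
    proof -
      note cl = is_subfield_add[OF U.subfield_fixed] is_subfield_mult[OF U.subfield_fixed] gL uv(1,2) bL
      have "gen m = m" unfolding m_def
        by (simp only: emb_add[OF g] emb_mult[OF g] gen_gen[OF p2] cl gb mult.commute[of "gen _"])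
      then show "m \<in> fixed_field" by (intro fixed_by_gen) (simp only: m_def cl)
      have "gen n = n" unfolding n_def
        by (simp only: emb_add[OF g] emb_mult[OF g] gen_gen[OF p2] cl mult.commute[of "gen _"] add.commute)
      then show "n \<in> fixed_field" by (intro fixed_by_gen) (simp only: n_def cl)
    qed
    ultimately show ?thesis using norm_mem[OF yL] unfolding represented_iff by blast
  qed
  then show ?thesis unfolding kaplansky_radical_iff[OF S_K] using norm_mem[OF yL] by blast
qed

text \<open>The witness t = 1 + gen z satisfies gen t = z t and fails only when it vanishes, that is
  for z = -1; there \<alpha> itself serves, since gen \<alpha> = - \<alpha>.\<close>

lemma hilbert_90:
  assumes z: "z \<in> L" "z * gen z = 1"
  obtains t where "t \<in> L" "t \<noteq> 0" "z = gen t / t"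
proof (cases "z = - 1")
  case True
  then have "z = gen \<alpha> / \<alpha>" using gen_alpha_2[OF p2] alpha_neq_0 by simp
  then show ?thesis using that alpha_mem_L alpha_neq_0 by blast
next
  case False
  define t where "t = 1 + gen z"
  have gz: "gen z \<in> L" by (rule aut_mem_L[OF gen_mem z(1)])
  have tL: "t \<in> L" unfolding t_def by (intro is_subfield_closed[OF U.subfield_fixed] gz)
  have gt: "gen t = z * t"
  proof -
    have "gen t = 1 + z" unfolding t_def
      using aut_add[OF gen_mem _ L_subset_Omega[OF gz], of 1] aut_1[OF gen_mem] gen_gen[OF p2 z(1)]
      by (simp add: Omega_closed)
    also have "\<dots> = z * t" using z(2) by (simp add: t_def algebra_simps)
    finally show ?thesis .
  qed
  have "t \<noteq> 0"
  proof
    assume "t = 0"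
    then have "gen z = - 1" by (simp add: t_def add_eq_0_iff)
    then show False using z(2) False by (metis minus_minus mult_minus1_right)
  qed
  then show ?thesis using that tL gt by simp
qed

text \<open>One inclusion always holds, as norms of radical elements and squares lie in the radical.
  For the other, an element with radical norm is divided by a radical element of L and an element of
  K so that the quotient has norm 1.\<close>

theorem H_condition_iff:
  "{x \<in> L - {0}. field_norm fixed_field L x \<in> kaplansky_radical fixed_field} =
     {r * c | r c. r \<in> kaplansky_radical L \<and> c \<in> fixed_field - {0}} \<longleftrightarrow> norm_onto_radical"
  (is "?A = ?B \<longleftrightarrow> _")
proof -
  have fn: "field_norm fixed_field L w = w * gen w" if "w \<in> L" for w
    using field_norm_L[OF that] partial_norm_2[OF p2, of w] by (simp add: partial_norm_def)
  note g = U.subfield_fixed field_embedding_mono[OF emb[OF gen_mem] U.fixed_field_subset]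
  have kL: "y \<in> L \<and> y \<noteq> 0" if "y \<in> kaplansky_radical L" for y using that unfolding kaplansky_radical_iff[OF S_L] by auto
  have cfix: "c \<in> L \<and> c \<noteq> 0 \<and> gen c = c" if "c \<in> fixed_field - {0}" for c
    using that fixed_subset_L gen_mem by (auto simp: fixed_field_iff)
  have norm_mult: "(y * c) * gen (y * c) = c ^ 2 * (y * gen y)" if "y \<in> L" "c \<in> fixed_field - {0}" for y c
    using that cfix[OF that(2)] by (simp add: emb_mult[OF g] power2_eq_square)
  have BA: "?B \<subseteq> ?A"
  proof
    fix x assume "x \<in> ?B"
    then obtain y c where yc: "x = y * c" "y \<in> kaplansky_radical L" "c \<in> fixed_field - {0}" by blast
    have xL: "x \<in> L - {0}" using kL[OF yc(2)] cfix[OF yc(3)] yc(1) by (simp add: is_subfield_mult[OF U.subfield_fixed])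
    have "x * gen x \<in> kaplansky_radical fixed_field"
      unfolding yc(1) norm_mult[OF conjunct1[OF kL[OF yc(2)]] yc(3)]
      using yc by (intro kaplansky_radical_mult[OF S_K] kaplansky_radical_square[OF S_K] norm_kaplansky_radical) auto
    then show "x \<in> ?A" using xL fn by simp
  qed
  show ?thesis
  proof
    assume AB: "?A = ?B"
    show norm_onto_radical
      unfolding norm_onto_radical_def
    proof
      fix r assume r: "r \<in> kaplansky_radical fixed_field"
      then have "r \<in> represented fixed_field (\<alpha> ^ p)"
        unfolding kaplansky_radical_iff[OF S_K] using alpha_pow alpha_pow_neq_0 by auto
      then obtain x where x: "x \<in> L - {0}" "r = field_norm fixed_field L x"
        unfolding norm_image_eq_represented[OF p2, symmetric] by blast
      then have "x \<in> ?B" using r AB by blast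
      then obtain y c where yc: "x = y * c" "y \<in> kaplansky_radical L" "c \<in> fixed_field - {0}" by blast
      have "r = c ^ 2 * (y * gen y)" using x fn norm_mult[OF conjunct1[OF kL[OF yc(2)]] yc(3)] yc(1) by simp
      then show "\<exists>y\<in>kaplansky_radical L. \<exists>c\<in>fixed_field - {0}. r = c ^ 2 * (y * gen y)" using yc by blast
    qed
  next
    assume sur: norm_onto_radical
    have "?A \<subseteq> ?B"
    proof
      fix x assume "x \<in> ?A"
      then have x: "x \<in> L" "x \<noteq> 0" "x * gen x \<in> kaplansky_radical fixed_field" using fn by auto
      then obtain y c where yc: "y \<in> kaplansky_radical L" "c \<in> fixed_field - {0}" "x * gen x = c ^ 2 * (y * gen y)"
        using sur unfolding norm_onto_radical_def by blast
      have y: "y \<in> L" "y \<noteq> 0" using kL yc by auto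
      have c: "c \<in> L" "c \<noteq> 0" "gen c = c" using cfix[OF yc(2)] by auto
      define z where "z = x / (y * c)"
      have zL: "z \<in> L" unfolding z_def using x y c by (auto intro!: is_subfield_closed[OF U.subfield_fixed])
      have "gen (y * c) \<noteq> 0" "y * c \<in> L" using y c emb_eq_0_iff[OF g, of "y * c"] by (auto simp: is_subfield_mult[OF U.subfield_fixed])
      then have "z * gen z = (x * gen x) / ((y * c) * gen (y * c))"
        unfolding z_def using x(1) by (simp add: emb_divide[OF g])
      also have "\<dots> = 1" unfolding norm_mult[OF y(1) yc(2)] yc(3)[symmetric]
        using norm_mem[OF x(1,2)] by simp
      finally obtain t where t: "t \<in> L" "t \<noteq> 0" "z = gen t / t" using hilbert_90[OF zL] by metis
      \<comment> \<open>gen t / t is rewritten as t^-2 times t gen t: the square goes to the radical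
        of L, the norm of t to K.\<close>
      have "x = (y * (inverse t) ^ 2) * (c * (t * gen t))"
        using t y c unfolding z_def by (simp add: field_simps power2_eq_square)
      moreover have "y * (inverse t) ^ 2 \<in> kaplansky_radical L"
        using t by (intro kaplansky_radical_mult[OF S_L] yc kaplansky_radical_square[OF S_L] is_subfield_inverse[OF U.subfield_fixed]) auto
      moreover have "c * (t * gen t) \<in> fixed_field - {0}"
        using norm_mem[OF t(1,2)] yc(2) by (simp add: is_subfield_mult[OF subfield_fixed])
      ultimately show "x \<in> ?B" by blast
    qed
    then show "?A = ?B" using BA by blast
  qed
qed

text \<open>Corestriction acts on Kummer classes as the norm, and \<open>kappa\<close> determines
  its argument exactly up to squares, which is the freedom of c in
  \<open>norm_onto_radical\<close>.\<close>

theorem kijima_nishi_condition_iff: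
  "corestriction p G T Ust 1 ` group_radical p (G\<lparr>carrier := Ust\<rparr>) (subtopology T Ust) = group_radical p G T
    \<longleftrightarrow> norm_onto_radical"
proof -
  have radU: "group_radical p (G\<lparr>carrier := Ust\<rparr>) (subtopology T Ust) = (\<lambda>y. {UK.kappa y}) ` kaplansky_radical L"
    using UK.group_radical_eq U.p_radical_eq_kaplansky_radical[OF p2] by simp
  have rad: "group_radical p G T = (\<lambda>r. {kappa r}) ` kaplansky_radical fixed_field"
    using group_radical_eq p_radical_eq_kaplansky_radical[OF p2] by simp
  have kL: "y \<in> L \<and> y \<noteq> 0" if "y \<in> kaplansky_radical L" for y using that unfolding kaplansky_radical_iff[OF S_L] by auto
  have kK: "r \<in> fixed_field \<and> r \<noteq> 0" if "r \<in> kaplansky_radical fixed_field" for r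
    using that unfolding kaplansky_radical_iff[OF S_K] by auto
  have "corestriction p G T Ust 1 ` (\<lambda>y. {UK.kappa y}) ` kaplansky_radical L = (\<lambda>y. {kappa (y * gen y)}) ` kaplansky_radical L"
    unfolding image_image
  proof (rule image_cong[OF refl])
    fix y assume "y \<in> kaplansky_radical L"
    then show "corestriction p G T Ust 1 {UK.kappa y} = {kappa (y * gen y)}"
      using corestriction_kappa[of y] kL partial_norm_2[OF p2] by simp
  qed
  then have "corestriction p G T Ust 1 ` group_radical p (G\<lparr>carrier := Ust\<rparr>) (subtopology T Ust) = group_radical p G T
    \<longleftrightarrow> (\<lambda>y. {kappa (y * gen y)}) ` kaplansky_radical L = (\<lambda>r. {kappa r}) ` kaplansky_radical fixed_field"
    unfolding radU rad by simp
  also have "\<dots> \<longleftrightarrow> norm_onto_radical"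
  proof
    assume e: "(\<lambda>y. {kappa (y * gen y)}) ` kaplansky_radical L = (\<lambda>r. {kappa r}) ` kaplansky_radical fixed_field"
    show norm_onto_radical
      unfolding norm_onto_radical_def
    proof
      fix r assume r: "r \<in> kaplansky_radical fixed_field"
      then have "{kappa r} \<in> (\<lambda>y. {kappa (y * gen y)}) ` kaplansky_radical L" unfolding e by (rule imageI)
      then obtain y where y: "y \<in> kaplansky_radical L" "kappa r = kappa (y * gen y)" by blast
      then obtain d where "d \<in> fixed_field - {0}" "r = d ^ p * (y * gen y)"
        using kappa_eq_iff[of r "y * gen y"] kK[OF r] kL[OF y(1)] norm_mem by blast
      then show "\<exists>y\<in>kaplansky_radical L. \<exists>c\<in>fixed_field - {0}. r = c ^ 2 * (y * gen y)" using y(1) p2 by blast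
    qed
  next
    assume sur: norm_onto_radical
    show "(\<lambda>y. {kappa (y * gen y)}) ` kaplansky_radical L = (\<lambda>r. {kappa r}) ` kaplansky_radical fixed_field"
    proof
      show "(\<lambda>y. {kappa (y * gen y)}) ` kaplansky_radical L \<subseteq> (\<lambda>r. {kappa r}) ` kaplansky_radical fixed_field"
        using norm_kaplansky_radical by blast
      show "(\<lambda>r. {kappa r}) ` kaplansky_radical fixed_field \<subseteq> (\<lambda>y. {kappa (y * gen y)}) ` kaplansky_radical L"
      proof
        fix \<alpha> assume "\<alpha> \<in> (\<lambda>r. {kappa r}) ` kaplansky_radical fixed_field"
        then obtain r where r: "r \<in> kaplansky_radical fixed_field" "\<alpha> = {kappa r}" by blast
        then obtain y c where yc: "y \<in> kaplansky_radical L" "c \<in> fixed_field - {0}" "r = c ^ 2 * (y * gen y)"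
          using sur unfolding norm_onto_radical_def by blast
        have "kappa r = kappa (y * gen y)"
          using kappa_eq_iff[of r "y * gen y"] kK[OF r(1)] kL[OF yc(1)] norm_mem yc(2,3) p2 by blast
        then show "\<alpha> \<in> (\<lambda>y. {kappa (y * gen y)}) ` kaplansky_radical L" using r(2) yc(1) by blast
      qed
    qed
  qed
  finally show ?thesis .
qed

end

end

section \<open>Subgroups of index two and the equivalence over the base field\<close>

context krull_group
begin

text \<open>For index two the indicator of the complement of U is a continuous character. A square
  root of its Kummer element is fixed exactly by U.\<close>

lemma exists_kummer_stabilizer:
  assumes p2: "p = 2" and U: "openin T U" "U \<lhd> G" "card (rcosets\<^bsub>G\<^esub> U) = 2"
  obtains \<alpha> where "\<alpha> ^ p \<in> fixed_field" "\<alpha> \<notin> fixed_field" "U = root_stabilizer \<alpha>"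
proof -
  have sub: "subgroup U G" by (rule normal_imp_subgroup[OF U(2)])
  then have UH: "U \<subseteq> H" using subgroup.subset by fastforce
  have Ucomp: "compose \<Omega> \<sigma> \<tau> \<in> U" if "\<sigma> \<in> U" "\<tau> \<in> U" for \<sigma> \<tau>
  proof -
    have "\<sigma> \<in> H" "\<tau> \<in> H" using that UH by auto
    then show ?thesis using subgroup.m_closed[OF sub that] by (simp only: G_mult)
  qed
  have Uinv: "inverse_aut \<sigma> \<in> U" if "\<sigma> \<in> U" for \<sigma>
    using subgroup.m_inv_closed[OF sub that] inv_G[of \<sigma>] that UH by auto
  have Ucomp_iff: "compose \<Omega> \<sigma> \<tau> \<in> U \<longleftrightarrow> \<tau> \<in> U" "compose \<Omega> \<tau> \<sigma> \<in> U \<longleftrightarrow> \<tau> \<in> U"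
    if s: "\<sigma> \<in> U" and t: "\<tau> \<in> H" for \<sigma> \<tau>
  proof -
    have sH: "\<sigma> \<in> H" using s UH by auto
    have "compose \<Omega> (inverse_aut \<sigma>) (compose \<Omega> \<sigma> \<tau>) = \<tau>"
      using inverse_aut(2)[OF sH] aut_mem[OF t]
      by (intro aut_ext compose_mem inverse_aut_mem sH t) (auto simp: compose_def)
    then show "compose \<Omega> \<sigma> \<tau> \<in> U \<longleftrightarrow> \<tau> \<in> U" using Ucomp[OF Uinv[OF s], of "compose \<Omega> \<sigma> \<tau>"] Ucomp[OF s, of \<tau>] by metis
    have "compose \<Omega> (compose \<Omega> \<tau> \<sigma>) (inverse_aut \<sigma>) = \<tau>"
      using inverse_aut(1)[OF sH] aut_mem[OF inverse_aut_mem[OF sH]]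
      by (intro aut_ext compose_mem inverse_aut_mem sH t) (auto simp: compose_def)
    then show "compose \<Omega> \<tau> \<sigma> \<in> U \<longleftrightarrow> \<tau> \<in> U" using Ucomp[OF _ Uinv[OF s], of "compose \<Omega> \<tau> \<sigma>"] Ucomp[OF _ s, of \<tau>] by metis
  qed
  have coset_mem: "\<sigma> \<in> U #>\<^bsub>G\<^esub> \<sigma>" if "\<sigma> \<in> H" for \<sigma>
    using group.rcos_self[OF group_G, of \<sigma> U] that sub by simp
  have coset_in: "U #>\<^bsub>G\<^esub> \<sigma> \<in> rcosets\<^bsub>G\<^esub> U" if "\<sigma> \<in> H" for \<sigma>
    using that unfolding RCOSETS_def by auto
  define i where "i = (\<lambda>x\<in>\<Omega>. x)"
  have iH: "i \<in> H" unfolding i_def by (rule id_mem)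
  have Ui: "U #>\<^bsub>G\<^esub> i = U"
    using group.coset_mult_one[OF group_G, of U] UH by (simp add: BijGroup_def i_def)
  obtain A B where AB: "rcosets\<^bsub>G\<^esub> U = {A, B}" using U(3) by (auto simp: card_2_iff)
  have two: "U #>\<^bsub>G\<^esub> \<sigma> = U #>\<^bsub>G\<^esub> \<tau>" if st: "\<sigma> \<in> H - U" "\<tau> \<in> H - U" for \<sigma> \<tau>
  proof -
    have "U \<in> {A, B}" "U #>\<^bsub>G\<^esub> \<sigma> \<in> {A, B}" "U #>\<^bsub>G\<^esub> \<tau> \<in> {A, B}"
      using coset_in[OF iH] coset_in[of \<sigma>] coset_in[of \<tau>] st unfolding Ui AB by auto
    moreover have "U #>\<^bsub>G\<^esub> \<sigma> \<noteq> U" "U #>\<^bsub>G\<^esub> \<tau> \<noteq> U" using coset_mem[of \<sigma>] coset_mem[of \<tau>] st by auto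
    ultimately show ?thesis by auto
  qed
  \<comment> \<open>With only two cosets, a product \<sigma>\<tau> outside U would lie in the coset
    U\<tau>, which forces \<sigma> into U.\<close>
  have prod: "compose \<Omega> \<sigma> \<tau> \<in> U" if st: "\<sigma> \<in> H - U" "\<tau> \<in> H - U" for \<sigma> \<tau>
  proof (rule ccontr)
    assume n: "compose \<Omega> \<sigma> \<tau> \<notin> U"
    have sH: "\<sigma> \<in> H" and tH: "\<tau> \<in> H" using st by auto
    then have c: "compose \<Omega> \<sigma> \<tau> \<in> H - U" using n compose_mem by auto
    have "compose \<Omega> \<sigma> \<tau> \<in> U #>\<^bsub>G\<^esub> \<tau>" using coset_mem[of "compose \<Omega> \<sigma> \<tau>"] c two[OF c st(2)] by simp
    then obtain u where u: "u \<in> U" "compose \<Omega> \<sigma> \<tau> = u \<otimes>\<^bsub>G\<^esub> \<tau>" unfolding r_coset_def by blast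
    have uH: "u \<in> H" using u UH by auto
    have "\<sigma> = u"
    proof (rule aut_ext[OF sH uH])
      fix x assume x: "x \<in> \<Omega>"
      have "compose \<Omega> \<sigma> \<tau> (inverse_aut \<tau> x) = compose \<Omega> u \<tau> (inverse_aut \<tau> x)" using u(2) G_mult[OF uH tH] by simp
      then show "\<sigma> x = u x" using inverse_aut(1)[OF tH x] aut_mem[OF inverse_aut_mem[OF tH] x] by (simp add: compose_def)
    qed
    then show False using u(1) st by simp
  qed
  define f where "f \<sigma> = (if \<sigma> \<in> U then 0 else 1 :: int)" for \<sigma>
  have "\<zeta> powi f (compose \<Omega> \<sigma> \<tau>) = \<zeta> powi f \<sigma> * \<zeta> powi f \<tau>" if st: "\<sigma> \<in> H" "\<tau> \<in> H" for \<sigma> \<tau>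
  proof -
    have "f (compose \<Omega> \<sigma> \<tau>) = (f \<sigma> + f \<tau>) mod int p"
      using Ucomp_iff(1)[of \<sigma> \<tau>] Ucomp_iff(2)[of \<tau> \<sigma>] prod[of \<sigma> \<tau>] st p2 by (auto simp: f_def)
    then show ?thesis by (simp add: zeta_powi_mod flip: zeta_powi_add)
  qed
  moreover have "locally_constant f"
    unfolding locally_constant_def
  proof
    fix \<sigma> assume s: "\<sigma> \<in> H"
    \<comment> \<open>Openness is invoked at the identity; left translation by \<sigma> carries the
      neighbourhood to \<sigma>.\<close>
    have "i \<in> U" using coset_mem[OF iH] Ui by simp
    then obtain F where F: "finite F" "F \<subseteq> \<Omega>" "{\<tau> \<in> H. \<forall>x\<in>F. \<tau> x = i x} \<subseteq> U"
      using U(1) unfolding openin_T by blast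
    have "f \<tau> = f \<sigma>" if t: "\<tau> \<in> H" "\<forall>x\<in>F. \<tau> x = \<sigma> x" for \<tau>
    proof -
      define \<rho> where "\<rho> = compose \<Omega> (inverse_aut \<sigma>) \<tau>"
      have \<rho>H: "\<rho> \<in> H" unfolding \<rho>_def by (intro compose_mem inverse_aut_mem s t)
      have "\<rho> x = i x" if "x \<in> F" for x
        using that t(2) F(2) inverse_aut(2)[OF s, of x] by (auto simp: \<rho>_def compose_def i_def)
      then have "\<rho> \<in> U" using F(3) \<rho>H by blast
      moreover have "compose \<Omega> \<sigma> \<rho> = \<tau>"
        using inverse_aut(1)[OF s] aut_mem[OF t(1)]
        by (intro aut_ext compose_mem s \<rho>H t) (auto simp: \<rho>_def compose_def)
      ultimately have "\<tau> \<in> U \<longleftrightarrow> \<sigma> \<in> U" using Ucomp_iff(2)[OF _ s] by metis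
      then show ?thesis by (simp add: f_def)
    qed
    then show "\<exists>F. finite F \<and> F \<subseteq> \<Omega> \<and> (\<forall>\<tau>\<in>H. (\<forall>x\<in>F. \<tau> x = \<sigma> x) \<longrightarrow> f \<tau> = f \<sigma>)" using F(1,2) by blast
  qed
  ultimately obtain b where b: "b \<in> fixed_field" "b \<noteq> 0" "\<And>\<sigma>. \<sigma> \<in> H \<Longrightarrow> kummer_char b \<sigma> = f \<sigma>"
    by (rule kummer_char_surj[of f]) (auto simp: f_def p2)
  obtain \<alpha> where \<alpha>: "\<alpha> ^ p = b" using nth_root_exists[OF p_gt_0] by blast
  have "\<sigma> \<alpha> = \<alpha> \<longleftrightarrow> \<sigma> \<in> U" if "\<sigma> \<in> H" for \<sigma>
    using kummer_char_eq_0_iff[OF \<alpha> b(1,2) that] b(3)[OF that] by (simp add: f_def split: if_splits)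
  then have st: "U = root_stabilizer \<alpha>" unfolding root_stabilizer_def using UH by blast
  moreover have "\<alpha> \<notin> fixed_field"
  proof
    assume "\<alpha> \<in> fixed_field"
    then have "U = H" unfolding st root_stabilizer_def by (auto simp: fixed_field_iff)
    have "rcosets\<^bsub>G\<^esub> U \<subseteq> {U}"
    proof
      fix C assume "C \<in> rcosets\<^bsub>G\<^esub> U"
      then obtain \<sigma> where "\<sigma> \<in> U" "C = U #>\<^bsub>G\<^esub> \<sigma>" unfolding RCOSETS_def using \<open>U = H\<close> by auto
      then show "C \<in> {U}" using group.coset_join2[OF group_G, of \<sigma> U] sub UH by auto
    qed
    then have "card (rcosets\<^bsub>G\<^esub> U) \<le> 1" using card_mono[of "{U}"] by fastforce
    then show False using U(3) by simp
  qed
  ultimately show ?thesis using that \<alpha> b(1) by blast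
qed

text \<open>Both sides become the same condition quantified over all \<alpha> outside the fixed
  field with \<alpha>^2 in it: nonsquares supply such \<alpha> on one side, subgroups of index two
  on the other.\<close>

theorem H_conjecture_iff_kijima_nishi:
  assumes p2: "p = 2"
  shows "H_conjecture fixed_field \<longleftrightarrow> kijima_nishi p G T"
proof -
  have kk: "krull_kummer p \<zeta> \<Omega> H T \<alpha>" if "\<alpha> ^ p \<in> fixed_field" "\<alpha> \<notin> fixed_field" for \<alpha>
    by (intro krull_kummer.intro kummer_extension.intro kummer_extension_axioms.intro)
      (rule krull_group_axioms automorphism_group_axioms that)+
  define cond where "cond \<alpha> \<longleftrightarrow> corestriction p G T (root_stabilizer \<alpha>) 1 `
      group_radical p (G\<lparr>carrier := root_stabilizer \<alpha>\<rparr>) (subtopology T (root_stabilizer \<alpha>)) = group_radical p G T" for \<alpha>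
  have H: "{x \<in> adjoin fixed_field \<alpha> - {0}. field_norm fixed_field (adjoin fixed_field \<alpha>) x \<in> kaplansky_radical fixed_field} =
      {r * c | r c. r \<in> kaplansky_radical (adjoin fixed_field \<alpha>) \<and> c \<in> fixed_field - {0}} \<longleftrightarrow> cond \<alpha>"
    if a: "\<alpha> ^ p \<in> fixed_field" "\<alpha> \<notin> fixed_field" for \<alpha>
  proof -
    interpret krull_kummer p \<zeta> \<Omega> H T \<alpha> by (rule kk[OF a])
    show ?thesis using H_condition_iff[OF p2] kijima_nishi_condition_iff[OF p2]
      unfolding cond_def L_eq_adjoin by simp
  qed
  have "H_conjecture fixed_field \<longleftrightarrow> (\<forall>\<alpha>. \<alpha> ^ p \<in> fixed_field \<longrightarrow> \<alpha> \<notin> fixed_field \<longrightarrow> cond \<alpha>)"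
  proof
    assume hc: "H_conjecture fixed_field"
    show "\<forall>\<alpha>. \<alpha> ^ p \<in> fixed_field \<longrightarrow> \<alpha> \<notin> fixed_field \<longrightarrow> cond \<alpha>"
    proof (intro allI impI)
      fix \<alpha> assume a: "\<alpha> ^ p \<in> fixed_field" "\<alpha> \<notin> fixed_field"
      have "\<alpha> \<noteq> 0" using a(2) is_subfield_0[OF subfield_fixed] by auto
      then have 1: "\<alpha> ^ 2 \<in> fixed_field - {0}" using a(1) p2 by simp
      \<comment> \<open>A square root of \<alpha>^2 is \<alpha> or - \<alpha>, so \<alpha>^2 is a
        square in the fixed field only if \<alpha> lies there.\<close>
      have 2: "\<nexists>b. b \<in> fixed_field \<and> b ^ 2 = \<alpha> ^ 2"
        using a(2) is_subfield_uminus[OF subfield_fixed] unfolding power2_eq_iff by force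
      show "cond \<alpha>" using hc 1 2 H[OF a] unfolding H_conjecture_def by blast
    qed
  next
    assume c: "\<forall>\<alpha>. \<alpha> ^ p \<in> fixed_field \<longrightarrow> \<alpha> \<notin> fixed_field \<longrightarrow> cond \<alpha>"
    show "H_conjecture fixed_field"
      unfolding H_conjecture_def
    proof (intro ballI impI allI)
      fix a \<alpha> assume a: "a \<in> fixed_field - {0}" "\<nexists>b. b \<in> fixed_field \<and> b ^ 2 = a" "\<alpha> ^ 2 = a"
      then have 1: "\<alpha> ^ p \<in> fixed_field" "\<alpha> \<notin> fixed_field" using p2 by auto
      show "{x \<in> adjoin fixed_field \<alpha> - {0}. field_norm fixed_field (adjoin fixed_field \<alpha>) x \<in> kaplansky_radical fixed_field} =
        {r * c | r c. r \<in> kaplansky_radical (adjoin fixed_field \<alpha>) \<and> c \<in> fixed_field - {0}}"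
        using H[OF 1] c 1 by blast
    qed
  qed
  also have "\<dots> \<longleftrightarrow> kijima_nishi p G T"
  proof
    assume c: "\<forall>\<alpha>. \<alpha> ^ p \<in> fixed_field \<longrightarrow> \<alpha> \<notin> fixed_field \<longrightarrow> cond \<alpha>"
    show "kijima_nishi p G T"
      unfolding kijima_nishi_def
    proof (intro allI impI)
      fix U assume U: "openin T U \<and> U \<lhd> G \<and> card (rcosets\<^bsub>G\<^esub> U) = p"
      obtain \<alpha> where "\<alpha> ^ p \<in> fixed_field" "\<alpha> \<notin> fixed_field" "U = root_stabilizer \<alpha>"
        by (rule exists_kummer_stabilizer[OF p2, of U]) (use U p2 in auto)
      then show "corestriction p G T U 1 ` group_radical p (G\<lparr>carrier := U\<rparr>) (subtopology T U) = group_radical p G T"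
        using c unfolding cond_def by blast
    qed
  next
    assume kn: "kijima_nishi p G T"
    show "\<forall>\<alpha>. \<alpha> ^ p \<in> fixed_field \<longrightarrow> \<alpha> \<notin> fixed_field \<longrightarrow> cond \<alpha>"
    proof (intro allI impI)
      fix \<alpha> assume a: "\<alpha> ^ p \<in> fixed_field" "\<alpha> \<notin> fixed_field"
      interpret krull_kummer p \<zeta> \<Omega> H T \<alpha> by (rule kk[OF a])
      show "cond \<alpha>"
        using kn openin_stabilizer normal_stabilizer card_rcosets_stabilizer unfolding kijima_nishi_def cond_def by blast
    qed
  qed
  finally show ?thesis .
qed

end

theorem mainTheorem5:
  fixes K :: "'c::alg_closed_field set" and p :: nat
  assumes "Factorial_Ring.prime p"
    and "subfield K ring_of_type_algebra"
    and "\<exists>\<zeta>\<in>K. primitive_root_of_unity p \<zeta>"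
  shows "mod_powers p K (p_radical p K) \<cong>
           (cohomology p (absolute_galois_group K) (krull_topology K) 1)
             \<lparr>carrier := group_radical p (absolute_galois_group K) (krull_topology K)\<rparr>
         \<and> (p = 2 \<longrightarrow>
             mod_powers 2 K (kaplansky_radical K) \<cong>
               (cohomology 2 (absolute_galois_group K) (krull_topology K) 1)
                 \<lparr>carrier := group_radical 2 (absolute_galois_group K) (krull_topology K)\<rparr>
             \<and> (H_conjecture K \<longleftrightarrow>
                  kijima_nishi 2 (absolute_galois_group K) (krull_topology K)))"
proof -
  obtain \<zeta> where zeta: "primitive_root_of_unity p \<zeta>" "\<zeta> \<in> K" using assms(3) by blast
  interpret krull_group p \<zeta> "separable_closure K" "carrier (absolute_galois_group K)" "krull_topology K"
    by (rule krull_group_absolute_galois_group[OF assms(2,1) zeta])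
  have fixed: "fixed_field = K"
    unfolding fixed_field_def by (rule fixed_field_absolute_galois_group[OF assms(2)])
  have G: "G = absolute_galois_group K"
    by (simp add: absolute_galois_group_def)
  have "p_radical p K \<subseteq> K - {0}" by (auto simp: p_radical_def)
  then have iso: "mod_powers p K (p_radical p K) \<cong>
      (cohomology p (absolute_galois_group K) (krull_topology K) 1)
        \<lparr>carrier := group_radical p (absolute_galois_group K) (krull_topology K)\<rparr>"
    using radical_iso[of "p_radical p K"] group_radical_eq unfolding fixed G by simp
  moreover have "mod_powers 2 K (kaplansky_radical K) \<cong>
       (cohomology 2 (absolute_galois_group K) (krull_topology K) 1)
         \<lparr>carrier := group_radical 2 (absolute_galois_group K) (krull_topology K)\<rparr>
     \<and> (H_conjecture K \<longleftrightarrow> kijima_nishi 2 (absolute_galois_group K) (krull_topology K))" if p2: "p = 2"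
    using iso p_radical_eq_kaplansky_radical[OF p2] H_conjecture_iff_kijima_nishi[OF p2]
    unfolding fixed G unfolding p2 by simp
  ultimately show ?thesis by blast
qed

end
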